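(* Let $A$, $B$, $C$ be bounded self-adjoint operators on a separable complex Hilbert space $\mathcal{H}$ such that $[A,C]\in\mathcal{I}_1$, $[B,C]\in\mathcal{I}_1$, and $\|[e^{itA},e^{itC}]\|<1$ and $\|[e^{itB},e^{itC}]\|<1$ for all $t\in[0,1]$. Then $$\mathrm{Tr}\log\left(e^{iA}e^{iB}e^{iC}e^{-iB}e^{-iA}e^{-iC}\right)=\mathrm{Tr}\log\left(e^{iA}e^{iC}e^{-iA}e^{-iC}\right)+\mathrm{Tr}\log\left(e^{iB}e^{iC}e^{-iB}e^{-iC}\right).$$ If, in addition, $(e^{iA}-\mathbb{1})(e^{iC}-\mathbb{1})\in\mathcal{I}_1$ and $(e^{iB}-\mathbb{1})(e^{iC}-\mathbb{1})\in\mathcal{I}_1$, then $$\mathrm{Bott}(e^{iA}e^{iB},e^{iC})=\mathrm{Bott}(e^{iA},e^{iC})+\mathrm{Bott}(e^{iB},e^{iC}).$$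
   Context: $\mathcal{I}_1$ denotes the ideal of trace class operators in the bounded operators on $\mathcal{H}$; $\|\cdot\|$ is the operator norm and $[X,Y]=XY-YX$. $\log$ is the principal logarithm (branch cut on the negative real axis, $\log e^{i\theta}=i\theta$ for $\theta\in(-\pi,\pi)$), defined by the Dunford (holomorphic) functional calculus. Definition of the Bott index: for unitary operators $U,V$ on $\mathcal{H}$ with $(U-\mathbb{1})(V-\mathbb{1})\in\mathcal{I}_1$, $(V-\mathbb{1})(U-\mathbb{1})\in\mathcal{I}_1$ and $\|[U,V]\|<2$, $$\mathrm{Bott}(U,V):=\frac{1}{2\pi i}\mathrm{Tr}\log\left(UVU^*V^*\right).$$ The condition $\|[U,V]\|<2$ is equivalent to $-1\notin\sigma(UVU^*V^* )$; and if $[U,V]\in\mathcal{I}_1$ as well, then $\log(UVU^*V^* )$ is well defined and trace class. *)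

theory Defs
  imports "HOL-Complex_Analysis.Complex_Analysis"
begin

section \<open>Complex Hilbert spaces\<close>

class complex_vector = real_vector +
  fixes scaleC :: "complex \<Rightarrow> 'a \<Rightarrow> 'a" (infixr \<open>*\<^sub>C\<close> 75)
  assumes scaleC_add_right: "c *\<^sub>C (x + y) = c *\<^sub>C x + c *\<^sub>C y"
    and scaleC_add_left: "(c + d) *\<^sub>C x = c *\<^sub>C x + d *\<^sub>C x"
    and scaleC_scaleC: "c *\<^sub>C (d *\<^sub>C x) = (c * d) *\<^sub>C x"
    and scaleC_of_real: "complex_of_real r *\<^sub>C x = r *\<^sub>R x"

text \<open>The inner product is linear in the second argument. Completeness is part of \<^class>\<open>banach\<close>;
  positive definiteness follows from \<open>norm_eq_sqrt_cinner\<close> and the norm axioms. The zero space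
  is not excluded.\<close>

class complex_hilbert = complex_vector + banach +
  fixes cinner :: "'a \<Rightarrow> 'a \<Rightarrow> complex"
  assumes cinner_commute: "cinner x y = cnj (cinner y x)"
    and cinner_add_right: "cinner x (y + z) = cinner x y + cinner x z"
    and cinner_scaleC_right: "cinner x (c *\<^sub>C y) = c * cinner x y"
    and norm_eq_sqrt_cinner: "norm x = sqrt (Re (cinner x x))"

text \<open>An orthonormal basis is a maximal orthonormal set.\<close>

definition is_onb :: "'h::complex_hilbert set \<Rightarrow> bool" where
  "is_onb E \<longleftrightarrow>
     (\<forall>e\<in>E. norm e = 1) \<and> (\<forall>e\<in>E. \<forall>f\<in>E. e \<noteq> f \<longrightarrow> cinner e f = 0) \<and>
     (\<forall>x. (\<forall>e\<in>E. cinner e x = 0) \<longrightarrow> x = 0)"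


section \<open>The algebra of bounded complex-linear operators\<close>

text \<open>Multiplication is composition and the norm is the operator norm, inherited from
  \<^typ>\<open>'h \<Rightarrow>\<^sub>L 'h\<close>. The type is only an instance of \<^class>\<open>real_normed_algebra\<close> and
  \<^class>\<open>monoid_mult\<close>, not of \<^class>\<open>real_normed_algebra_1\<close>, because \<open>1 = 0\<close> on the zero space.\<close>

typedef (overloaded) ('h::complex_hilbert) bop =
  "{f :: 'h \<Rightarrow>\<^sub>L 'h. \<forall>c x. blinfun_apply f (c *\<^sub>C x) = c *\<^sub>C blinfun_apply f x}"
  morphisms blinfun_of_bop Bop
proof (rule exI, rule CollectI, intro allI)
  fix c and x :: 'h
  show "blinfun_apply id_blinfun (c *\<^sub>C x) = c *\<^sub>C blinfun_apply id_blinfun x"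
    by simp
qed

setup_lifting type_definition_bop

lemma scaleC_zero_right [simp]: "c *\<^sub>C (0::'a::complex_vector) = 0"
  using scaleC_add_right[of c "0::'a" 0] by simp

lemma scaleC_minus_right: "c *\<^sub>C (- x::'a::complex_vector) = - (c *\<^sub>C x)"
  using scaleC_add_right[of c x "- x"] by (simp add: eq_neg_iff_add_eq_0 add.commute)

lemma scaleC_diff_right: "c *\<^sub>C (x - y::'a::complex_vector) = c *\<^sub>C x - c *\<^sub>C y"
  using scaleC_add_right[of c x "- y"] by (simp add: scaleC_minus_right)

lemma scaleC_scaleR: "c *\<^sub>C (r *\<^sub>R x) = r *\<^sub>R (c *\<^sub>C (x::'a::complex_vector))"
  by (simp only: scaleC_of_real[symmetric] scaleC_scaleC mult.commute)

lemma cinner_scaleC_left: "cinner (c *\<^sub>C x) y = cnj c * cinner (x::'h::complex_hilbert) y"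
  by (metis cinner_commute cinner_scaleC_right complex_cnj_mult)

lemma norm_scaleC: "norm (c *\<^sub>C x) = cmod c * norm (x::'h::complex_hilbert)"
proof -
  have "cinner (c *\<^sub>C x) (c *\<^sub>C x) = of_real ((cmod c)\<^sup>2) * cinner x x"
    by (simp add: cinner_scaleC_right cinner_scaleC_left complex_norm_square[symmetric]
        mult.assoc[symmetric] mult.commute)
  then show ?thesis
    by (simp add: norm_eq_sqrt_cinner real_sqrt_mult)
qed

lemma bounded_linear_scaleC: "bounded_linear (\<lambda>x::'h::complex_hilbert. c *\<^sub>C x)"
  by (rule bounded_linear_intro[where K = "cmod c"])
    (simp_all add: scaleC_add_right scaleC_scaleR norm_scaleC mult.commute)

instantiation bop :: (complex_hilbert) "{real_normed_algebra, monoid_mult}"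
begin

lift_definition zero_bop :: "'a bop" is 0 by simp
lift_definition one_bop :: "'a bop" is id_blinfun by simp
lift_definition plus_bop :: "'a bop \<Rightarrow> 'a bop \<Rightarrow> 'a bop" is "(+)"
  by (simp add: blinfun.add_left scaleC_add_right)
lift_definition minus_bop :: "'a bop \<Rightarrow> 'a bop \<Rightarrow> 'a bop" is "(-)"
  by (simp add: blinfun.diff_left scaleC_diff_right)
lift_definition uminus_bop :: "'a bop \<Rightarrow> 'a bop" is uminus
  by (simp add: blinfun.minus_left scaleC_minus_right)
lift_definition times_bop :: "'a bop \<Rightarrow> 'a bop \<Rightarrow> 'a bop" is "(o\<^sub>L)" by simp
lift_definition scaleR_bop :: "real \<Rightarrow> 'a bop \<Rightarrow> 'a bop" is "(*\<^sub>R)"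
  by (simp add: blinfun.scaleR_left scaleC_scaleR)
lift_definition norm_bop :: "'a bop \<Rightarrow> real" is norm .
lift_definition sgn_bop :: "'a bop \<Rightarrow> 'a bop" is sgn
  by (simp add: sgn_div_norm blinfun.scaleR_left scaleC_scaleR)
lift_definition dist_bop :: "'a bop \<Rightarrow> 'a bop \<Rightarrow> real" is dist .

definition uniformity_bop :: "('a bop \<times> 'a bop) filter" where
  "uniformity_bop = (INF e\<in>{0<..}. principal {(x, y). dist x y < e})"

definition open_bop :: "'a bop set \<Rightarrow> bool" where
  "open_bop S = (\<forall>x\<in>S. \<forall>\<^sub>F (x', y) in uniformity. x' = x \<longrightarrow> y \<in> S)"

instance
proof
  fix a b c :: "'a bop" and r s :: real and S :: "'a bop set"
  show "a + b + c = a + (b + c)" by transfer (rule add.assoc)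
  show "a + b = b + a" by transfer (rule add.commute)
  show "0 + a = a" by transfer simp
  show "- a + a = 0" by transfer simp
  show "a - b = a + - b" by transfer simp
  show "a * b * c = a * (b * c)" by transfer (auto intro: blinfun_eqI)
  show "1 * a = a" by transfer (auto intro: blinfun_eqI)
  show "a * 1 = a" by transfer (auto intro: blinfun_eqI)
  show "(a + b) * c = a * c + b * c"
    by transfer (auto intro: blinfun_eqI simp: blinfun.add_left)
  show "a * (b + c) = a * b + a * c"
    by transfer (auto intro: blinfun_eqI simp: blinfun.add_left blinfun.add_right)
  show "r *\<^sub>R (a + b) = r *\<^sub>R a + r *\<^sub>R b" by transfer (rule scaleR_add_right)
  show "(r + s) *\<^sub>R a = r *\<^sub>R a + s *\<^sub>R a" by transfer (rule scaleR_add_left)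
  show "r *\<^sub>R s *\<^sub>R a = (r * s) *\<^sub>R a" by transfer (rule scaleR_scaleR)
  show "1 *\<^sub>R a = a" by transfer simp
  show "r *\<^sub>R a * b = r *\<^sub>R (a * b)"
    by transfer (auto intro: blinfun_eqI simp: blinfun.scaleR_left)
  show "a * r *\<^sub>R b = r *\<^sub>R (a * b)"
    by transfer (auto intro: blinfun_eqI simp: blinfun.scaleR_left blinfun.scaleR_right)
  show "dist a b = norm (a - b)" by transfer (rule dist_norm)
  show "sgn a = inverse (norm a) *\<^sub>R a" by transfer (rule sgn_div_norm)
  show "(norm a = 0) = (a = 0)" by transfer simp
  show "norm (a + b) \<le> norm a + norm b" by transfer (rule norm_triangle_ineq)
  show "norm (r *\<^sub>R a) = \<bar>r\<bar> * norm a" by transfer simp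
  show "norm (a * b) \<le> norm a * norm b" by transfer (rule norm_blinfun_compose)
  show "(uniformity :: ('a bop \<times> 'a bop) filter) =
      (INF e\<in>{0<..}. principal {(x, y). dist x y < e})"
    by (rule uniformity_bop_def)
  show "open S = (\<forall>x\<in>S. \<forall>\<^sub>F (x', y) in uniformity. x' = x \<longrightarrow> y \<in> S)"
    by (rule open_bop_def)
qed

end

instance bop :: (complex_hilbert) banach
proof
  fix X :: "nat \<Rightarrow> 'a bop"
  assume X: "Cauchy X"
  have "Cauchy (\<lambda>n. blinfun_of_bop (X n))"
    using X unfolding Cauchy_def by transfer
  then obtain L where L: "(\<lambda>n. blinfun_of_bop (X n)) \<longlonglongrightarrow> L"
    using convergent_eq_Cauchy by blast
  have lim: "(\<lambda>n. blinfun_of_bop (X n) x) \<longlonglongrightarrow> L x" for x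
    by (intro tendsto_intros L)
  have "L (c *\<^sub>C x) = c *\<^sub>C L x" for c x
  proof (rule LIMSEQ_unique[OF lim])
    have "(\<lambda>n. c *\<^sub>C blinfun_of_bop (X n) x) \<longlonglongrightarrow> c *\<^sub>C L x"
      by (rule bounded_linear.tendsto[OF bounded_linear_scaleC lim])
    moreover have "blinfun_of_bop (X n) (c *\<^sub>C x) = c *\<^sub>C blinfun_of_bop (X n) x" for n
      using blinfun_of_bop[of "X n"] by simp
    ultimately show "(\<lambda>n. blinfun_of_bop (X n) (c *\<^sub>C x)) \<longlonglongrightarrow> c *\<^sub>C L x"
      by simp
  qed
  then have "blinfun_of_bop (Bop L) = L"
    by (intro Bop_inverse) simp
  then have "X \<longlonglongrightarrow> Bop L"
    using L unfolding tendsto_iff by (simp add: dist_bop.rep_eq)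
  then show "convergent X"
    by (auto simp: convergent_def)
qed

lemma apply_Blinfun_scaleC: "blinfun_apply (Blinfun (\<lambda>x::'h::complex_hilbert. c *\<^sub>C x)) x = c *\<^sub>C x"
  by (simp add: bounded_linear_Blinfun_apply bounded_linear_scaleC)

instantiation bop :: (complex_hilbert) complex_vector
begin

lift_definition scaleC_bop :: "complex \<Rightarrow> 'a bop \<Rightarrow> 'a bop" is
  "\<lambda>c f. Blinfun (\<lambda>x. c *\<^sub>C x) o\<^sub>L f"
  by (simp add: apply_Blinfun_scaleC scaleC_scaleC mult.commute)

instance
proof
  fix a b :: "'a bop" and c d :: complex and r :: real
  show "c *\<^sub>C (a + b) = c *\<^sub>C a + c *\<^sub>C b"
    by transfer (rule blinfun_eqI, simp add: apply_Blinfun_scaleC blinfun.add_left scaleC_add_right)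
  show "(c + d) *\<^sub>C a = c *\<^sub>C a + d *\<^sub>C a"
    by transfer (rule blinfun_eqI, simp add: apply_Blinfun_scaleC blinfun.add_left scaleC_add_left)
  show "c *\<^sub>C d *\<^sub>C a = (c * d) *\<^sub>C a"
    by transfer (rule blinfun_eqI, simp add: apply_Blinfun_scaleC scaleC_scaleC)
  show "complex_of_real r *\<^sub>C a = r *\<^sub>R a"
    by transfer (rule blinfun_eqI, simp add: apply_Blinfun_scaleC blinfun.scaleR_left scaleC_of_real)
qed

end

definition bop_apply :: "'h::complex_hilbert bop \<Rightarrow> 'h \<Rightarrow> 'h" (infixr \<open>*\<^sub>V\<close> 70) where
  "T *\<^sub>V x = blinfun_apply (blinfun_of_bop T) x"

definition adj :: "'h::complex_hilbert bop \<Rightarrow> 'h bop" where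
  "adj T = (THE S. \<forall>x y. cinner (S *\<^sub>V x) y = cinner x (T *\<^sub>V y))"

definition selfadjoint :: "'h::complex_hilbert bop \<Rightarrow> bool" where
  "selfadjoint T \<longleftrightarrow> adj T = T"

definition unitary :: "'h::complex_hilbert bop \<Rightarrow> bool" where
  "unitary U \<longleftrightarrow> adj U * U = 1 \<and> U * adj U = 1"

definition commutator :: "'h::complex_hilbert bop \<Rightarrow> 'h bop \<Rightarrow> 'h bop" where
  "commutator X Y = X * Y - Y * X"

text \<open>This is the series that defines \<^const>\<open>exp\<close>, which is not available here for want of
  \<^class>\<open>real_normed_algebra_1\<close>.\<close>

definition op_exp :: "'h::complex_hilbert bop \<Rightarrow> 'h bop" where
  "op_exp T = (\<Sum>n. T ^ n /\<^sub>R fact n)"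


section \<open>Trace class operators\<close>

definition positive_op :: "'h::complex_hilbert bop \<Rightarrow> bool" where
  "positive_op T \<longleftrightarrow> (\<forall>x. cinner x (T *\<^sub>V x) \<in> \<real>\<^sub>\<ge>\<^sub>0)"

definition abs_op :: "'h::complex_hilbert bop \<Rightarrow> 'h bop" where
  "abs_op T = (THE P. positive_op P \<and> P * P = adj T * T)"

definition trace_class :: "'h::complex_hilbert bop \<Rightarrow> bool" where
  "trace_class T \<longleftrightarrow> (\<exists>E. is_onb E \<and> (\<lambda>e. cinner e (abs_op T *\<^sub>V e)) summable_on E)"

text \<open>The trace does not depend on the choice of the orthonormal basis. It is left unspecified
  outside the trace class, so that an equation between traces is not met by a default value.\<close>

definition op_trace :: "'h::complex_hilbert bop \<Rightarrow> complex" where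
  "op_trace T =
     (if trace_class T
      then infsum (\<lambda>e. cinner e (T *\<^sub>V e)) (SOME E. is_onb E)
      else undefined)"


section \<open>Holomorphic functional calculus\<close>

definition op_inverse :: "'h::complex_hilbert bop \<Rightarrow> 'h bop" where
  "op_inverse T = (THE S. S * T = 1 \<and> T * S = 1)"

definition op_spectrum :: "'h::complex_hilbert bop \<Rightarrow> complex set" where
  "op_spectrum T = {z. \<nexists>S. S * (z *\<^sub>C 1 - T) = 1 \<and> (z *\<^sub>C 1 - T) * S = 1}"

definition dunford_contour ::
    "complex set \<Rightarrow> 'h::complex_hilbert bop \<Rightarrow> (real \<Rightarrow> complex) \<Rightarrow> bool" where
  "dunford_contour D T \<gamma> \<longleftrightarrow>
     valid_path \<gamma> \<and> pathfinish \<gamma> = pathstart \<gamma> \<and> path_image \<gamma> \<subseteq> D - op_spectrum T \<and>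
     (\<forall>z\<in>op_spectrum T. winding_number \<gamma> z = 1) \<and> (\<forall>z. z \<notin> D \<longrightarrow> winding_number \<gamma> z = 0)"

text \<open>For \<open>f\<close> holomorphic on the open set \<open>D\<close> containing the spectrum of \<open>T\<close>, this is
  \<open>f(T) = 1/(2 \<pi> i) \<integral>\<^sub>\<gamma> f(z) (z - T)\<^sup>-\<^sup>1 dz\<close>, with the contour integral of an operator-valued function
  written out as in \<^const>\<open>has_contour_integral\<close>; it does not depend on the contour.
  A single closed path (rather than a cycle) suffices when \<open>D\<close> is simply connected, which is the
  only case used here.\<close>

definition dunford ::
    "(complex \<Rightarrow> complex) \<Rightarrow> complex set \<Rightarrow> 'h::complex_hilbert bop \<Rightarrow> 'h bop" where
  "dunford f D T =
     (let \<gamma> = (SOME \<gamma>. dunford_contour D T \<gamma>)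
      in (1 / (2 * of_real pi * \<i>)) *\<^sub>C
         integral {0..1} (\<lambda>t. (f (\<gamma> t) * vector_derivative \<gamma> (at t within {0..1})) *\<^sub>C
                               op_inverse (\<gamma> t *\<^sub>C 1 - T)))"

definition op_log :: "'h::complex_hilbert bop \<Rightarrow> 'h bop" where
  "op_log T = dunford Ln (- \<real>\<^sub>\<le>\<^sub>0) T"


section \<open>The Bott index\<close>

definition bott_pair :: "'h::complex_hilbert bop \<Rightarrow> 'h bop \<Rightarrow> bool" where
  "bott_pair U V \<longleftrightarrow> unitary U \<and> unitary V \<and>
     trace_class ((U - 1) * (V - 1)) \<and> trace_class ((V - 1) * (U - 1)) \<and>
     norm (commutator U V) < 2"

text \<open>Unspecified where the index is not defined: an identity between indices thus includes
  that the pairs involved are admissible.\<close>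

definition bott :: "'h::complex_hilbert bop \<Rightarrow> 'h bop \<Rightarrow> complex" where
  "bott U V =
     (if bott_pair U V
      then 1 / (2 * of_real pi * \<i>) * op_trace (op_log (U * V * adj U * adj V))
      else undefined)"

end

theory Submission
  imports Defs
begin

text \<open>Write \<open>U = e\<^sup>i\<^sup>A\<close>, \<open>V = e\<^sup>i\<^sup>B\<close>, \<open>W = e\<^sup>i\<^sup>C\<close>. The operator on the left-hand side is \<open>P Q\<close> with
  \<open>P = U (V W V\<^sup>* W\<^sup>*) U\<^sup>*\<close> and \<open>Q = U W U\<^sup>* W\<^sup>*\<close>, both in \<open>1 + \<I>\<^sub>1\<close> and at distance less than 1 from 1.
  So the theorem says that \<open>Tr log (P Q) = Tr log P + Tr log Q\<close>. Along \<open>P\<^sub>t = 1 + t (P - 1)\<close>,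
  \<open>Q\<^sub>t = 1 + t (Q - 1)\<close> the numbers \<open>\<le> 0\<close> stay out of the spectrum of \<open>P\<^sub>t Q\<^sub>t\<close>, and both sides have the
  same derivative because \<open>d Tr log T = Tr (T\<^sup>-\<^sup>1 dT)\<close>. For this the Dunford logarithm is rewritten as
  \<open>log T = \<integral>\<^sub>0\<^sup>1 (T - 1) (1 + s (T - 1))\<^sup>-\<^sup>1 ds\<close>.\<close>


section \<open>Inner products and orthonormal bases\<close>

lemma scaleC_one [simp]: "1 *\<^sub>C (x::'a::complex_vector) = x"
  using scaleC_of_real[of 1 x] by simp

lemma scaleC_zero_left [simp]: "0 *\<^sub>C (x::'a::complex_vector) = 0"
  using scaleC_of_real[of 0 x] by simp

lemma scaleC_minus_left: "(- c) *\<^sub>C (x::'a::complex_vector) = - (c *\<^sub>C x)"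
  using scaleC_add_left[of c "- c" x] by (simp add: add_eq_0_iff)

lemma scaleC_diff_left: "(c - d) *\<^sub>C (x::'a::complex_vector) = c *\<^sub>C x - d *\<^sub>C x"
  using scaleC_add_left[of c "- d" x] by (simp add: scaleC_minus_left)

lemma cinner_add_left: "cinner (x + y) z = cinner x z + cinner y z"
  by (subst (1 2 3) cinner_commute) (simp add: cinner_add_right)

lemma cinner_zero_right [simp]: "cinner x 0 = 0"
  using cinner_add_right[of x 0 0] by simp

lemma cinner_zero_left [simp]: "cinner 0 x = 0"
  using cinner_add_left[of 0 0 x] by simp

lemma cinner_minus_right: "cinner x (- y) = - cinner x y"
  using cinner_add_right[of x y "- y"] by (simp add: add_eq_0_iff)

lemma cinner_minus_left: "cinner (- x) y = - cinner x y"
  using cinner_add_left[of x "- x" y] by (simp add: add_eq_0_iff)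

lemma cinner_diff_right: "cinner x (y - z) = cinner x y - cinner x z"
  using cinner_add_right[of x y "- z"] by (simp add: cinner_minus_right)

lemma cinner_diff_left: "cinner (x - y) z = cinner x z - cinner y z"
  using cinner_add_left[of x "- y" z] by (simp add: cinner_minus_left)

lemma cinner_scaleR_right: "cinner x (r *\<^sub>R y) = of_real r * cinner x y"
  using cinner_scaleC_right[of x "of_real r" y] by (simp add: scaleC_of_real)

lemma cinner_scaleR_left: "cinner (r *\<^sub>R x) y = of_real r * cinner x y"
  using cinner_scaleC_left[of "of_real r" x y] by (simp add: scaleC_of_real)

lemma cinner_sum_right: "cinner x (sum f A) = (\<Sum>i\<in>A. cinner x (f i))"
  by (induction A rule: infinite_finite_induct) (simp_all add: cinner_add_right)

lemma cinner_sum_left: "cinner (sum f A) x = (\<Sum>i\<in>A. cinner (f i) x)"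
  by (induction A rule: infinite_finite_induct) (simp_all add: cinner_add_left)

lemmas cinner_linear =
  cinner_add_left cinner_add_right cinner_diff_left cinner_diff_right cinner_minus_left
  cinner_minus_right cinner_scaleC_left cinner_scaleC_right cinner_scaleR_left cinner_scaleR_right

lemma cinner_self: "cinner x x = of_real ((norm x)\<^sup>2)"
proof -
  have im: "Im (cinner x x) = 0"
    using arg_cong[OF cinner_commute[of x x], of Im] by simp
  have "Re (cinner x x) \<ge> 0"
    using norm_ge_zero[of x] unfolding norm_eq_sqrt_cinner by simp
  then have "Re (cinner x x) = (norm x)\<^sup>2"
    by (simp add: norm_eq_sqrt_cinner)
  then show ?thesis using im by (simp add: complex_eq_iff)
qed

lemma norm_add_sq: "(norm (x + y))\<^sup>2 = (norm x)\<^sup>2 + 2 * Re (cinner x y) + (norm y)\<^sup>2"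
proof -
  have "Re (cinner (x + y) (x + y)) = (norm x)\<^sup>2 + 2 * Re (cinner x y) + (norm y)\<^sup>2"
    using arg_cong[OF cinner_commute[of x y], of Re]
    by (simp add: cinner_add_left cinner_add_right cinner_self[of x] cinner_self[of y] del: of_real_power)
  then show ?thesis by (simp add: cinner_self del: of_real_power)
qed

lemma norm_diff_sq: "(norm (x - y))\<^sup>2 = (norm x)\<^sup>2 - 2 * Re (cinner x y) + (norm y)\<^sup>2"
  using norm_add_sq[of x "- y"] by (simp add: cinner_minus_right)

lemma Re_cinner_le: "Re (cinner x y) \<le> norm x * norm y"
proof -
  have "(norm (x + y))\<^sup>2 \<le> (norm x + norm y)\<^sup>2"
    by (intro power_mono norm_triangle_ineq norm_ge_zero)
  then show ?thesis by (simp add: norm_add_sq power2_sum)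
qed

lemma cmod_cinner_le: "cmod (cinner x y) \<le> norm x * norm y"
proof (cases "cinner x y = 0")
  case False
  let ?z = "cinner x y"
  define c where "c = cnj ?z / of_real (cmod ?z)"
  have c: "cmod c = 1" using False by (simp add: c_def norm_divide)
  have "c * ?z = of_real ((cmod ?z)\<^sup>2) / of_real (cmod ?z)"
    unfolding complex_norm_square c_def by (simp add: mult.commute)
  then have "c * ?z = of_real (cmod ?z)"
    using False by (simp add: power2_eq_square)
  then have "cmod (cinner x y) = Re (cinner x (c *\<^sub>C y))"
    by (simp add: cinner_scaleC_right)
  also have "\<dots> \<le> norm x * norm (c *\<^sub>C y)" by (rule Re_cinner_le)
  finally show ?thesis using c by (simp add: norm_scaleC)
qed (simp add: mult_nonneg_nonneg)

lemma cinner_ext: "(\<And>y. cinner y x = cinner y x') \<Longrightarrow> x = x'"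
  using cinner_self[of "x - x'"] by (simp add: cinner_diff_right)

lemma bounded_linear_cinner_right: "bounded_linear (\<lambda>y::'h::complex_hilbert. cinner x y)"
  by (rule bounded_linear_intro[where K = "norm x"])
    (use cmod_cinner_le[of x] in \<open>simp_all add: cinner_linear scaleR_conv_of_real mult.commute[of _ "norm x"]\<close>)

definition orthonormal :: "'h::complex_hilbert set \<Rightarrow> bool" where
  "orthonormal E \<longleftrightarrow> (\<forall>e\<in>E. norm e = 1) \<and> (\<forall>e\<in>E. \<forall>f\<in>E. e \<noteq> f \<longrightarrow> cinner e f = 0)"

lemma orthonormal_cinner: "orthonormal E \<Longrightarrow> e \<in> E \<Longrightarrow> f \<in> E \<Longrightarrow> cinner e f = (if e = f then 1 else 0)"
  by (auto simp: orthonormal_def cinner_self)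

lemma onb_orthonormal: "is_onb E \<Longrightarrow> orthonormal E"
  by (simp add: is_onb_def orthonormal_def)

lemma orthonormal_subset: "orthonormal E \<Longrightarrow> F \<subseteq> E \<Longrightarrow> orthonormal F"
  unfolding orthonormal_def by (meson subsetD)

lemma norm_sum_orthonormal:
  assumes "orthonormal F" "finite F"
  shows "(norm (\<Sum>e\<in>F. c e *\<^sub>C e))\<^sup>2 = (\<Sum>e\<in>F. (cmod (c e))\<^sup>2)"
proof -
  have "cinner (\<Sum>e\<in>F. c e *\<^sub>C e) (\<Sum>e\<in>F. c e *\<^sub>C e) = (\<Sum>e\<in>F. \<Sum>f\<in>F. cinner (c e *\<^sub>C e) (c f *\<^sub>C f))"
    by (simp only: cinner_sum_left) (simp only: cinner_sum_right)
  also have "\<dots> = (\<Sum>e\<in>F. \<Sum>f\<in>F. if f = e then c f * cnj (c e) else 0)"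
    by (intro sum.cong refl) (simp add: cinner_scaleC_left cinner_scaleC_right orthonormal_cinner[OF assms(1)])
  also have "\<dots> = (\<Sum>e\<in>F. c e * cnj (c e))"
    by (simp only: sum.delta[OF assms(2)]) simp
  also have "\<dots> = of_real (\<Sum>e\<in>F. (cmod (c e))\<^sup>2)"
    unfolding of_real_sum complex_norm_square ..
  finally show ?thesis unfolding cinner_self of_real_eq_iff .
qed

lemma bessel:
  assumes "orthonormal F" "finite F"
  shows "(\<Sum>e\<in>F. (cmod (cinner e x))\<^sup>2) \<le> (norm x)\<^sup>2"
proof -
  define s where "s = (\<Sum>e\<in>F. cinner e x *\<^sub>C e)"
  have s2: "(norm s)\<^sup>2 = (\<Sum>e\<in>F. (cmod (cinner e x))\<^sup>2)"
    unfolding s_def by (rule norm_sum_orthonormal[OF assms])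
  have "cinner x s = (\<Sum>e\<in>F. of_real ((cmod (cinner e x))\<^sup>2))"
    unfolding s_def cinner_sum_right cinner_scaleC_right complex_norm_square
    by (intro sum.cong refl arg_cong2[of _ _ _ _ "(*)"] cinner_commute)
  then have "Re (cinner x s) = (norm s)\<^sup>2" by (simp add: s2 del: of_real_power)
  then have "(norm (x - s))\<^sup>2 = (norm x)\<^sup>2 - (norm s)\<^sup>2"
    by (simp add: norm_diff_sq)
  then show ?thesis using s2 zero_le_power2[of "norm (x - s)"] by linarith
qed

lemma summable_on_if_small_tails:
  fixes f :: "'a \<Rightarrow> 'b::banach"
  assumes "\<And>e. e > 0 \<Longrightarrow> \<exists>F0. finite F0 \<and> F0 \<subseteq> A \<and> (\<forall>F. finite F \<longrightarrow> F \<subseteq> A - F0 \<longrightarrow> norm (sum f F) < e)"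
  shows "f summable_on A"
proof -
  have "cauchy_filter (filtermap (sum f) (finite_subsets_at_top A))"
    unfolding cauchy_filter_metric_filtermap
  proof (intro allI impI)
    fix e :: real assume "e > 0"
    then obtain F0 where F0: "finite F0" "F0 \<subseteq> A"
      and small: "\<And>F. finite F \<Longrightarrow> F \<subseteq> A - F0 \<Longrightarrow> norm (sum f F) < e/2"
      using assms[of "e/2"] by auto
    define P where "P F \<longleftrightarrow> finite F \<and> F0 \<subseteq> F \<and> F \<subseteq> A" for F
    have close: "norm (sum f F - sum f F0) < e/2" if "P F" for F
      using small[of "F - F0"] that F0 unfolding P_def by (auto simp: sum_diff)
    have "dist (sum f F) (sum f F') < e" if "P F" "P F'" for F F'
      using dist_triangle2[of "sum f F" "sum f F'" "sum f F0"] close[OF that(1)] close[OF that(2)]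
      unfolding dist_norm by linarith
    moreover have "eventually P (finite_subsets_at_top A)"
      unfolding eventually_finite_subsets_at_top P_def using F0 by blast
    ultimately show "\<exists>P. eventually P (finite_subsets_at_top A) \<and>
        (\<forall>x y. P x \<and> P y \<longrightarrow> dist (sum f x) (sum f y) < e)" by blast
  qed
  moreover have "complete (UNIV :: 'b set)"
    by (meson Cauchy_convergent UNIV_I complete_def convergent_def)
  ultimately obtain L where "(sum f \<longlongrightarrow> L) (finite_subsets_at_top A)"
    using complete_uniform[where S = UNIV] by (force simp add: filterlim_def)
  then show ?thesis using has_sum_def summable_on_def by blast
qed

lemma small_tails_nonneg:
  fixes f :: "'a \<Rightarrow> real"
  assumes "f summable_on A" "\<And>x. x \<in> A \<Longrightarrow> f x \<ge> 0" "e > 0"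
  obtains F0 where "finite F0" "F0 \<subseteq> A" "\<And>F. finite F \<Longrightarrow> F \<subseteq> A - F0 \<Longrightarrow> sum f F < e"
proof -
  obtain S where S: "(f has_sum S) A" using assms(1) by (auto simp: summable_on_def)
  from has_sum_finite_approximation[OF this assms(3)]
  obtain F0 where F0: "finite F0" "F0 \<subseteq> A" "dist (sum f F0) S \<le> e/2"
    using has_sum_finite_approximation[OF S, of "e/2"] assms(3) by auto
  have "sum f F < e" if "finite F" "F \<subseteq> A - F0" for F
  proof -
    have "sum f (F \<union> F0) \<le> S"
      by (rule finite_sum_le_has_sum[OF S]) (use that F0 assms(2) in auto)
    moreover have "sum f (F \<union> F0) = sum f F + sum f F0"
      by (rule sum.union_disjoint) (use that F0 in auto)
    ultimately show ?thesis using F0(3) assms(3) unfolding dist_real_def by linarith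
  qed
  then show ?thesis using that F0 by blast
qed

lemma summable_orthonormal:
  assumes "orthonormal E" and B: "\<And>F. finite F \<Longrightarrow> F \<subseteq> E \<Longrightarrow> (\<Sum>e\<in>F. (cmod (c e))\<^sup>2) \<le> B"
  shows "(\<lambda>e. c e *\<^sub>C e) summable_on E"
proof (rule summable_on_if_small_tails)
  fix r :: real assume r: "r > 0"
  have "(\<lambda>e. (cmod (c e))\<^sup>2) summable_on E"
    by (rule nonneg_bdd_above_summable_on) (auto simp: bdd_above_def intro!: exI[of _ B] B)
  from small_tails_nonneg[OF this, of "r\<^sup>2"] r
  obtain F0 where F0: "finite F0" "F0 \<subseteq> E" "\<And>F. finite F \<Longrightarrow> F \<subseteq> E - F0 \<Longrightarrow> (\<Sum>e\<in>F. (cmod (c e))\<^sup>2) < r\<^sup>2"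
    by auto
  have "norm (\<Sum>e\<in>F. c e *\<^sub>C e) < r" if "finite F" "F \<subseteq> E - F0" for F
  proof -
    have "(norm (\<Sum>e\<in>F. c e *\<^sub>C e))\<^sup>2 < r\<^sup>2"
      using norm_sum_orthonormal[of F c] F0(3)[OF that] that(1) orthonormal_subset[OF assms(1) subset_trans[OF that(2) Diff_subset]]
      by simp
    then show ?thesis using r by (meson less_imp_le power2_less_imp_less)
  qed
  then show "\<exists>F0. finite F0 \<and> F0 \<subseteq> E \<and> (\<forall>F. finite F \<longrightarrow> F \<subseteq> E - F0 \<longrightarrow> norm (\<Sum>e\<in>F. c e *\<^sub>C e) < r)"
    using F0 by blast
qed

lemma onb_expansion:
  assumes E: "is_onb E"
  shows "((\<lambda>e. cinner e x *\<^sub>C e) has_sum x) E"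
proof -
  have on: "orthonormal E" using E by (rule onb_orthonormal)
  define s where "s = infsum (\<lambda>e. cinner e x *\<^sub>C e) E"
  have s: "((\<lambda>e. cinner e x *\<^sub>C e) has_sum s) E"
    unfolding s_def using bessel[OF orthonormal_subset[OF on]]
    by (intro has_sum_infsum summable_orthonormal[OF on]) blast
  have "cinner f (x - s) = 0" if f: "f \<in> E" for f
  proof -
    have "((\<lambda>e. cinner f (cinner e x *\<^sub>C e)) has_sum cinner f s) E"
      by (rule has_sum_bounded_linear[OF bounded_linear_cinner_right s])
    moreover have "((\<lambda>e. cinner f (cinner e x *\<^sub>C e)) has_sum cinner f x) E"
      by (rule has_sum_finite_neutralI[of "{f}"])
        (use f in \<open>auto simp: cinner_scaleC_right orthonormal_cinner[OF on]\<close>)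
    ultimately show ?thesis by (simp add: cinner_diff_right has_sum_unique)
  qed
  then have "x - s = 0" using E unfolding is_onb_def by blast
  then show ?thesis using s by simp
qed

lemma parseval_cinner:
  assumes E: "is_onb E"
  shows "((\<lambda>e. cinner y e * cinner e x) has_sum cinner y x) E"
  using has_sum_bounded_linear[OF bounded_linear_cinner_right onb_expansion[OF E, of x], of y]
  by (simp add: cinner_scaleC_right mult.commute)

lemma parseval:
  assumes E: "is_onb E"
  shows "((\<lambda>e. (cmod (cinner e x))\<^sup>2) has_sum (norm x)\<^sup>2) E"
proof -
  have "((\<lambda>e. Re (cinner x e * cinner e x)) has_sum Re (cinner x x)) E"
    by (rule has_sum_bounded_linear[OF bounded_linear_Re parseval_cinner[OF E]])
  moreover have "Re (cinner x e * cinner e x) = (cmod (cinner e x))\<^sup>2" for e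
    by (metis Re_complex_of_real cinner_commute complex_norm_square mult.commute)
  ultimately show ?thesis by (simp add: cinner_self del: of_real_power)
qed

lemma onb_exists: "\<exists>E::'h::complex_hilbert set. is_onb E"
proof -
  have "\<exists>M\<in>Collect orthonormal. \<forall>X\<in>Collect orthonormal. M \<subseteq> X \<longrightarrow> X = (M::'h set)"
  proof (rule subset_Zorn', goal_cases)
    case (1 c)
    have "orthonormal (\<Union>c)"
      unfolding orthonormal_def
    proof (intro conjI ballI impI)
      fix e assume "e \<in> \<Union>c" then show "norm e = 1"
        using 1 by (auto simp: orthonormal_def subset_chain_def)
    next
      fix e f assume "e \<in> \<Union>c" "f \<in> \<Union>c" "e \<noteq> f"
      then obtain X Y where "X \<in> c" "Y \<in> c" "e \<in> X" "f \<in> Y" by auto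
      moreover have "X \<subseteq> Y \<or> Y \<subseteq> X" using 1 calculation unfolding subset_chain_def by blast
      ultimately obtain Z where "Z \<in> c" "e \<in> Z" "f \<in> Z" by blast
      then show "cinner e f = 0" using 1 \<open>e \<noteq> f\<close> by (auto simp: orthonormal_def subset_chain_def)
    qed
    then show ?case by simp
  qed
  then obtain M :: "'h set" where M: "orthonormal M" and max: "\<And>X. orthonormal X \<Longrightarrow> M \<subseteq> X \<Longrightarrow> X = M" by auto
  have "x = 0" if orth: "\<forall>e\<in>M. cinner e x = 0" for x
  proof (rule ccontr)
    assume x: "x \<noteq> 0"
    define u where "u = (1 / norm x) *\<^sub>R x"
    have u: "norm u = 1" "\<And>e. e \<in> M \<Longrightarrow> cinner e u = 0"
      using x orth by (auto simp: u_def cinner_scaleR_right)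
    then have "\<And>e. e \<in> M \<Longrightarrow> cinner u e = 0" by (subst cinner_commute) simp
    then have "orthonormal (insert u M)" using M u by (auto simp: orthonormal_def)
    then have "u \<in> M" using max by blast
    then have "cinner u u = 0" by (rule u(2))
    then show False using u(1) by (simp add: cinner_self)
  qed
  then have "is_onb M" using M by (auto simp: is_onb_def orthonormal_def)
  then show ?thesis by blast
qed


section \<open>Bounded operators\<close>

lemma norm_le_if_mult_le:
  assumes "norm w * norm w \<le> K * norm w" "0 \<le> K"
  shows "norm w \<le> K"
proof (cases "norm w = 0")
  case False
  then have "0 < norm w" using norm_ge_zero[of w] by linarith
  then show ?thesis using assms(1) by (rule mult_right_le_imp_le[rotated])
qed (use assms in simp)

lemma bop_apply_simps [simp]:
  "(S + T) *\<^sub>V x = S *\<^sub>V x + T *\<^sub>V x" "(S - T) *\<^sub>V x = S *\<^sub>V x - T *\<^sub>V x"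
  "(- T) *\<^sub>V x = - (T *\<^sub>V x)" "(0::'h bop) *\<^sub>V x = 0" "(1::'h bop) *\<^sub>V x = x"
  "(S * T) *\<^sub>V x = S *\<^sub>V T *\<^sub>V x" "(r *\<^sub>R T) *\<^sub>V x = r *\<^sub>R (T *\<^sub>V x)"
  "(c *\<^sub>C T) *\<^sub>V x = c *\<^sub>C (T *\<^sub>V x)" for S T :: "'h::complex_hilbert bop"
  unfolding bop_apply_def
  by (transfer, simp add: blinfun.add_left blinfun.diff_left blinfun.minus_left blinfun.scaleR_left
      apply_Blinfun_scaleC)+

lemma bop_apply_scaleC: "T *\<^sub>V (c *\<^sub>C x) = c *\<^sub>C (T *\<^sub>V x)"
  unfolding bop_apply_def by transfer simp

lemma bop_apply_linear [simp]:
  "T *\<^sub>V (x + y) = T *\<^sub>V x + T *\<^sub>V y" "T *\<^sub>V (x - y) = T *\<^sub>V x - T *\<^sub>V y"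
  "T *\<^sub>V (- x) = - (T *\<^sub>V x)" "T *\<^sub>V 0 = 0" "T *\<^sub>V (r *\<^sub>R x) = r *\<^sub>R (T *\<^sub>V x)"
  unfolding bop_apply_def
  by (simp_all add: blinfun.add_right blinfun.diff_right blinfun.minus_right blinfun.scaleR_right)

lemma bop_apply_sum: "T *\<^sub>V (sum f A) = (\<Sum>i\<in>A. T *\<^sub>V f i)"
  by (induction A rule: infinite_finite_induct) simp_all

lemma norm_bop_apply: "norm (T *\<^sub>V x) \<le> norm T * norm x"
  unfolding bop_apply_def by transfer (rule norm_blinfun)

lemma bop_eqI: "(\<And>x. S *\<^sub>V x = T *\<^sub>V x) \<Longrightarrow> S = T"
  unfolding bop_apply_def by (metis blinfun_eqI blinfun_of_bop_inject)

lemma bop_eqI_cinner: "(\<And>x y. cinner x (S *\<^sub>V y) = cinner x (T *\<^sub>V y)) \<Longrightarrow> S = T"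
  by (intro bop_eqI cinner_ext)

lemma norm_bop_le: "0 \<le> b \<Longrightarrow> (\<And>x. norm (T *\<^sub>V x) \<le> b * norm x) \<Longrightarrow> norm T \<le> b"
  unfolding bop_apply_def by (simp add: norm_bop.rep_eq norm_blinfun_bound)

lemma bop_exists:
  fixes f :: "'h::complex_hilbert \<Rightarrow> 'h"
  assumes "\<And>x y. f (x + y) = f x + f y" "\<And>c x. f (c *\<^sub>C x) = c *\<^sub>C f x" "\<And>x. norm (f x) \<le> K * norm x"
  shows "\<exists>T. \<forall>x. T *\<^sub>V x = f x"
proof -
  have "bounded_linear f"
  proof (rule bounded_linear_intro[where K = K])
    show "f (r *\<^sub>R x) = r *\<^sub>R f x" for r x by (metis assms(2) scaleC_of_real)
  qed (use assms(1,3) in \<open>auto simp: mult.commute\<close>)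
  then have *: "blinfun_apply (Blinfun f) = f" by (rule bounded_linear_Blinfun_apply)
  have "Bop (Blinfun f) *\<^sub>V x = f x" for x
    unfolding bop_apply_def by (subst Bop_inverse) (simp_all add: * assms(2))
  then show ?thesis by blast
qed

lemma bounded_linear_bop_apply: "bounded_linear (\<lambda>T. T *\<^sub>V x)"
  by (rule bounded_linear_intro[where K = "norm x"]) (simp_all add: norm_bop_apply)

lemma bounded_linear_bop_apply_right: "bounded_linear (\<lambda>x. T *\<^sub>V x)"
  by (rule bounded_linear_intro[where K = "norm T"])
    (simp_all add: norm_bop_apply mult.commute[of _ "norm T"])

lemma bounded_linear_cinner_bop: "bounded_linear (\<lambda>T. cinner x (T *\<^sub>V y))"
  by (rule bounded_linear_compose[OF bounded_linear_cinner_right bounded_linear_bop_apply])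

lemma bop_mult_scaleC [simp]:
  "(c *\<^sub>C S) * T = c *\<^sub>C (S * T)" "S * (c *\<^sub>C T) = c *\<^sub>C (S * T)" for S T :: "'h::complex_hilbert bop"
  by (auto intro!: bop_eqI simp: bop_apply_scaleC)

lemma norm_scaleC_bop: "norm (c *\<^sub>C T) = cmod c * norm (T::'h::complex_hilbert bop)"
proof -
  have le: "norm (c *\<^sub>C T) \<le> cmod c * norm T" for c and T :: "'h bop"
    by (rule norm_bop_le)
      (simp_all add: norm_scaleC mult_left_mono[OF norm_bop_apply] mult.assoc)
  show ?thesis
  proof (cases "c = 0")
    case False
    have "norm T = norm (inverse c *\<^sub>C (c *\<^sub>C T))" using False by (simp add: scaleC_scaleC)
    also have "\<dots> \<le> norm (c *\<^sub>C T) / cmod c"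
      using le[of "inverse c" "c *\<^sub>C T"] by (simp add: norm_inverse divide_inverse mult.commute)
    finally show ?thesis using False le[of c T] by (simp add: field_simps)
  qed simp
qed

lemma bounded_linear_scaleC_bop: "bounded_linear (\<lambda>T::'h::complex_hilbert bop. c *\<^sub>C T)"
  by (rule bounded_linear_intro[where K = "cmod c"])
    (simp_all add: scaleC_add_right scaleC_scaleR norm_scaleC_bop mult.commute)

lemma bounded_bilinear_scaleC_bop: "bounded_bilinear (\<lambda>c (T::'h::complex_hilbert bop). c *\<^sub>C T)"
proof (unfold_locales, goal_cases)
  case (3 r c T) then show ?case
    by (simp add: scaleR_conv_of_real scaleC_scaleC[symmetric] scaleC_of_real)
next
  case 5 then show ?case by (intro exI[of _ 1]) (simp add: norm_scaleC_bop)
qed (simp_all add: scaleC_add_left scaleC_add_right scaleC_scaleR)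

lemma norm_one_bop_le: "norm (1::'h::complex_hilbert bop) \<le> 1"
  by (rule norm_bop_le) simp_all

lemma norm_power_bop_le: "norm (T ^ n) \<le> norm (T::'h::complex_hilbert bop) ^ n"
proof (induction n)
  case (Suc n)
  have "norm (T ^ Suc n) \<le> norm T * norm (T ^ n)" by (simp add: norm_mult_ineq)
  also have "\<dots> \<le> norm T * norm T ^ n" by (intro mult_left_mono Suc) simp
  finally show ?case by simp
qed (simp add: norm_one_bop_le)


section \<open>Adjoints\<close>

lemma adj_exists: "\<exists>S. \<forall>x y. cinner (S *\<^sub>V x) y = cinner x (T *\<^sub>V y)" for T :: "'h::complex_hilbert bop"
proof -
  obtain E :: "'h set" where E: "is_onb E" using onb_exists by blast
  have on: "orthonormal E" using E by (rule onb_orthonormal)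
  define f where "f x = infsum (\<lambda>e. cinner (T *\<^sub>V e) x *\<^sub>C e) E" for x
  have bound: "(\<Sum>e\<in>F. (cmod (cinner (T *\<^sub>V e) x))\<^sup>2) \<le> (norm T * norm x)\<^sup>2" if F: "finite F" "F \<subseteq> E" for F x
  proof -
    define w where "w = (\<Sum>e\<in>F. cinner (T *\<^sub>V e) x *\<^sub>C e)"
    have w2: "(norm w)\<^sup>2 = (\<Sum>e\<in>F. (cmod (cinner (T *\<^sub>V e) x))\<^sup>2)"
      unfolding w_def using norm_sum_orthonormal[OF orthonormal_subset[OF on F(2)] F(1)] .
    have "cinner (T *\<^sub>V w) x = of_real ((norm w)\<^sup>2)"
      unfolding w2 unfolding of_real_sum complex_norm_square w_def bop_apply_sum cinner_sum_left
        bop_apply_scaleC cinner_scaleC_left by (intro sum.cong refl mult.commute)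
    then have "(norm w)\<^sup>2 \<le> norm (T *\<^sub>V w) * norm x"
      using Re_cinner_le[of "T *\<^sub>V w" x] by (simp del: of_real_power)
    also have "\<dots> \<le> norm T * norm w * norm x" by (intro mult_right_mono norm_bop_apply) simp
    finally have "norm w * norm w \<le> (norm T * norm x) * norm w" by (simp add: power2_eq_square mult_ac)
    then have "norm w \<le> norm T * norm x" by (rule norm_le_if_mult_le) simp
    then have "(norm w)\<^sup>2 \<le> (norm T * norm x)\<^sup>2" by (intro power_mono) auto
    then show ?thesis unfolding w2 .
  qed
  have f: "((\<lambda>e. cinner (T *\<^sub>V e) x *\<^sub>C e) has_sum f x) E" for x
    unfolding f_def using bound by (intro has_sum_infsum summable_orthonormal[OF on]) blast
  have eq: "cinner (f x) y = cinner x (T *\<^sub>V y)" for x y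
  proof -
    have "((\<lambda>e. cinner y (cinner (T *\<^sub>V e) x *\<^sub>C e)) has_sum cinner y (f x)) E"
      by (rule has_sum_bounded_linear[OF bounded_linear_cinner_right f])
    then have "((\<lambda>e. cnj (cinner y (cinner (T *\<^sub>V e) x *\<^sub>C e))) has_sum cnj (cinner y (f x))) E"
      by (rule has_sum_bounded_linear[OF bounded_linear_cnj])
    then have 1: "((\<lambda>e. cinner x (T *\<^sub>V e) * cinner e y) has_sum cinner (f x) y) E"
      by (simp add: cinner_scaleC_right cinner_commute[symmetric])
    have "((\<lambda>e. cinner x (T *\<^sub>V (cinner e y *\<^sub>C e))) has_sum cinner x (T *\<^sub>V y)) E"
      by (rule has_sum_bounded_linear[OF bounded_linear_compose[OF bounded_linear_cinner_right
        bounded_linear_bop_apply_right] onb_expansion[OF E]])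
    then have "((\<lambda>e. cinner x (T *\<^sub>V e) * cinner e y) has_sum cinner x (T *\<^sub>V y)) E"
      by (simp add: bop_apply_scaleC cinner_scaleC_right mult.commute)
    then show ?thesis using 1 has_sum_unique by blast
  qed
  have eq': "cinner y (f x) = cinner (T *\<^sub>V y) x" for x y
    using eq[of x y] cinner_commute[of y "f x"] cinner_commute[of "T *\<^sub>V y" x] by simp
  have nf: "norm (f x) \<le> norm T * norm x" for x
  proof -
    have "(norm (f x))\<^sup>2 = Re (cinner x (T *\<^sub>V f x))"
      using arg_cong[OF eq[of x "f x"], of Re] by (simp only: cinner_self Re_complex_of_real)
    also have "\<dots> \<le> norm x * (norm T * norm (f x))"
      by (rule order_trans[OF Re_cinner_le mult_left_mono[OF norm_bop_apply]]) simp
    finally have "norm (f x) * norm (f x) \<le> (norm T * norm x) * norm (f x)"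
      by (simp add: power2_eq_square mult_ac)
    then show ?thesis by (rule norm_le_if_mult_le) simp
  qed
  have "\<exists>S. \<forall>x. S *\<^sub>V x = f x"
  proof (rule bop_exists[OF _ _ nf])
    show "f (x + y) = f x + f y" for x y by (rule cinner_ext) (simp only: eq' cinner_add_right)
    show "f (c *\<^sub>C x) = c *\<^sub>C f x" for c x by (rule cinner_ext) (simp only: eq' cinner_scaleC_right)
  qed
  then obtain S where "\<And>x. S *\<^sub>V x = f x" by blast
  then show ?thesis using eq by (intro exI[of _ S]) simp
qed

lemma adj_unique: "(\<And>x y. cinner (S *\<^sub>V x) y = cinner x (T *\<^sub>V y)) \<Longrightarrow> adj T = S"
  unfolding adj_def
proof (rule the_equality)
  fix S' assume S: "\<And>x y. cinner (S *\<^sub>V x) y = cinner x (T *\<^sub>V y)"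
    and S': "\<forall>x y. cinner (S' *\<^sub>V x) y = cinner x (T *\<^sub>V y)"
  show "S' = S"
  proof (intro bop_eqI cinner_ext)
    fix x y show "cinner y (S' *\<^sub>V x) = cinner y (S *\<^sub>V x)"
      using S[of x y] S'[rule_format, of x y] cinner_commute[of y "S *\<^sub>V x"]
        cinner_commute[of y "S' *\<^sub>V x"] by simp
  qed
qed auto

lemma cinner_adj_left: "cinner (adj T *\<^sub>V x) y = cinner x (T *\<^sub>V y)"
proof -
  obtain S where S: "\<And>x y. cinner (S *\<^sub>V x) y = cinner x (T *\<^sub>V y)" using adj_exists[of T] by blast
  have "adj T = S" by (rule adj_unique) (rule S)
  then show ?thesis using S by simp
qed

lemma cinner_adj_right: "cinner x (adj T *\<^sub>V y) = cinner (T *\<^sub>V x) y"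
  using cinner_adj_left[of T y x] cinner_commute[of x "adj T *\<^sub>V y"] cinner_commute[of "T *\<^sub>V x" y] by simp

lemma adj_adj [simp]: "adj (adj T) = T"
  by (rule adj_unique) (simp add: cinner_adj_right)

lemma adj_mult [simp]: "adj (S * T) = adj T * adj S"
  by (rule adj_unique) (simp add: cinner_adj_left)

lemma adj_one [simp]: "adj 1 = 1" by (rule adj_unique) simp
lemma adj_zero [simp]: "adj 0 = 0" by (rule adj_unique) simp
lemma adj_add [simp]: "adj (S + T) = adj S + adj T"
  by (rule adj_unique) (simp add: cinner_adj_left cinner_linear)
lemma adj_minus [simp]: "adj (- T) = - adj T"
  by (rule adj_unique) (simp add: cinner_adj_left cinner_linear)
lemma adj_diff [simp]: "adj (S - T) = adj S - adj T"
  by (rule adj_unique) (simp add: cinner_adj_left cinner_linear)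
lemma adj_scaleC [simp]: "adj (c *\<^sub>C T) = cnj c *\<^sub>C adj T"
  by (rule adj_unique) (simp add: cinner_adj_left cinner_linear)
lemma adj_scaleR [simp]: "adj (r *\<^sub>R T) = r *\<^sub>R adj T"
  by (rule adj_unique) (simp add: cinner_adj_left cinner_linear)
lemma adj_power [simp]: "adj (T ^ n) = adj T ^ n"
  by (induction n) (simp_all add: power_commutes)

lemma norm_adj_le: "norm (adj T) \<le> norm T"
proof (rule norm_bop_le)
  fix x
  have "(norm (adj T *\<^sub>V x))\<^sup>2 = Re (cinner x (T *\<^sub>V adj T *\<^sub>V x))"
    using arg_cong[OF cinner_adj_left[of T x "adj T *\<^sub>V x"], of Re] by (simp only: cinner_self Re_complex_of_real)
  also have "\<dots> \<le> norm x * (norm T * norm (adj T *\<^sub>V x))"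
    by (rule order_trans[OF Re_cinner_le mult_left_mono[OF norm_bop_apply]]) simp
  finally have "norm (adj T *\<^sub>V x) * norm (adj T *\<^sub>V x) \<le> (norm T * norm x) * norm (adj T *\<^sub>V x)"
    by (simp add: power2_eq_square mult_ac)
  then show "norm (adj T *\<^sub>V x) \<le> norm T * norm x"
    by (rule norm_le_if_mult_le) simp
qed simp

lemma norm_adj [simp]: "norm (adj T) = norm T"
  using norm_adj_le[of T] norm_adj_le[of "adj T"] by simp

lemma bounded_linear_adj: "bounded_linear adj"
  by (rule bounded_linear_intro[where K = 1]) simp_all

lemma bop_zeroI: "(\<And>x. cinner x (S *\<^sub>V x) = 0) \<Longrightarrow> S = 0"
proof (rule bop_eqI_cinner)
  fix x y assume S: "\<And>x. cinner x (S *\<^sub>V x) = 0"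
  have 1: "cinner x (S *\<^sub>V y) + cinner y (S *\<^sub>V x) = 0"
    using S[of "x + y"] by (simp add: cinner_linear S add.commute)
  have "cinner x (S *\<^sub>V y) - cinner y (S *\<^sub>V x) = 0"
    using S[of "x + \<i> *\<^sub>C y"] by (simp add: cinner_linear S bop_apply_scaleC)
  then show "cinner x (S *\<^sub>V y) = cinner x (0 *\<^sub>V y)" using 1 by simp
qed

lemma positive_op_iff: "positive_op T \<longleftrightarrow> adj T = T \<and> (\<forall>x. 0 \<le> Re (cinner x (T *\<^sub>V x)))"
proof -
  have "adj T = T" if "\<forall>x. Im (cinner x (T *\<^sub>V x)) = 0"
  proof -
    have "adj T - T = 0"
    proof (rule bop_zeroI)
      fix x show "cinner x ((adj T - T) *\<^sub>V x) = 0"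
        using that[rule_format, of x] cinner_commute[of "T *\<^sub>V x" x]
        by (simp add: cinner_linear cinner_adj_right complex_eq_iff)
    qed
    then show ?thesis by simp
  qed
  moreover have "Im (cinner x (T *\<^sub>V x)) = 0" if "adj T = T" for x
    using that cinner_adj_right[of x T x] arg_cong[OF cinner_commute[of "T *\<^sub>V x" x], of Im] by simp
  ultimately show ?thesis unfolding positive_op_def complex_nonneg_Reals_iff by blast
qed


section \<open>Inverses\<close>

lemma op_inverse_eqI: "S * T = 1 \<Longrightarrow> T * S = 1 \<Longrightarrow> op_inverse T = S"
  unfolding op_inverse_def by (rule the_equality) (auto, metis mult.assoc mult.left_neutral mult.right_neutral)

definition invertible_op :: "'h::complex_hilbert bop \<Rightarrow> bool" where
  "invertible_op T \<longleftrightarrow> (\<exists>S. S * T = 1 \<and> T * S = 1)"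

lemma op_inverse: 
  assumes "invertible_op T"
  shows "op_inverse T * T = 1" "T * op_inverse T = 1"
  using assms op_inverse_eqI unfolding invertible_op_def by blast+

lemma invertible_opI: "S * T = 1 \<Longrightarrow> T * S = 1 \<Longrightarrow> invertible_op T"
  unfolding invertible_op_def by blast

lemma op_inverse_cancel:
  assumes "invertible_op T"
  shows "op_inverse T * (T * X) = X" "T * (op_inverse T * X) = X"
  using op_inverse[OF assms] by (simp_all add: mult.assoc[symmetric])

lemma invertible_op_mult:
  assumes "invertible_op S" "invertible_op T"
  shows "invertible_op (S * T)" "op_inverse (S * T) = op_inverse T * op_inverse S"
proof -
  have "(op_inverse T * op_inverse S) * (S * T) = 1" "(S * T) * (op_inverse T * op_inverse S) = 1"
    by (simp_all add: mult.assoc op_inverse_cancel assms op_inverse)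
  then show "invertible_op (S * T)" "op_inverse (S * T) = op_inverse T * op_inverse S"
    by (auto intro: invertible_opI op_inverse_eqI)
qed

lemma invertible_op_scaleC:
  assumes "invertible_op T" "c \<noteq> 0"
  shows "invertible_op (c *\<^sub>C T)" "op_inverse (c *\<^sub>C T) = inverse c *\<^sub>C op_inverse T"
proof -
  have "(inverse c *\<^sub>C op_inverse T) * (c *\<^sub>C T) = 1" "(c *\<^sub>C T) * (inverse c *\<^sub>C op_inverse T) = 1"
    using assms by (simp_all add: op_inverse scaleC_scaleC del: bop_mult_scaleC(1)) (simp_all add: op_inverse scaleC_scaleC)
  then show "invertible_op (c *\<^sub>C T)" "op_inverse (c *\<^sub>C T) = inverse c *\<^sub>C op_inverse T"
    by (rule invertible_opI op_inverse_eqI; fact)+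
qed

lemma neumann:
  assumes "norm X < 1"
  shows "invertible_op (1 - X)"
proof -
  have "summable (\<lambda>n. norm X ^ n)" using assms by (simp add: summable_geometric)
  then have s: "summable (\<lambda>n. X ^ n)"
    by (rule summable_comparison_test'[where N = 0]) (rule norm_power_bop_le)
  have "(\<Sum>n. X ^ n) = 1 + (\<Sum>n. X ^ Suc n)"
    using suminf_split_head[OF s] by simp
  moreover have "X * (\<Sum>n. X ^ n) = (\<Sum>n. X ^ Suc n)"
    using suminf_mult[OF s, of X] by simp
  moreover have "(\<Sum>n. X ^ n) * X = (\<Sum>n. X ^ Suc n)"
    using suminf_mult2[OF s, of X] by (simp add: power_commutes)
  ultimately show ?thesis
    by (intro invertible_opI[of "\<Sum>n. X ^ n"]) (simp_all add: algebra_simps)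
qed

lemma norm_op_inverse_le:
  assumes "invertible_op M" "c > 0" "\<And>x. c * norm x \<le> norm (M *\<^sub>V x)"
  shows "norm (op_inverse M) \<le> 1 / c"
proof (rule norm_bop_le)
  fix x
  have "c * norm (op_inverse M *\<^sub>V x) \<le> norm ((M * op_inverse M) *\<^sub>V x)"
    using assms(3)[of "op_inverse M *\<^sub>V x"] by simp
  then show "norm (op_inverse M *\<^sub>V x) \<le> 1 / c * norm x"
    using assms(2) by (simp add: op_inverse[OF assms(1)] field_simps)
qed (use assms(2) in simp)

lemma accretive_invertible:
  assumes c: "c > 0" and acc: "\<And>x. c * (norm x)\<^sup>2 \<le> Re (cinner x (M *\<^sub>V x))"
  shows "invertible_op M" "norm (op_inverse M) \<le> 1 / c"
proof -
  define m where "m = (norm M)\<^sup>2 + 1"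
  define h where "h = c / m"
  define q where "q = sqrt (max 0 (1 - c\<^sup>2 / m))"
  have m: "m > 0" by (simp add: m_def add_nonneg_pos)
  have q: "0 \<le> q" "q < 1" unfolding q_def using c m by (auto simp: real_sqrt_lt_1_iff)
  have "norm (1 - h *\<^sub>R M) \<le> q"
  proof (rule norm_bop_le[OF q(1)])
    fix x
    have "(norm (M *\<^sub>V x))\<^sup>2 \<le> (norm M * norm x)\<^sup>2" by (intro power_mono norm_bop_apply) simp
    also have "\<dots> \<le> m * (norm x)\<^sup>2" by (simp add: m_def power_mult_distrib algebra_simps)
    finally have Mx: "(norm (M *\<^sub>V x))\<^sup>2 \<le> m * (norm x)\<^sup>2" .
    have "(norm ((1 - h *\<^sub>R M) *\<^sub>V x))\<^sup>2 = (norm x)\<^sup>2 - 2 * h * Re (cinner x (M *\<^sub>V x)) + h\<^sup>2 * (norm (M *\<^sub>V x))\<^sup>2"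
      by (simp add: norm_diff_sq cinner_scaleR_right power_mult_distrib)
    also have "\<dots> \<le> (norm x)\<^sup>2 - 2 * h * (c * (norm x)\<^sup>2) + h\<^sup>2 * (m * (norm x)\<^sup>2)"
      using acc[of x] Mx c m by (intro add_mono diff_mono mult_left_mono) (auto simp: h_def)
    also have "\<dots> = (1 - c\<^sup>2 / m) * (norm x)\<^sup>2"
      using m by (simp add: h_def field_simps power2_eq_square)
    also have "\<dots> \<le> (max 0 (1 - c\<^sup>2 / m)) * (norm x)\<^sup>2" by (intro mult_right_mono) auto
    also have "\<dots> = (q * norm x)\<^sup>2" by (simp add: q_def power_mult_distrib)
    finally show "norm ((1 - h *\<^sub>R M) *\<^sub>V x) \<le> q * norm x"
      by (rule power2_le_imp_le) (use q in simp)
  qed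
  then have "invertible_op (1 - (1 - h *\<^sub>R M))" using q by (intro neumann) simp
  then have "invertible_op (h *\<^sub>R M)" by simp
  then have "invertible_op (of_real (1/h) *\<^sub>C (h *\<^sub>R M))"
    using c m by (intro invertible_op_scaleC) (auto simp: h_def)
  then show inv: "invertible_op M" using c m by (simp only: scaleC_of_real) (simp add: h_def)
  show "norm (op_inverse M) \<le> 1 / c"
  proof (rule norm_op_inverse_le[OF inv c])
    fix x
    have "norm x * (c * norm x) \<le> norm x * norm (M *\<^sub>V x)"
      using acc[of x] Re_cinner_le[of x "M *\<^sub>V x"] by (simp add: power2_eq_square mult_ac)
    then show "c * norm x \<le> norm (M *\<^sub>V x)" by (cases "x = 0") simp_all
  qed
qed


section \<open>Square roots and absolute values\<close>

lemma positive_opD: "positive_op P \<Longrightarrow> adj P = P" "positive_op P \<Longrightarrow> 0 \<le> Re (cinner x (P *\<^sub>V x))"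
  by (simp_all add: positive_op_iff)

lemma positive_op_scaleR: "positive_op P \<Longrightarrow> r \<ge> 0 \<Longrightarrow> positive_op (r *\<^sub>R P)"
  by (simp add: positive_op_iff cinner_scaleR_right)

lemma positive_op_adj_mult: "positive_op (adj T * T)"
  by (simp add: positive_op_iff cinner_adj_right cinner_self del: of_real_power)

lemma norm_one_minus_positive:
  assumes P: "positive_op P" and n: "norm P \<le> 1"
  shows "norm (1 - P) \<le> 1"
proof (rule norm_bop_le)
  fix x
  define y where "y = P *\<^sub>V x"
  have sa: "cinner (P *\<^sub>V u) v = cinner u (P *\<^sub>V v)" for u v
    using cinner_adj_left[of P u v] positive_opD(1)[OF P] by simp
  have "Re (cinner y (P *\<^sub>V y)) \<le> norm y * (norm P * norm y)"
    by (rule order_trans[OF Re_cinner_le mult_left_mono[OF norm_bop_apply]]) simp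
  also have "\<dots> \<le> (norm y)\<^sup>2"
    using mult_right_mono[OF n, of "(norm y)\<^sup>2"] by (simp add: power2_eq_square mult_ac)
  finally have 1: "Re (cinner y (P *\<^sub>V y)) \<le> (norm y)\<^sup>2" .
  have "0 \<le> Re (cinner (x - y) (P *\<^sub>V (x - y)))" by (rule positive_opD(2)[OF P])
  also have "\<dots> = Re (cinner x y) - 2 * (norm y)\<^sup>2 + Re (cinner y (P *\<^sub>V y))"
  proof -
    have "cinner x (P *\<^sub>V y) = cinner y y" using sa[of x y] by (simp add: y_def)
    then have "cinner (x - y) (P *\<^sub>V (x - y)) = cinner x y - 2 * cinner y y + cinner y (P *\<^sub>V y)"
      by (simp add: cinner_diff_left cinner_diff_right y_def[symmetric])
    then show ?thesis by (simp add: cinner_self[of y] del: of_real_power)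
  qed
  finally have 2: "(norm y)\<^sup>2 \<le> Re (cinner x y)" using 1 by linarith
  have "(norm (x - y))\<^sup>2 \<le> (norm x)\<^sup>2"
    unfolding norm_diff_sq using 2 zero_le_power2[of "norm y"] by linarith
  then have "norm (x - y) \<le> norm x" by (rule power2_le_imp_le) simp
  then show "norm ((1 - P) *\<^sub>V x) \<le> 1 * norm x" by (simp add: y_def)
qed simp

text \<open>The iteration \<open>Y \<mapsto> (B + Y\<^sup>2)/2\<close> converges to \<open>1 - \<surd>(1 - B)\<close>; its increments are dominated
  by those of the scalar iteration for \<open>B = 1\<close>.\<close>

primrec sqrt_iter :: "'h::complex_hilbert bop \<Rightarrow> nat \<Rightarrow> 'h bop" where
  "sqrt_iter B 0 = 0"
| "sqrt_iter B (Suc n) = (1/2) *\<^sub>R (B + sqrt_iter B n * sqrt_iter B n)"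

primrec sqrt_iter_real :: "nat \<Rightarrow> real" where
  "sqrt_iter_real 0 = 0"
| "sqrt_iter_real (Suc n) = (1 + sqrt_iter_real n * sqrt_iter_real n) / 2"

lemma sqrt_iter_real_bounds: "0 \<le> sqrt_iter_real n" "sqrt_iter_real n \<le> 1"
  by (induction n) (auto simp: mult_le_one)

lemma incseq_sqrt_iter_real: "incseq sqrt_iter_real"
proof (rule incseq_SucI)
  fix n
  have "0 \<le> (1 - sqrt_iter_real n)\<^sup>2" by simp
  then show "sqrt_iter_real n \<le> sqrt_iter_real (Suc n)"
    by (simp add: power2_eq_square algebra_simps)
qed

lemma sqrt_iter_commute: "B * X = X * B \<Longrightarrow> sqrt_iter B n * X = X * sqrt_iter B n"
proof (induction n)
  case (Suc n)
  then have "sqrt_iter B n * sqrt_iter B n * X = X * (sqrt_iter B n * sqrt_iter B n)"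
    by (metis mult.assoc)
  then show ?case using Suc by (simp add: distrib_left distrib_right)
qed simp

lemma adj_sqrt_iter: "adj B = B \<Longrightarrow> adj (sqrt_iter B n) = sqrt_iter B n"
  by (induction n) simp_all

lemma norm_sqrt_iter: "norm B \<le> 1 \<Longrightarrow> norm (sqrt_iter B n) \<le> sqrt_iter_real n"
proof (induction n)
  case (Suc n)
  have "norm (B + sqrt_iter B n * sqrt_iter B n) \<le> norm B + norm (sqrt_iter B n) * norm (sqrt_iter B n)"
    by (meson norm_triangle_le add_left_mono norm_mult_ineq order_trans norm_triangle_ineq)
  also have "\<dots> \<le> 1 + sqrt_iter_real n * sqrt_iter_real n"
    using Suc by (intro add_mono mult_mono) (auto simp: sqrt_iter_real_bounds)
  finally show ?case by simp
qed simp

lemma norm_sqrt_iter_diff: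
  assumes B: "norm B \<le> 1"
  shows "norm (sqrt_iter B (Suc n) - sqrt_iter B n) \<le> sqrt_iter_real (Suc n) - sqrt_iter_real n"
proof (induction n)
  case 0 then show ?case using B by simp
next
  case (Suc n)
  let ?Y = "sqrt_iter B" and ?y = sqrt_iter_real
  have comm: "?Y n * ?Y (Suc n) = ?Y (Suc n) * ?Y n"
    by (rule sqrt_iter_commute[OF sqrt_iter_commute[OF refl, symmetric]])
  have "?Y (Suc (Suc n)) - ?Y (Suc n) = (1/2) *\<^sub>R (?Y (Suc n) * ?Y (Suc n) - ?Y n * ?Y n)"
    by (subst sqrt_iter.simps(2), subst (5) sqrt_iter.simps(2)) (simp add: algebra_simps)
  also have "?Y (Suc n) * ?Y (Suc n) - ?Y n * ?Y n = (?Y (Suc n) - ?Y n) * (?Y (Suc n) + ?Y n)"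
    using comm by (simp only: left_diff_distrib distrib_left) simp
  finally have "norm (?Y (Suc (Suc n)) - ?Y (Suc n)) \<le> 1/2 * (norm (?Y (Suc n) - ?Y n) * norm (?Y (Suc n) + ?Y n))"
    by (simp only: norm_scaleR) (simp add: norm_mult_ineq)
  also have "\<dots> \<le> 1/2 * ((?y (Suc n) - ?y n) * (?y (Suc n) + ?y n))"
    using Suc norm_sqrt_iter[OF B, of n] norm_sqrt_iter[OF B, of "Suc n"]
    by (intro mult_left_mono mult_mono order_trans[OF norm_triangle_ineq] add_mono)
      (use incseq_SucD[OF incseq_sqrt_iter_real, of n] in auto)
  also have "\<dots> = ?y (Suc (Suc n)) - ?y (Suc n)"
    by (subst (3) sqrt_iter_real.simps(2), subst (4) sqrt_iter_real.simps(2)) (simp add: field_simps)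
  finally show ?case .
qed

lemma sqrt_exists_small:
  assumes P: "positive_op P" and n: "norm P \<le> 1"
  shows "\<exists>S. positive_op S \<and> S * S = P \<and> (\<forall>X. P * X = X * P \<longrightarrow> S * X = X * S)"
proof -
  define B where "B = 1 - P"
  have B: "norm B \<le> 1" unfolding B_def by (rule norm_one_minus_positive[OF P n])
  have aB: "adj B = B" unfolding B_def using positive_opD(1)[OF P] by simp
  have "\<forall>i. sqrt_iter_real i \<le> 1" by (simp add: sqrt_iter_real_bounds)
  from incseq_convergent[OF incseq_sqrt_iter_real this]
  obtain l where "sqrt_iter_real \<longlonglongrightarrow> l" by blast
  then have "summable (\<lambda>n. sqrt_iter_real (Suc n) - sqrt_iter_real n)" by (rule telescope_summable)
  then have "summable (\<lambda>n. sqrt_iter B (Suc n) - sqrt_iter B n)"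
    by (rule summable_comparison_test'[where N = 0]) (rule norm_sqrt_iter_diff[OF B])
  then obtain Y where "(\<lambda>n. \<Sum>i<n. sqrt_iter B (Suc i) - sqrt_iter B i) \<longlonglongrightarrow> Y"
    using summable_LIMSEQ by blast
  then have Y: "sqrt_iter B \<longlonglongrightarrow> Y" by (simp only: sum_lessThan_telescope) simp
  have "(\<lambda>n. sqrt_iter B (Suc n)) \<longlonglongrightarrow> (1/2) *\<^sub>R (B + Y * Y)"
    unfolding sqrt_iter.simps by (intro tendsto_intros Y)
  then have "Y = (1/2) *\<^sub>R (B + Y * Y)"
    using LIMSEQ_Suc[OF Y] LIMSEQ_unique by blast
  then have "2 *\<^sub>R Y = 2 *\<^sub>R ((1/2) *\<^sub>R (B + Y * Y))" by (rule arg_cong)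
  then have YY: "Y + Y = B + Y * Y" by (simp add: scaleR_2)
  have nY: "norm Y \<le> 1"
    by (rule Lim_norm_ubound[OF _ Y])
      (intro always_eventually allI trivial_limit_sequentially order_trans[OF norm_sqrt_iter[OF B] sqrt_iter_real_bounds(2)])+
  have comm: "Y * X = X * Y" if "P * X = X * P" for X
  proof -
    have "B * X = X * B" using that by (simp add: B_def left_diff_distrib right_diff_distrib)
    then have "sqrt_iter B n * X = X * sqrt_iter B n" for n by (rule sqrt_iter_commute)
    moreover have "(\<lambda>n. X * sqrt_iter B n) \<longlonglongrightarrow> X * Y" by (intro tendsto_intros Y)
    ultimately have "(\<lambda>n. sqrt_iter B n * X) \<longlonglongrightarrow> X * Y" by simp
    moreover have "(\<lambda>n. sqrt_iter B n * X) \<longlonglongrightarrow> Y * X" by (intro tendsto_intros Y)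
    ultimately show ?thesis using LIMSEQ_unique by blast
  qed
  have "(\<lambda>n. adj (sqrt_iter B n)) \<longlonglongrightarrow> adj Y" by (rule bounded_linear.tendsto[OF bounded_linear_adj Y])
  then have aY: "adj Y = Y" unfolding adj_sqrt_iter[OF aB] using Y LIMSEQ_unique by blast
  have "positive_op (1 - Y)"
    unfolding positive_op_iff
  proof (intro conjI allI)
    fix x
    have "Re (cinner x (Y *\<^sub>V x)) \<le> norm x * (norm Y * norm x)"
      by (rule order_trans[OF Re_cinner_le mult_left_mono[OF norm_bop_apply]]) simp
    also have "\<dots> \<le> (norm x)\<^sup>2"
      using mult_right_mono[OF nY, of "(norm x)\<^sup>2"] by (simp add: power2_eq_square mult_ac)
    finally show "0 \<le> Re (cinner x ((1 - Y) *\<^sub>V x))"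
      by (simp add: cinner_diff_right cinner_self del: of_real_power)
  qed (simp add: aY)
  moreover have "(1 - Y) * (1 - Y) = P"
  proof -
    have "(1 - Y) * (1 - Y) = 1 - (Y + Y) + Y * Y" by (simp add: left_diff_distrib right_diff_distrib)
    then show ?thesis unfolding YY B_def by simp
  qed
  moreover have "(1 - Y) * X = X * (1 - Y)" if "P * X = X * P" for X
    by (simp add: left_diff_distrib right_diff_distrib comm[OF that])
  ultimately show ?thesis by blast
qed

lemma sqrt_exists:
  assumes P: "positive_op P"
  obtains S where "positive_op S" "S * S = P" "\<And>X. P * X = X * P \<Longrightarrow> S * X = X * S"
proof -
  define k where "k = norm P + 1"
  have k: "k > 0" by (simp add: k_def add_nonneg_pos)
  have "positive_op ((1/k) *\<^sub>R P)" "norm ((1/k) *\<^sub>R P) \<le> 1"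
    using k by (auto intro: positive_op_scaleR[OF P] simp: k_def)
  then obtain S where S: "positive_op S" "S * S = (1/k) *\<^sub>R P"
    "\<forall>X. (1/k) *\<^sub>R P * X = X * ((1/k) *\<^sub>R P) \<longrightarrow> S * X = X * S"
    using sqrt_exists_small by blast
  show ?thesis
  proof (rule that[of "sqrt k *\<^sub>R S"])
    show "positive_op (sqrt k *\<^sub>R S)" by (rule positive_op_scaleR[OF S(1)]) (use k in simp)
    show "sqrt k *\<^sub>R S * sqrt k *\<^sub>R S = P" using S(2) k by simp
    show "sqrt k *\<^sub>R S * X = X * sqrt k *\<^sub>R S" if "P * X = X * P" for X
      using S(3) that by simp
  qed
qed

lemma positive_op_conj:
  assumes "positive_op P" "adj D = D"
  shows "positive_op (D * P * D)"
  unfolding positive_op_iff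
proof (intro conjI allI)
  fix x
  have "cinner x ((D * P * D) *\<^sub>V x) = cinner (D *\<^sub>V x) (P *\<^sub>V D *\<^sub>V x)"
    using cinner_adj_left[of D x] assms(2) by simp
  then show "0 \<le> Re (cinner x ((D * P * D) *\<^sub>V x))" using positive_opD(2)[OF assms(1)] by simp
qed (use assms positive_opD(1)[OF assms(1)] in \<open>simp add: mult.assoc\<close>)

lemma positive_op_antisym:
  assumes P: "positive_op P" and Q: "positive_op Q" and PQ: "P + Q = 0"
  shows "P = 0"
proof (rule bop_zeroI)
  fix x
  have "Re (cinner x (P *\<^sub>V x)) + Re (cinner x (Q *\<^sub>V x)) = Re (cinner x ((P + Q) *\<^sub>V x))"
    by (simp add: cinner_add_right)
  then have "Re (cinner x (P *\<^sub>V x)) = 0"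
    using PQ positive_opD(2)[OF P, of x] positive_opD(2)[OF Q, of x] by simp
  then show "cinner x (P *\<^sub>V x) = 0"
    using P by (auto simp: positive_op_def complex_nonneg_Reals_iff complex_eq_iff)
qed

lemma sqrt_unique:
  assumes S: "positive_op S" and S': "positive_op S'" and eq: "S * S = S' * S'"
  shows "S = S'"
proof -
  obtain R where R: "positive_op R" "R * R = S * S" and comm: "\<And>X. S * S * X = X * (S * S) \<Longrightarrow> R * X = X * R"
  proof -
    have "positive_op (S * S)" using positive_op_adj_mult[of S] positive_opD(1)[OF S] by simp
    from sqrt_exists[OF this] show ?thesis using that by blast
  qed
  have *: "X = R" if X: "positive_op X" "X * X = S * S" for X
  proof -
    have RX: "R * X = X * R" by (rule comm) (simp add: X(2)[symmetric] mult.assoc)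
    define D where "D = X - R"
    have aD: "adj D = D" by (simp add: D_def positive_opD(1) X(1) R(1))
    have "(X + R) * D = 0" unfolding D_def using X(2) R(2) RX by (simp add: algebra_simps)
    then have "D * ((X + R) * D) = 0" by simp
    then have "D * X * D + D * R * D = 0" by (simp add: algebra_simps)
    then have "D * X * D = 0" "D * R * D = 0"
      using positive_op_antisym[OF positive_op_conj[OF X(1) aD] positive_op_conj[OF R(1) aD]]
      by auto
    then have "D * X * D - D * R * D = 0" by simp
    then have DDD: "D * D * D = 0" by (simp add: D_def algebra_simps)
    have DD: "adj (D * D) * (D * D) = 0" using DDD aD by (simp add: mult.assoc[symmetric])
    have z: "Z = 0" if "adj Z * Z = 0" for Z :: "'a bop"
    proof (rule bop_eqI)
      fix x
      have "cinner (Z *\<^sub>V x) (Z *\<^sub>V x) = cinner x ((adj Z * Z) *\<^sub>V x)"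
        by (simp add: cinner_adj_right)
      then show "Z *\<^sub>V x = 0 *\<^sub>V x" using that by (simp add: cinner_self)
    qed
    have "D = 0" using z[of D] z[of "D * D"] DD aD by simp
    then show "X = R" by (simp add: D_def)
  qed
  show ?thesis using *[OF S] *[OF S'] eq by simp
qed

lemma abs_op: "positive_op (abs_op T)" "abs_op T * abs_op T = adj T * T"
  and abs_op_commute: "adj T * T * X = X * (adj T * T) \<Longrightarrow> abs_op T * X = X * abs_op T"
proof -
  obtain S where S: "positive_op S" "S * S = adj T * T" "\<And>X. adj T * T * X = X * (adj T * T) \<Longrightarrow> S * X = X * S"
    using sqrt_exists[OF positive_op_adj_mult[of T]] by blast
  have eq: "abs_op T = S"
    unfolding abs_op_def
  proof (rule the_equality)
    show "P = S" if "positive_op P \<and> P * P = adj T * T" for P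
      using sqrt_unique[of P S] S(1,2) that by simp
  qed (use S(1,2) in simp)
  show "positive_op (abs_op T)" "abs_op T * abs_op T = adj T * T" unfolding eq by (fact S(1), fact S(2))
  show "adj T * T * X = X * (adj T * T) \<Longrightarrow> abs_op T * X = X * abs_op T" unfolding eq by (rule S(3))
qed

lemma norm_apply_abs_op: "norm (abs_op T *\<^sub>V x) = norm (T *\<^sub>V x)"
proof -
  have "cinner (abs_op T *\<^sub>V x) (abs_op T *\<^sub>V x) = cinner x ((abs_op T * abs_op T) *\<^sub>V x)"
    using cinner_adj_left[of "abs_op T" x "abs_op T *\<^sub>V x"] positive_opD(1)[OF abs_op(1)[of T]] by simp
  also have "\<dots> = cinner (T *\<^sub>V x) (T *\<^sub>V x)" by (simp add: abs_op(2) cinner_adj_right)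
  finally show ?thesis by (simp add: cinner_self del: of_real_power)
qed

text \<open>The contractions \<open>T(\<bar>T\<bar> + \<epsilon>)\<^sup>-\<^sup>1\<close> replace the partial isometry of the polar decomposition.\<close>

lemma approx_polar:
  assumes "\<epsilon> > 0"
  obtains W where "norm W \<le> 1" "norm (T - W * abs_op T) \<le> \<epsilon>" "norm (abs_op T - adj W * T) \<le> \<epsilon>"
    "\<And>X. X * T = T * X \<Longrightarrow> X * abs_op T = abs_op T * X \<Longrightarrow> X * W = W * X"
proof -
  define Q where "Q = abs_op T"
  define M where "M = Q + \<epsilon> *\<^sub>R 1"
  have Q: "positive_op Q" "adj Q = Q" "Q * Q = adj T * T"
    unfolding Q_def using abs_op positive_opD by auto
  have M: "invertible_op M"
    by (rule accretive_invertible[OF assms])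
      (use positive_opD(2)[OF Q(1)] in \<open>simp add: M_def cinner_linear cinner_self[of x for x] del: of_real_power\<close>)
  define R where "R = op_inverse M"
  have RM: "R * M = 1" "M * R = 1" unfolding R_def using op_inverse[OF M] by auto
  have aM: "adj M = M" by (simp add: M_def Q)
  have "adj R = R"
    using op_inverse_eqI[of "adj R" M] arg_cong[OF RM(1), of adj] arg_cong[OF RM(2), of adj]
    by (simp add: aM R_def)
  have Qy: "norm (Q *\<^sub>V R *\<^sub>V x) \<le> norm x" for x
  proof -
    define y where "y = R *\<^sub>V x"
    have "M *\<^sub>V y = x" unfolding y_def using RM by (metis bop_apply_simps(5,6))
    then have "(norm x)\<^sup>2 = (norm (Q *\<^sub>V y))\<^sup>2 + 2 * (\<epsilon> * Re (cinner (Q *\<^sub>V y) y)) + (\<epsilon> * norm y)\<^sup>2"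
      by (auto simp: M_def norm_add_sq cinner_scaleR_right power_mult_distrib)
    moreover have "Re (cinner (Q *\<^sub>V y) y) \<ge> 0"
      using cinner_adj_left[of Q y y] Q positive_opD(2)[OF Q(1), of y] by simp
    ultimately have "(norm (Q *\<^sub>V y))\<^sup>2 \<le> (norm x)\<^sup>2" using assms by simp
    then show ?thesis unfolding y_def by (rule power2_le_imp_le) simp
  qed
  have nQR: "norm (Q * R) \<le> 1" by (rule norm_bop_le) (use Qy in auto)
  then have nRQ: "norm (R * Q) \<le> 1" using norm_adj[of "Q * R"] \<open>adj R = R\<close> Q by simp
  define W where "W = T * R"
  have nW: "norm W \<le> 1"
    by (rule norm_bop_le) (use Qy norm_apply_abs_op[of T] in \<open>auto simp: W_def Q_def\<close>)
  show ?thesis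
  proof (rule that[OF nW])
    have "T - W * Q = \<epsilon> *\<^sub>R W"
    proof -
      have "W * M = T" unfolding W_def by (simp add: mult.assoc RM)
      then show ?thesis by (simp add: M_def distrib_left) (metis add_diff_cancel_left')
    qed
    then show "norm (T - W * abs_op T) \<le> \<epsilon>" using nW assms by (simp add: Q_def mult_left_le)
    have "Q - adj W * T = \<epsilon> *\<^sub>R (R * Q)"
    proof -
      have "R * M * Q = Q" by (simp add: RM)
      then have "R * Q * Q + \<epsilon> *\<^sub>R (R * Q) = Q" by (simp add: M_def algebra_simps)
      moreover have "adj W * T = R * Q * Q" by (simp add: W_def \<open>adj R = R\<close> mult.assoc Q(3))
      ultimately show ?thesis by (metis add_diff_cancel_left')
    qed
    then show "norm (abs_op T - adj W * T) \<le> \<epsilon>" using nRQ assms by (simp add: Q_def mult_left_le)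
    fix X assume X: "X * T = T * X" "X * abs_op T = abs_op T * X"
    have "M * X = X * M" using X by (simp add: M_def Q_def algebra_simps)
    then have "R * (M * X) * R = R * (X * M) * R" by simp
    then have "X * R = R * X" using RM by (simp add: mult.assoc) (metis RM(1) mult.assoc mult.left_neutral)
    then show "X * W = W * X" unfolding W_def using X(1) by (metis mult.assoc)
  qed
qed

lemma approx_polar_sequence:
  obtains W where "\<And>n. norm (W n) \<le> 1" "(\<lambda>n. W n * abs_op T) \<longlonglongrightarrow> T"
    "(\<lambda>n. adj (W n) * T) \<longlonglongrightarrow> abs_op T"
proof -
  have "\<exists>W. norm W \<le> 1 \<and> norm (T - W * abs_op T) \<le> 1 / real (Suc n)
      \<and> norm (abs_op T - adj W * T) \<le> 1 / real (Suc n)" for n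
    by (rule approx_polar[of "1 / real (Suc n)" T]) auto
  then obtain W where W: "\<And>n. norm (W n) \<le> 1" "\<And>n. norm (T - W n * abs_op T) \<le> 1 / real (Suc n)"
    "\<And>n. norm (abs_op T - adj (W n) * T) \<le> 1 / real (Suc n)" by metis
  have lim: "X \<longlonglongrightarrow> Y" if "\<And>n. norm (Y - X n) \<le> 1 / real (Suc n)" for X and Y :: "'a bop"
  proof -
    have "(\<lambda>n. Y - X n) \<longlonglongrightarrow> 0"
      by (rule Lim_null_comparison[OF _ LIMSEQ_Suc[OF lim_inverse_n]]) (use that in \<open>auto simp: divide_inverse\<close>)
    then have "(\<lambda>n. Y - (Y - X n)) \<longlonglongrightarrow> Y - 0" by (intro tendsto_intros)
    then show ?thesis by simp
  qed
  show ?thesis by (rule that[OF W(1) lim[OF W(2)] lim[OF W(3)]])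
qed

lemma abs_op_dominates:
  assumes "adj R = R"
  shows "\<bar>Re (cinner x (R *\<^sub>V x))\<bar> \<le> Re (cinner x (abs_op R *\<^sub>V x))"
proof (rule field_le_epsilon)
  fix \<delta> :: real assume d: "\<delta> > 0"
  define \<epsilon> where "\<epsilon> = \<delta> / ((norm x)\<^sup>2 + 1)"
  have N: "(norm x)\<^sup>2 + 1 > 0" by (simp add: add_nonneg_pos)
  have "\<epsilon> > 0" unfolding \<epsilon>_def using d N by (rule divide_pos_pos)
  moreover have "\<epsilon> * (norm x)\<^sup>2 \<le> \<delta>" using d N by (simp add: \<epsilon>_def divide_le_eq)
  ultimately have e: "\<epsilon> > 0" "\<epsilon> * (norm x)\<^sup>2 \<le> \<delta>" by auto
  obtain S where S: "positive_op S" "S * S = abs_op R" and comm: "\<And>X. abs_op R * X = X * abs_op R \<Longrightarrow> S * X = X * S"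
    using sqrt_exists[OF abs_op(1)] by blast
  have aR: "abs_op R * R = R * abs_op R"
    by (rule abs_op_commute) (simp add: assms mult.assoc)
  obtain W where W: "norm W \<le> 1" "norm (R - W * abs_op R) \<le> \<epsilon>"
    and Wc: "\<And>X. X * R = R * X \<Longrightarrow> X * abs_op R = abs_op R * X \<Longrightarrow> X * W = W * X"
    using approx_polar[OF e(1), of R] by blast
  have SW: "S * W = W * S"
    by (rule Wc) (simp add: comm aR, simp add: S(2)[symmetric] mult.assoc)
  have Sa: "cinner u (S *\<^sub>V v) = cinner (S *\<^sub>V u) v" for u v
    using cinner_adj_right[of u S v] positive_opD(1)[OF S(1)] by simp
  have "(W * abs_op R) = S * W * S" by (simp add: S(2)[symmetric] SW mult.assoc)
  then have "cinner x ((W * abs_op R) *\<^sub>V x) = cinner (S *\<^sub>V x) (W *\<^sub>V S *\<^sub>V x)"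
    by (simp add: Sa)
  then have "cmod (cinner x ((W * abs_op R) *\<^sub>V x)) \<le> norm (S *\<^sub>V x) * (norm W * norm (S *\<^sub>V x))"
    by (simp only:) (rule order_trans[OF cmod_cinner_le mult_left_mono[OF norm_bop_apply]], simp)
  also have "\<dots> \<le> (norm (S *\<^sub>V x))\<^sup>2"
    using mult_right_mono[OF W(1), of "(norm (S *\<^sub>V x))\<^sup>2"] by (simp add: power2_eq_square mult_ac)
  also have "\<dots> = Re (cinner (S *\<^sub>V x) (S *\<^sub>V x))" by (simp add: cinner_self del: of_real_power)
  also have "\<dots> = Re (cinner x (abs_op R *\<^sub>V x))" by (simp add: Sa S(2)[symmetric])
  finally have 1: "cmod (cinner x ((W * abs_op R) *\<^sub>V x)) \<le> Re (cinner x (abs_op R *\<^sub>V x))" .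
  have "cmod (cinner x ((R - W * abs_op R) *\<^sub>V x)) \<le> norm x * (norm (R - W * abs_op R) * norm x)"
    by (rule order_trans[OF cmod_cinner_le mult_left_mono[OF norm_bop_apply]]) simp
  also have "\<dots> \<le> \<epsilon> * (norm x)\<^sup>2"
    using mult_right_mono[OF W(2), of "(norm x)\<^sup>2"] by (simp add: power2_eq_square mult_ac)
  finally have 2: "cmod (cinner x ((R - W * abs_op R) *\<^sub>V x)) \<le> \<delta>" using e(2) by linarith
  have "cinner x (R *\<^sub>V x) = cinner x ((W * abs_op R) *\<^sub>V x) + cinner x ((R - W * abs_op R) *\<^sub>V x)"
    by (simp add: cinner_linear)
  then have "cmod (cinner x (R *\<^sub>V x)) \<le> Re (cinner x (abs_op R *\<^sub>V x)) + \<delta>"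
    using norm_triangle_ineq[of "cinner x ((W * abs_op R) *\<^sub>V x)" "cinner x ((R - W * abs_op R) *\<^sub>V x)"] 1 2 by simp
  then show "\<bar>Re (cinner x (R *\<^sub>V x))\<bar> \<le> Re (cinner x (abs_op R *\<^sub>V x)) + \<delta>"
    using abs_Re_le_cmod order_trans by blast
qed


section \<open>Trace class operators\<close>

definition bessel_family :: "'i set \<Rightarrow> ('i \<Rightarrow> 'h::complex_hilbert) \<Rightarrow> bool" where
  "bessel_family I x \<longleftrightarrow> (\<forall>v. (\<Sum>i\<in>I. (cmod (cinner (x i) v))\<^sup>2) \<le> (norm v)\<^sup>2)"

text \<open>\<open>trace_norm_le T c\<close> says that the trace norm of \<open>T\<close> is at most \<open>c\<close>. Bessel families instead of
  orthonormal ones make the ideal property immediate, because contractions preserve them.\<close>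

definition trace_norm_le :: "'h::complex_hilbert bop \<Rightarrow> real \<Rightarrow> bool" where
  "trace_norm_le T c \<longleftrightarrow> (\<forall>(I::'h set) x y. finite I \<longrightarrow> bessel_family I x \<longrightarrow> bessel_family I y \<longrightarrow>
     (\<Sum>i\<in>I. cmod (cinner (x i) (T *\<^sub>V y i))) \<le> c)"

lemma trace_norm_leD:
  fixes I :: "'h::complex_hilbert set" and T :: "'h bop"
  shows "trace_norm_le T c \<Longrightarrow> finite I \<Longrightarrow> bessel_family I x \<Longrightarrow> bessel_family I y \<Longrightarrow>
    (\<Sum>i\<in>I. cmod (cinner (x i) (T *\<^sub>V y i))) \<le> c"
  unfolding trace_norm_le_def by blast

lemma trace_norm_leI:
  fixes T :: "'h::complex_hilbert bop"
  assumes "\<And>(I::'h set) x y. finite I \<Longrightarrow> bessel_family I x \<Longrightarrow> bessel_family I y \<Longrightarrow>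
     (\<Sum>i\<in>I. cmod (cinner (x i) (T *\<^sub>V y i))) \<le> c"
  shows "trace_norm_le T c"
  unfolding trace_norm_le_def using assms by simp

lemma bessel_family_orthonormal: "orthonormal F \<Longrightarrow> finite F \<Longrightarrow> bessel_family F (\<lambda>e. e)"
  unfolding bessel_family_def by (intro allI bessel)

lemma bessel_family_contraction:
  assumes x: "bessel_family I x" and A: "norm A \<le> 1"
  shows "bessel_family I (\<lambda>i. A *\<^sub>V x i)"
  unfolding bessel_family_def
proof
  fix v
  have "(\<Sum>i\<in>I. (cmod (cinner (A *\<^sub>V x i) v))\<^sup>2) = (\<Sum>i\<in>I. (cmod (cinner (x i) (adj A *\<^sub>V v)))\<^sup>2)"
    by (simp add: cinner_adj_right)
  also have "\<dots> \<le> (norm (adj A *\<^sub>V v))\<^sup>2" using x by (simp add: bessel_family_def)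
  also have "\<dots> \<le> (norm v)\<^sup>2"
  proof (rule power_mono)
    have "norm (adj A *\<^sub>V v) \<le> norm A * norm v" using norm_bop_apply[of "adj A" v] by simp
    also have "\<dots> \<le> 1 * norm v" using A by (intro mult_right_mono) auto
    finally show "norm (adj A *\<^sub>V v) \<le> norm v" by simp
  qed simp
  finally show "(\<Sum>i\<in>I. (cmod (cinner (A *\<^sub>V x i) v))\<^sup>2) \<le> (norm v)\<^sup>2" .
qed

lemma trace_norm_le_nonneg: "trace_norm_le T c \<Longrightarrow> 0 \<le> c"
  using trace_norm_leD[of T c "{}"] by (simp add: bessel_family_def)

lemma trace_norm_le_mono: "trace_norm_le T c \<Longrightarrow> c \<le> d \<Longrightarrow> trace_norm_le T d"
  unfolding trace_norm_le_def by (meson order_trans)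

lemma trace_norm_le_zero: "trace_norm_le 0 0"
  by (rule trace_norm_leI) simp

lemma trace_norm_le_add:
  assumes "trace_norm_le S c" "trace_norm_le T d"
  shows "trace_norm_le (S + T) (c + d)"
proof (rule trace_norm_leI)
  fix I :: "'a set" and x y :: "'a \<Rightarrow> 'a" assume I: "finite I" "bessel_family I x" "bessel_family I y"
  have "(\<Sum>i\<in>I. cmod (cinner (x i) ((S + T) *\<^sub>V y i)))
      \<le> (\<Sum>i\<in>I. cmod (cinner (x i) (S *\<^sub>V y i)) + cmod (cinner (x i) (T *\<^sub>V y i)))"
    by (intro sum_mono) (simp add: cinner_add_right norm_triangle_ineq)
  also have "\<dots> \<le> c + d"
    unfolding sum.distrib by (intro add_mono trace_norm_leD[OF assms(1) I] trace_norm_leD[OF assms(2) I])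
  finally show "(\<Sum>i\<in>I. cmod (cinner (x i) ((S + T) *\<^sub>V y i))) \<le> c + d" .
qed

lemma trace_norm_le_scaleC:
  assumes "trace_norm_le T c"
  shows "trace_norm_le (a *\<^sub>C T) (cmod a * c)"
proof (rule trace_norm_leI)
  fix I :: "'a set" and x y :: "'a \<Rightarrow> 'a" assume I: "finite I" "bessel_family I x" "bessel_family I y"
  show "(\<Sum>i\<in>I. cmod (cinner (x i) ((a *\<^sub>C T) *\<^sub>V y i))) \<le> cmod a * c"
    using mult_left_mono[OF trace_norm_leD[OF assms I], of "cmod a"]
    by (simp add: cinner_scaleC_right norm_mult sum_distrib_left)
qed

lemma trace_norm_le_scaleR: "trace_norm_le T c \<Longrightarrow> trace_norm_le (r *\<^sub>R T) (\<bar>r\<bar> * c)"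
  using trace_norm_le_scaleC[of T c "of_real r"] by (simp add: scaleC_of_real)

lemma trace_norm_le_minus: "trace_norm_le T c \<Longrightarrow> trace_norm_le (- T) c"
  using trace_norm_le_scaleR[of T c "-1"] by simp

lemma trace_norm_le_diff: "trace_norm_le S c \<Longrightarrow> trace_norm_le T d \<Longrightarrow> trace_norm_le (S - T) (c + d)"
  using trace_norm_le_add[OF _ trace_norm_le_minus] by force

lemma trace_norm_le_adj:
  assumes "trace_norm_le T c"
  shows "trace_norm_le (adj T) c"
proof (rule trace_norm_leI)
  fix I :: "'a set" and x y :: "'a \<Rightarrow> 'a" assume I: "finite I" "bessel_family I x" "bessel_family I y"
  have "cmod (cinner (x i) (adj T *\<^sub>V y i)) = cmod (cinner (y i) (T *\<^sub>V x i))" for i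
    unfolding cinner_adj_right by (subst cinner_commute) simp
  then show "(\<Sum>i\<in>I. cmod (cinner (x i) (adj T *\<^sub>V y i))) \<le> c"
    using trace_norm_leD[OF assms I(1) I(3) I(2)] by simp
qed

lemma trace_norm_le_mult_right:
  assumes T: "trace_norm_le T c"
  shows "trace_norm_le (T * A) (norm A * c)"
proof (cases "A = 0")
  case False
  define B where "B = (1 / norm A) *\<^sub>R A"
  have B: "norm B \<le> 1" "A = norm A *\<^sub>R B" using False by (simp_all add: B_def)
  have "trace_norm_le (T * B) c"
  proof (rule trace_norm_leI)
    fix I :: "'a set" and x y :: "'a \<Rightarrow> 'a" assume I: "finite I" "bessel_family I x" "bessel_family I y"
    show "(\<Sum>i\<in>I. cmod (cinner (x i) ((T * B) *\<^sub>V y i))) \<le> c"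
      using trace_norm_leD[OF T I(1,2) bessel_family_contraction[OF I(3) B(1)]] by simp
  qed
  from trace_norm_le_scaleR[OF this, of "norm A"] show ?thesis
    by (subst B(2)) simp
qed (simp add: trace_norm_le_zero)

lemma trace_norm_le_mult_left:
  assumes T: "trace_norm_le T c"
  shows "trace_norm_le (A * T) (norm A * c)"
  using trace_norm_le_adj[OF trace_norm_le_mult_right[OF trace_norm_le_adj[OF T], of "adj A"]] by simp

lemma trace_norm_le_sum:
  "(\<And>i. i \<in> I \<Longrightarrow> trace_norm_le (f i) (c i)) \<Longrightarrow> trace_norm_le (sum f I) (sum c I)"
  by (induction I rule: infinite_finite_induct) (auto simp: trace_norm_le_zero intro!: trace_norm_le_add)

lemma trace_norm_le_limit:
  assumes X: "\<And>n. trace_norm_le (X n) c" and lim: "X \<longlonglongrightarrow> T"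
  shows "trace_norm_le T c"
proof (rule trace_norm_leI)
  fix I :: "'a set" and x y :: "'a \<Rightarrow> 'a" assume I: "finite I" "bessel_family I x" "bessel_family I y"
  have "(\<lambda>n. \<Sum>i\<in>I. cmod (cinner (x i) (X n *\<^sub>V y i))) \<longlonglongrightarrow> (\<Sum>i\<in>I. cmod (cinner (x i) (T *\<^sub>V y i)))"
    by (intro tendsto_intros bounded_linear.tendsto[OF bounded_linear_cinner_bop lim])
  then show "(\<Sum>i\<in>I. cmod (cinner (x i) (T *\<^sub>V y i))) \<le> c"
    by (rule LIMSEQ_le_const2) (use trace_norm_leD[OF X I] in blast)
qed

lemma bessel_family_hilbert_schmidt:
  assumes E: "is_onb E" and S: "adj S = S" and h: "((\<lambda>e. (norm (S *\<^sub>V e))\<^sup>2) has_sum h) E"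
    and I: "finite I" "bessel_family I y"
  shows "(\<Sum>i\<in>I. (norm (S *\<^sub>V y i))\<^sup>2) \<le> h"
proof -
  have "((\<lambda>e. \<Sum>i\<in>I. (cmod (cinner e (S *\<^sub>V y i)))\<^sup>2) has_sum (\<Sum>i\<in>I. (norm (S *\<^sub>V y i))\<^sup>2)) E"
    using I(1)
  proof (induction I rule: finite_induct)
    case (insert i I)
    then show ?case by (simp add: has_sum_add[OF parseval[OF E] insert.IH])
  qed simp
  moreover have "(\<Sum>i\<in>I. (cmod (cinner e (S *\<^sub>V y i)))\<^sup>2) \<le> (norm (S *\<^sub>V e))\<^sup>2" for e
  proof -
    have "cmod (cinner e (S *\<^sub>V y i)) = cmod (cinner (y i) (S *\<^sub>V e))" for i
      using cinner_adj_right[of e S "y i"] S cinner_commute[of "S *\<^sub>V e" "y i"] by simp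
    then show ?thesis using I(2) by (simp add: bessel_family_def)
  qed
  ultimately show ?thesis by (rule has_sum_mono[OF _ h])
qed

lemma cinner_sqrt:
  assumes "positive_op S" "S * S = Q"
  shows "cinner x (Q *\<^sub>V x) = of_real ((norm (S *\<^sub>V x))\<^sup>2)"
  using cinner_adj_left[of S x "S *\<^sub>V x"] positive_opD(1)[OF assms(1)]
  by (simp add: assms(2)[symmetric] cinner_self)

lemma trace_norm_le_if_trace_class:
  assumes "trace_class T"
  obtains c where "trace_norm_le T c"
proof -
  obtain E where E: "is_onb E" and sm: "(\<lambda>e. cinner e (abs_op T *\<^sub>V e)) summable_on E"
    using assms unfolding trace_class_def by blast
  obtain S where S: "positive_op S" "S * S = abs_op T" using sqrt_exists[OF abs_op(1)] by blast
  have aS: "adj S = S" by (rule positive_opD(1)[OF S(1)])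
  have "(\<lambda>e. Re (cinner e (abs_op T *\<^sub>V e))) summable_on E"
    by (rule summable_on_bounded_linear[OF bounded_linear_Re sm])
  then have "(\<lambda>e. (norm (S *\<^sub>V e))\<^sup>2) summable_on E"
    by (simp add: cinner_sqrt[OF S] del: of_real_power)
  then obtain h where h: "((\<lambda>e. (norm (S *\<^sub>V e))\<^sup>2) has_sum h) E" by (auto simp: summable_on_def)
  have *: "trace_norm_le (W * abs_op T) h" if W: "norm W \<le> 1" for W
  proof (rule trace_norm_leI)
    fix I :: "'a set" and x y :: "'a \<Rightarrow> 'a" assume I: "finite I" "bessel_family I x" "bessel_family I y"
    have x': "bessel_family I (\<lambda>i. adj W *\<^sub>V x i)" using bessel_family_contraction[OF I(2), of "adj W"] W by simp
    have "cmod (cinner (x i) ((W * abs_op T) *\<^sub>V y i))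
        \<le> ((norm (S *\<^sub>V adj W *\<^sub>V x i))\<^sup>2 + (norm (S *\<^sub>V y i))\<^sup>2) / 2" for i
    proof -
      have "cinner (x i) ((W * abs_op T) *\<^sub>V y i) = cinner (S *\<^sub>V adj W *\<^sub>V x i) (S *\<^sub>V y i)"
        using cinner_adj_left[of S "adj W *\<^sub>V x i" "S *\<^sub>V y i"] cinner_adj_left[of W "x i"]
        by (simp add: aS S(2)[symmetric])
      then have "cmod (cinner (x i) ((W * abs_op T) *\<^sub>V y i)) \<le> norm (S *\<^sub>V adj W *\<^sub>V x i) * norm (S *\<^sub>V y i)"
        using cmod_cinner_le by simp
      then show ?thesis using sum_squares_bound[of "norm (S *\<^sub>V adj W *\<^sub>V x i)" "norm (S *\<^sub>V y i)"] by simp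
    qed
    then have "(\<Sum>i\<in>I. cmod (cinner (x i) ((W * abs_op T) *\<^sub>V y i)))
        \<le> (\<Sum>i\<in>I. ((norm (S *\<^sub>V adj W *\<^sub>V x i))\<^sup>2 + (norm (S *\<^sub>V y i))\<^sup>2) / 2)"
      by (intro sum_mono)
    also have "\<dots> = ((\<Sum>i\<in>I. (norm (S *\<^sub>V adj W *\<^sub>V x i))\<^sup>2) + (\<Sum>i\<in>I. (norm (S *\<^sub>V y i))\<^sup>2)) / 2"
      by (simp add: sum.distrib sum_divide_distrib[symmetric])
    also have "\<dots> \<le> h"
      using bessel_family_hilbert_schmidt[OF E aS h I(1) x'] bessel_family_hilbert_schmidt[OF E aS h I(1,3)] by simp
    finally show "(\<Sum>i\<in>I. cmod (cinner (x i) ((W * abs_op T) *\<^sub>V y i))) \<le> h" .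
  qed
  obtain W where W: "\<And>n. norm (W n) \<le> 1" "(\<lambda>n. W n * abs_op T) \<longlonglongrightarrow> T"
    by (rule approx_polar_sequence[of T]) blast
  from trace_norm_le_limit[OF *[OF W(1)] W(2)] show ?thesis by (rule that)
qed

abbreviation trace_on :: "'h::complex_hilbert set \<Rightarrow> 'h bop \<Rightarrow> complex" where
  "trace_on E T \<equiv> infsum (\<lambda>e. cinner e (T *\<^sub>V e)) E"

lemma trace_norm_le_summable:
  assumes T: "trace_norm_le T c" and E: "is_onb E"
  shows "(\<lambda>e. cmod (cinner e (T *\<^sub>V e))) summable_on E" "cmod (trace_on E T) \<le> c"
proof -
  have b: "(\<Sum>e\<in>F. cmod (cinner e (T *\<^sub>V e))) \<le> c" if "finite F" "F \<subseteq> E" for F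
    using trace_norm_leD[OF T that(1) bessel_family_orthonormal bessel_family_orthonormal] that orthonormal_subset[OF onb_orthonormal[OF E]]
    by simp
  show s: "(\<lambda>e. cmod (cinner e (T *\<^sub>V e))) summable_on E"
    by (rule nonneg_bdd_above_summable_on) (auto simp: bdd_above_def intro!: exI[of _ c] b)
  have "cmod (trace_on E T) \<le> infsum (\<lambda>e. cmod (cinner e (T *\<^sub>V e))) E"
    by (rule norm_infsum_bound[OF s])
  also have "\<dots> \<le> c" by (rule infsum_le_finite_sums[OF s]) (rule b)
  finally show "cmod (trace_on E T) \<le> c" .
qed

lemma trace_class_if_trace_norm_le:
  fixes T :: "'h::complex_hilbert bop"
  assumes T: "trace_norm_le T c"
  shows "trace_class T"
proof -
  obtain W where W: "\<And>n. norm (W n) \<le> 1" and lim: "(\<lambda>n. adj (W n) * T) \<longlonglongrightarrow> abs_op T"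
    by (rule approx_polar_sequence[of T]) blast
  have "trace_norm_le (adj (W n) * T) c" for n
    by (rule trace_norm_le_mono[OF trace_norm_le_mult_left[OF T]])
      (use W[of n] trace_norm_le_nonneg[OF T] in \<open>simp add: mult_left_le_one_le\<close>)
  from trace_norm_le_limit[OF this lim] have "trace_norm_le (abs_op T) c" .
  moreover obtain E :: "'h set" where E: "is_onb E" using onb_exists by blast
  ultimately show ?thesis
    unfolding trace_class_def using trace_norm_le_summable(1)[THEN abs_summable_summable] by blast
qed

lemma trace_class_iff: "trace_class T \<longleftrightarrow> (\<exists>c. trace_norm_le T c)"
  using trace_norm_le_if_trace_class trace_class_if_trace_norm_le by metis

lemma trace_class_add: "trace_class S \<Longrightarrow> trace_class T \<Longrightarrow> trace_class (S + T)"
  unfolding trace_class_iff by (meson trace_norm_le_add)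
lemma trace_class_diff: "trace_class S \<Longrightarrow> trace_class T \<Longrightarrow> trace_class (S - T)"
  unfolding trace_class_iff by (meson trace_norm_le_diff)
lemma trace_class_minus: "trace_class T \<Longrightarrow> trace_class (- T)"
  unfolding trace_class_iff by (meson trace_norm_le_minus)
lemma trace_class_scaleC: "trace_class T \<Longrightarrow> trace_class (a *\<^sub>C T)"
  unfolding trace_class_iff by (meson trace_norm_le_scaleC)
lemma trace_class_scaleR: "trace_class T \<Longrightarrow> trace_class (r *\<^sub>R T)"
  unfolding trace_class_iff by (meson trace_norm_le_scaleR)
lemma trace_class_mult_left: "trace_class T \<Longrightarrow> trace_class (A * T)"
  unfolding trace_class_iff by (meson trace_norm_le_mult_left)
lemma trace_class_mult_right: "trace_class T \<Longrightarrow> trace_class (T * A)"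
  unfolding trace_class_iff by (meson trace_norm_le_mult_right)
lemma trace_class_adj: "trace_class T \<Longrightarrow> trace_class (adj T)"
  unfolding trace_class_iff by (meson trace_norm_le_adj)

lemma trace_class_abs_op: "trace_class T \<Longrightarrow> trace_class (abs_op T)"
proof -
  assume "trace_class T"
  moreover have "abs_op (abs_op T) = abs_op T"
    by (rule sqrt_unique) (simp_all add: abs_op positive_opD(1)[OF abs_op(1)])
  ultimately show ?thesis unfolding trace_class_def by simp
qed

lemma some_onb: "is_onb (SOME E. is_onb E)"
  using onb_exists by (rule someI_ex)

lemma op_trace_eq: "trace_class T \<Longrightarrow> op_trace T = trace_on (SOME E. is_onb E) T"
  by (simp add: op_trace_def)

lemma trace_class_summable: "trace_class T \<Longrightarrow> is_onb E \<Longrightarrow> (\<lambda>e. cinner e (T *\<^sub>V e)) summable_on E"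
  unfolding trace_class_iff using trace_norm_le_summable(1)[THEN abs_summable_summable] by blast

lemma cmod_op_trace_le: "trace_norm_le T c \<Longrightarrow> cmod (op_trace T) \<le> c"
  using trace_norm_le_summable(2)[OF _ some_onb] by (simp add: op_trace_eq trace_class_if_trace_norm_le)

lemma op_trace_add: "trace_class S \<Longrightarrow> trace_class T \<Longrightarrow> op_trace (S + T) = op_trace S + op_trace T"
  by (simp add: op_trace_eq trace_class_add cinner_add_right infsum_add trace_class_summable some_onb)

lemma op_trace_scaleC: "trace_class T \<Longrightarrow> op_trace (a *\<^sub>C T) = a * op_trace T"
  by (simp add: op_trace_eq trace_class_scaleC cinner_scaleC_right infsum_cmult_right trace_class_summable some_onb)

lemma op_trace_scaleR: "trace_class T \<Longrightarrow> op_trace (r *\<^sub>R T) = r *\<^sub>R op_trace T"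
  using op_trace_scaleC[of T "of_real r"] by (simp add: scaleC_of_real scaleR_conv_of_real)

lemma op_trace_diff: "trace_class S \<Longrightarrow> trace_class T \<Longrightarrow> op_trace (S - T) = op_trace S - op_trace T"
  using op_trace_add[of S "(-1) *\<^sub>C T"] op_trace_scaleC[of T "-1"] trace_class_scaleC[of T "-1"]
  by (simp add: scaleC_minus_left)

lemma trace_basis_independent_positive:
  assumes Q: "positive_op Q" "trace_class Q" and E: "is_onb E" and E': "is_onb E'"
  shows "trace_on E Q = trace_on E' Q"
proof -
  obtain S where S: "positive_op S" "S * S = Q" using sqrt_exists[OF Q(1)] by blast
  have aS: "adj S = S" by (rule positive_opD(1)[OF S(1)])
  let ?n = "\<lambda>e. (norm (S *\<^sub>V e))\<^sup>2"
  have sm: "?n summable_on G" if "is_onb G" for G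
    using summable_on_bounded_linear[OF bounded_linear_Re trace_class_summable[OF Q(2) that]]
    by (simp add: cinner_sqrt[OF S] del: of_real_power)
  have le: "infsum ?n G \<le> infsum ?n G'" if G: "is_onb G" and G': "is_onb G'" for G G'
  proof (rule infsum_le_finite_sums[OF sm[OF G]])
    fix F assume "finite F" "F \<subseteq> G"
    then show "sum ?n F \<le> infsum ?n G'"
      by (intro bessel_family_hilbert_schmidt[OF G' aS has_sum_infsum[OF sm[OF G']]]
          bessel_family_orthonormal orthonormal_subset[OF onb_orthonormal[OF G]])
  qed
  have "infsum ?n E = infsum ?n E'" by (intro antisym le E E')
  moreover have "trace_on G Q = of_real (infsum ?n G)" if "is_onb G" for G
    unfolding cinner_sqrt[OF S]
    by (rule infsumI) (rule has_sum_bounded_linear[OF bounded_linear_of_real has_sum_infsum[OF sm[OF that]]])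
  ultimately show ?thesis using E E' by simp
qed

lemma trace_basis_independent_selfadjoint:
  assumes R: "adj R = R" "trace_class R" and E: "is_onb E" and E': "is_onb E'"
  shows "trace_on E R = trace_on E' R"
proof -
  define P N where "P = abs_op R + R" and "N = abs_op R - R"
  have dom: "\<bar>Re (cinner x (R *\<^sub>V x))\<bar> \<le> Re (cinner x (abs_op R *\<^sub>V x))" for x
    by (rule abs_op_dominates[OF R(1)])
  have "0 \<le> Re (cinner x (P *\<^sub>V x))" "0 \<le> Re (cinner x (N *\<^sub>V x))" for x
    using dom[of x] by (simp_all add: P_def N_def cinner_linear)
  then have pos: "positive_op P" "positive_op N"
    unfolding positive_op_iff using R(1) positive_opD(1)[OF abs_op(1)] by (simp_all add: P_def N_def)
  have tc: "trace_class P" "trace_class N"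
    unfolding P_def N_def by (intro trace_class_add trace_class_diff trace_class_abs_op R(2))+
  have PN: "2 * cinner e (R *\<^sub>V e) = cinner e (P *\<^sub>V e) + (-1) * cinner e (N *\<^sub>V e)" for e
    by (simp add: P_def N_def cinner_linear)
  have *: "2 * trace_on G R = trace_on G P + (-1) * trace_on G N" if G: "is_onb G" for G
  proof -
    have "((\<lambda>e. 2 * cinner e (R *\<^sub>V e)) has_sum
        (trace_on G P + (-1) * trace_on G N)) G"
      unfolding PN by (intro has_sum_add has_sum_cmult_right has_sum_infsum trace_class_summable tc G)
    moreover have "((\<lambda>e. 2 * cinner e (R *\<^sub>V e)) has_sum 2 * trace_on G R) G"
      by (intro has_sum_cmult_right has_sum_infsum trace_class_summable R G)
    ultimately show ?thesis by (rule has_sum_unique[symmetric])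
  qed
  have "2 * trace_on E R = 2 * trace_on E' R"
    unfolding *[OF E] *[OF E'] trace_basis_independent_positive[OF pos(1) tc(1) E E']
      trace_basis_independent_positive[OF pos(2) tc(2) E E'] ..
  then show ?thesis by (simp only: mult_cancel_left) simp
qed

lemma cartesian_decomposition:
  obtains X Y where "adj X = X" "adj Y = Y" "T = X + \<i> *\<^sub>C Y"
    "trace_class T \<Longrightarrow> trace_class X" "trace_class T \<Longrightarrow> trace_class Y"
proof
  let ?X = "(1/2) *\<^sub>C (T + adj T)" and ?Y = "(\<i>/2) *\<^sub>C (adj T - T)"
  show "adj ?X = ?X" by (simp add: add.commute)
  show "adj ?Y = ?Y" by (simp add: scaleC_diff_right scaleC_minus_left)
  show "T = ?X + \<i> *\<^sub>C ?Y"
  proof -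
    have "?X + \<i> *\<^sub>C ?Y = (1/2) *\<^sub>C T + (1/2) *\<^sub>C T"
      by (simp add: scaleC_scaleC scaleC_diff_right scaleC_add_right scaleC_minus_left)
    also have "\<dots> = T" unfolding scaleC_add_left[symmetric] by simp
    finally show ?thesis ..
  qed
  show "trace_class ?X" "trace_class ?Y" if "trace_class T"
    using that by (intro trace_class_scaleC trace_class_add trace_class_diff trace_class_adj; assumption)+
qed

lemma trace_basis_independent:
  assumes T: "trace_class T" and E: "is_onb E" and E': "is_onb E'"
  shows "trace_on E T = trace_on E' T"
proof -
  obtain X Y where X: "adj X = X" "trace_class X" and Y: "adj Y = Y" "trace_class Y" and TXY: "T = X + \<i> *\<^sub>C Y"
    using cartesian_decomposition[of T] T by metis
  have *: "trace_on G T = trace_on G X + \<i> * trace_on G Y" if G: "is_onb G" for G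
    by (rule infsumI, unfold TXY bop_apply_simps cinner_linear)
      (intro has_sum_add has_sum_cmult_right has_sum_infsum trace_class_summable X Y G)
  show ?thesis
    using *[OF E] *[OF E'] trace_basis_independent_selfadjoint[OF X E E'] trace_basis_independent_selfadjoint[OF Y E E']
    by simp
qed

lemma op_trace_unitary_commute:
  assumes T: "trace_class T" and U: "unitary U"
  shows "op_trace (U * T) = op_trace (T * U)"
proof -
  define E :: "'a set" where "E = (SOME E. is_onb E)"
  have E: "is_onb E" unfolding E_def by (rule some_onb)
  have UU: "adj U *\<^sub>V U *\<^sub>V x = x" "U *\<^sub>V adj U *\<^sub>V x = x" for x
    using U bop_apply_simps(6)[of "adj U" U x] bop_apply_simps(6)[of U "adj U" x] by (simp_all add: unitary_def)
  have iso: "cinner (U *\<^sub>V x) (U *\<^sub>V y) = cinner x y" for x y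
    using cinner_adj_right[of x U "U *\<^sub>V y"] by (simp add: UU)
  have niso: "norm (U *\<^sub>V x) = norm x" for x using iso[of x x] by (simp add: cinner_self del: of_real_power)
  have inj: "inj_on ((*\<^sub>V) U) E" by (metis UU(1) inj_onI)
  have "is_onb ((*\<^sub>V) U ` E)"
    unfolding is_onb_def
  proof (intro conjI allI impI ballI)
    fix x assume *: "\<forall>e\<in>(*\<^sub>V) U ` E. cinner e x = 0"
    have "adj U *\<^sub>V x = 0"
    proof -
      have "\<forall>e\<in>E. cinner e (adj U *\<^sub>V x) = 0" using * by (simp add: cinner_adj_right)
      then show ?thesis using E by (simp add: is_onb_def)
    qed
    then show "x = 0" using UU(2)[of x] by simp
  next
    fix e f assume "e \<in> (*\<^sub>V) U ` E" "f \<in> (*\<^sub>V) U ` E" "e \<noteq> f"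
    then obtain e' f' where "e' \<in> E" "f' \<in> E" "e' \<noteq> f'" "e = U *\<^sub>V e'" "f = U *\<^sub>V f'" by blast
    then show "cinner e f = 0" using E by (simp add: iso is_onb_def)
  qed (use E in \<open>auto simp: is_onb_def niso\<close>)
  from trace_basis_independent[OF trace_class_mult_left[OF T] this E, of U]
  have "infsum (\<lambda>e. cinner (U *\<^sub>V e) (U *\<^sub>V T *\<^sub>V U *\<^sub>V e)) E = op_trace (U * T)"
    using inj by (simp add: infsum_reindex o_def op_trace_eq trace_class_mult_left[OF T] E_def)
  then show ?thesis by (simp add: iso op_trace_eq trace_class_mult_right[OF T] E_def)
qed

text \<open>For the resolvent \<open>V = (1 - \<i>H)\<^sup>-\<^sup>1\<close> the Cayley transform \<open>2V - 1\<close> is unitary. Hence \<open>V\<close> commutes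
  with every \<open>T'\<close> under the trace; \<open>T' = (1 - \<i>H) T (1 - \<i>H)\<close> gives the claim for \<open>H\<close>.\<close>

lemma op_trace_selfadjoint_commute:
  assumes T: "trace_class T" and H: "adj H = H"
  shows "op_trace (H * T) = op_trace (T * H)"
proof -
  define M where "M = 1 - \<i> *\<^sub>C H"
  have aM: "adj M = 1 + \<i> *\<^sub>C H" by (simp add: M_def H scaleC_minus_left)
  have sum2: "M + adj M = 1 + 1" by (simp add: aM) (simp add: M_def)
  have comm: "M * adj M = adj M * M" unfolding aM by (simp add: M_def algebra_simps scaleC_add_right scaleC_diff_right)
  have "Im (cinner x (H *\<^sub>V x)) = 0" for x
    using arg_cong[OF cinner_adj_right[of x H x], of Im] arg_cong[OF cinner_commute[of "H *\<^sub>V x" x], of Im] H by simp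
  then have "1 * (norm x)\<^sup>2 \<le> Re (cinner x (M *\<^sub>V x))" for x
    by (simp add: M_def cinner_linear cinner_self[of x] del: of_real_power)
  then have M: "invertible_op M" by (rule accretive_invertible[OF zero_less_one])
  define V where "V = op_inverse M"
  have VM: "V * M = 1" "M * V = 1" unfolding V_def by (rule op_inverse[OF M])+
  have aVM: "adj V * adj M = 1" "adj M * adj V = 1"
    using arg_cong[OF VM(2), of adj] arg_cong[OF VM(1), of adj] by simp_all
  have Vc: "V * adj V = adj V * V"
  proof -
    have aM': "invertible_op (adj M)" "op_inverse (adj M) = adj V"
      by (rule invertible_opI[OF aVM]) (rule op_inverse_eqI[OF aVM])
    show ?thesis
      using invertible_op_mult(2)[OF M aM'(1)] invertible_op_mult(2)[OF aM'(1) M]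
      by (simp add: comm aM'(2) V_def)
  qed
  define U where "U = adj M * V"
  have U2: "U = (1 + 1) * V - 1" unfolding U_def sum2[symmetric] by (simp add: algebra_simps VM)
  have "unitary U"
    unfolding unitary_def
  proof
    have "adj U * U = adj V * (M * adj M) * V" by (simp add: U_def mult.assoc)
    also have "\<dots> = (adj V * adj M) * (M * V)" unfolding comm by (simp add: mult.assoc)
    finally show "adj U * U = 1" by (simp add: VM aVM)
    have "U * adj U = adj M * (V * adj V) * M" by (simp add: U_def mult.assoc)
    also have "\<dots> = (adj M * adj V) * (V * M)" unfolding Vc by (simp add: mult.assoc)
    finally show "U * adj U = 1" by (simp add: VM aVM)
  qed
  define T' where "T' = M * T * M"
  have T': "trace_class T'" unfolding T'_def by (intro trace_class_mult_left trace_class_mult_right T)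
  have "U * T' = (T * M + T * M) - T'"
  proof -
    have "V * T' = T * M" unfolding T'_def using VM by (simp add: mult.assoc[symmetric])
    then show ?thesis unfolding U2 by (simp add: algebra_simps)
  qed
  moreover have "T' * U = (M * T + M * T) - T'"
  proof -
    have "T' * V = M * T" unfolding T'_def using VM by (simp add: mult.assoc)
    then show ?thesis unfolding U2 by (simp add: algebra_simps)
  qed
  ultimately have "op_trace ((T * M + T * M) - T') = op_trace ((M * T + M * T) - T')"
    using op_trace_unitary_commute[OF T' \<open>unitary U\<close>] by simp
  then have "op_trace (T * M) = op_trace (M * T)"
    by (simp add: op_trace_diff op_trace_add T T' trace_class_add trace_class_mult_left trace_class_mult_right)
  then show ?thesis
    by (simp add: M_def left_diff_distrib right_diff_distrib op_trace_diff op_trace_scaleC T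
        trace_class_scaleC trace_class_mult_left trace_class_mult_right)
qed

lemma op_trace_commute:
  assumes T: "trace_class T"
  shows "op_trace (A * T) = op_trace (T * A)"
proof -
  obtain X Y where X: "adj X = X" and Y: "adj Y = Y" and A: "A = X + \<i> *\<^sub>C Y"
    using cartesian_decomposition[of A] by metis
  show ?thesis
    unfolding A by (simp add: distrib_left distrib_right op_trace_add op_trace_scaleC T trace_class_scaleC
        trace_class_mult_left trace_class_mult_right op_trace_selfadjoint_commute[OF T X]
        op_trace_selfadjoint_commute[OF T Y])
qed


section \<open>Continuity of the inverse\<close>

lemma op_inverse_diff:
  assumes "invertible_op A" "invertible_op B"
  shows "op_inverse B - op_inverse A = op_inverse B * (A - B) * op_inverse A"
  by (simp add: left_diff_distrib right_diff_distrib mult.assoc op_inverse_cancel op_inverse assms)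

lemma invertible_op_near:
  assumes A: "invertible_op A" and small: "norm (op_inverse A) * norm (A - B) \<le> 1/2"
  shows "invertible_op B" "norm (op_inverse B - op_inverse A) \<le> 2 * (norm (op_inverse A))\<^sup>2 * norm (A - B)"
proof -
  let ?a = "norm (op_inverse A)" and ?d = "norm (A - B)"
  have "norm (op_inverse A * (A - B)) < 1"
    using order_trans[OF norm_mult_ineq small] by linarith
  from invertible_op_mult(1)[OF A neumann[OF this]]
  show B: "invertible_op B" by (simp add: right_diff_distrib op_inverse_cancel[OF A])
  have d: "norm (op_inverse B - op_inverse A) \<le> norm (op_inverse B) * ?d * ?a"
    unfolding op_inverse_diff[OF A B] by (meson norm_mult_ineq mult_right_mono norm_ge_zero order_trans)
  have "norm (op_inverse B) \<le> ?a + norm (op_inverse B - op_inverse A)"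
    using norm_triangle_ineq[of "op_inverse A" "op_inverse B - op_inverse A"] by simp
  also have "\<dots> \<le> ?a + norm (op_inverse B) * (1/2)"
    using d mult_left_mono[OF small, of "norm (op_inverse B)"] by (simp add: mult_ac)
  finally have "norm (op_inverse B) \<le> 2 * ?a" by simp
  then have "norm (op_inverse B) * ?d * ?a \<le> (2 * ?a) * ?d * ?a"
    by (intro mult_right_mono) auto
  then show "norm (op_inverse B - op_inverse A) \<le> 2 * ?a\<^sup>2 * ?d"
    using d by (simp add: power2_eq_square mult_ac)
qed

lemma eventually_invertible_op:
  assumes "(f \<longlongrightarrow> A) F"
  shows "\<forall>\<^sub>F x in F. norm (op_inverse A) * norm (A - f x) \<le> 1/2"
proof -
  have "((\<lambda>x. norm (op_inverse A) * norm (A - f x)) \<longlongrightarrow> norm (op_inverse A) * norm (A - A)) F"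
    by (intro tendsto_intros assms)
  then have "\<forall>\<^sub>F x in F. norm (op_inverse A) * norm (A - f x) < 1/2"
    by (rule order_tendstoD(2)) simp
  then show ?thesis by (rule eventually_mono) simp
qed

lemma tendsto_op_inverse:
  assumes A: "invertible_op A" and f: "(f \<longlongrightarrow> A) F"
  shows "((\<lambda>x. op_inverse (f x)) \<longlongrightarrow> op_inverse A) F"
proof -
  have "((\<lambda>x. 2 * (norm (op_inverse A))\<^sup>2 * norm (A - f x)) \<longlongrightarrow> 2 * (norm (op_inverse A))\<^sup>2 * norm (A - A)) F"
    by (intro tendsto_intros f)
  then have lim: "((\<lambda>x. 2 * (norm (op_inverse A))\<^sup>2 * norm (A - f x)) \<longlongrightarrow> 0) F" by simp
  have "\<forall>\<^sub>F x in F. norm (op_inverse (f x) - op_inverse A) \<le> 2 * (norm (op_inverse A))\<^sup>2 * norm (A - f x)"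
    using eventually_invertible_op[OF f] by (rule eventually_mono) (rule invertible_op_near(2)[OF A])
  from Lim_null_comparison[OF this lim]
  have "((\<lambda>x. op_inverse (f x) - op_inverse A) \<longlongrightarrow> 0) F" .
  then show ?thesis by (rule LIM_zero_cancel)
qed

lemma continuous_on_op_inverse:
  fixes f :: "'a::topological_space \<Rightarrow> 'h::complex_hilbert bop"
  assumes "continuous_on S f" "\<And>x. x \<in> S \<Longrightarrow> invertible_op (f x)"
  shows "continuous_on S (\<lambda>x. op_inverse (f x))"
  unfolding continuous_on_def
proof
  fix x assume x: "x \<in> S"
  show "((\<lambda>x. op_inverse (f x)) \<longlongrightarrow> op_inverse (f x)) (at x within S)"
    by (rule tendsto_op_inverse[OF assms(2)[OF x]]) (use assms(1) x in \<open>simp add: continuous_on_def\<close>)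
qed


section \<open>The logarithm as an integral of resolvents\<close>

definition res :: "'h::complex_hilbert bop \<Rightarrow> real \<Rightarrow> 'h bop" where
  "res K s = op_inverse (1 + s *\<^sub>R K)"

definition log_domain :: "'h::complex_hilbert bop \<Rightarrow> bool" where
  "log_domain K \<longleftrightarrow> (\<forall>s\<in>{0..1}. invertible_op (1 + s *\<^sub>R K))"

definition res_integral :: "'h::complex_hilbert bop \<Rightarrow> 'h bop" where
  "res_integral K = integral {0..1} (res K)"

lemma continuous_on_res: "log_domain K \<Longrightarrow> continuous_on {0..1} (res K)"
  unfolding res_def log_domain_def by (intro continuous_on_op_inverse continuous_intros) auto

lemma integrable_res: "log_domain K \<Longrightarrow> res K integrable_on {0..1}"
  by (rule integrable_continuous_interval[OF continuous_on_res])

lemma res_inverse: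
  assumes "log_domain K" "s \<in> {0..1}"
  shows "res K s * (1 + s *\<^sub>R K) = 1" "(1 + s *\<^sub>R K) * res K s = 1"
  using op_inverse[of "1 + s *\<^sub>R K"] assms unfolding log_domain_def res_def by simp_all

lemma res_commute:
  assumes "log_domain K" "s \<in> {0..1}"
  shows "K * res K s = res K s * K"
proof -
  note R = res_inverse[OF assms]
  have "res K s * (K * (1 + s *\<^sub>R K)) * res K s = res K s * ((1 + s *\<^sub>R K) * K) * res K s"
    by (simp add: distrib_left distrib_right)
  then have "res K s * K * ((1 + s *\<^sub>R K) * res K s) = (res K s * (1 + s *\<^sub>R K)) * (K * res K s)"
    by (simp only: mult.assoc)
  then show ?thesis by (simp add: R)
qed

text \<open>Since \<open>d/ds (s (1 + s K)\<^sup>-\<^sup>1) = (1 + s K)\<^sup>-\<^sup>2\<close>.\<close>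

lemma has_integral_res_sq:
  assumes K: "log_domain K"
  shows "((\<lambda>s. res K s * res K s) has_integral op_inverse (1 + K)) {0..1}"
proof -
  have "((\<lambda>s. s *\<^sub>R res K s) has_vector_derivative res K s * res K s) (at s within {0..1})" if s: "s \<in> {0..1}" for s
    unfolding has_vector_derivative_def has_derivative_iff_norm
  proof
    show "bounded_linear (\<lambda>x. x *\<^sub>R (res K s * res K s))" by (rule bounded_linear_scaleR_left)
    have "(res K \<longlongrightarrow> res K s) (at s within {0..1})"
      using continuous_on_res[OF K] s by (simp add: continuous_on_def)
    then have "((\<lambda>y. norm (res K y * res K s - res K s * res K s)) \<longlongrightarrow> norm (res K s * res K s - res K s * res K s)) (at s within {0..1})"
      by (intro tendsto_intros)
    then have lim: "((\<lambda>y. norm (res K y * res K s - res K s * res K s)) \<longlongrightarrow> 0) (at s within {0..1})" by simp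
    have eq: "norm (y *\<^sub>R res K y - s *\<^sub>R res K s - (y - s) *\<^sub>R (res K s * res K s)) / norm (y - s)
        = norm (res K y * res K s - res K s * res K s)" if y: "y \<in> {0..1}" "y \<noteq> s" for y
    proof -
      have "y *\<^sub>R res K y - s *\<^sub>R res K s
          = res K y * (y *\<^sub>R (1 + s *\<^sub>R K) - s *\<^sub>R (1 + y *\<^sub>R K)) * res K s"
        using res_inverse[OF K s] res_inverse[OF K y(1)]
        by (simp add: left_diff_distrib right_diff_distrib mult.assoc)
      also have "y *\<^sub>R (1 + s *\<^sub>R K) - s *\<^sub>R (1 + y *\<^sub>R K) = (y - s) *\<^sub>R 1"
        by (simp add: scaleR_add_right scaleR_diff_left mult.commute)
      finally have "y *\<^sub>R res K y - s *\<^sub>R res K s - (y - s) *\<^sub>R (res K s * res K s)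
          = (y - s) *\<^sub>R (res K y * res K s - res K s * res K s)"
        by (simp add: scaleR_diff_right)
      then show ?thesis using y(2) by simp
    qed
    show "((\<lambda>y. norm (y *\<^sub>R res K y - s *\<^sub>R res K s - (y - s) *\<^sub>R (res K s * res K s)) / norm (y - s)) \<longlongrightarrow> 0) (at s within {0..1})"
      by (rule Lim_transform_eventually[OF lim])
        (unfold eventually_at_filter, intro always_eventually allI impI eq[symmetric])
  qed
  then have "((\<lambda>s. res K s * res K s) has_integral (1 *\<^sub>R res K 1 - 0 *\<^sub>R res K 0)) {0..1}"
    by (intro fundamental_theorem_of_calculus) auto
  then show ?thesis by (simp add: res_def)
qed

lemma bounded_linear_op_trace_mult:
  assumes "trace_class K"
  shows "bounded_linear (\<lambda>X. op_trace (K * X))"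
proof -
  obtain c where c: "trace_norm_le K c" using assms trace_norm_le_if_trace_class by blast
  show ?thesis
    by (rule bounded_linear_intro[where K = c])
      (simp_all add: distrib_left op_trace_add op_trace_scaleR assms trace_class_mult_right
        cmod_op_trace_le[OF trace_norm_le_mult_right[OF c]])
qed

abbreviation trace_log :: "'h::complex_hilbert bop \<Rightarrow> complex" where
  "trace_log K \<equiv> op_trace (K * res_integral K)"

lemma op_trace_log_eq_integral:
  assumes "log_domain K" "trace_class K"
  shows "((\<lambda>s. op_trace (K * res K s)) has_integral trace_log K) {0..1}"
  unfolding res_integral_def
  using has_integral_linear[OF integrable_integral[OF integrable_res[OF assms(1)]] bounded_linear_op_trace_mult[OF assms(2)]]
  by (simp add: o_def)

text \<open>The differential of \<open>K \<mapsto> Tr log (1 + K)\<close> at \<open>K\<^sub>1\<close> is \<open>D \<mapsto> Tr (D (1 + K\<^sub>1)\<^sup>-\<^sup>1)\<close>.\<close>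

lemma op_trace_log_expansion:
  assumes dom: "log_domain K1" "log_domain K2" and tc: "trace_class K1" "trace_class K2"
    and d: "trace_norm_le (K2 - K1) d"
    and M: "\<And>s. s \<in> {0..1} \<Longrightarrow> norm (res K1 s) \<le> M" "\<And>s. s \<in> {0..1} \<Longrightarrow> norm (res K2 s) \<le> M"
  shows "cmod (trace_log K2 - trace_log K1
      - op_trace ((K2 - K1) * op_inverse (1 + K1))) \<le> M ^ 3 * d * norm (K2 - K1)"
proof -
  define D where "D = K2 - K1"
  have tD: "trace_class D" unfolding D_def by (intro trace_class_diff tc)
  have M0: "0 \<le> M" using order_trans[OF norm_ge_zero M(1)[of 0]] by simp
  have d0: "0 \<le> d" by (rule trace_norm_le_nonneg[OF d])
  let ?f = "\<lambda>s. op_trace (K2 * res K2 s) - op_trace (K1 * res K1 s) - op_trace (D * (res K1 s * res K1 s))"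
  have "((\<lambda>s. op_trace (D * (res K1 s * res K1 s))) has_integral op_trace (D * op_inverse (1 + K1))) {0..1}"
    using has_integral_linear[OF has_integral_res_sq[OF dom(1)] bounded_linear_op_trace_mult[OF tD]] by (simp add: o_def)
  then have int: "(?f has_integral (trace_log K2 - trace_log K1
      - op_trace (D * op_inverse (1 + K1)))) {0..1}"
    by (intro has_integral_diff op_trace_log_eq_integral dom tc)
  have f: "cmod (?f s) \<le> M ^ 3 * d * norm D" if s: "s \<in> {0..1}" for s
  proof -
    let ?R1 = "res K1 s" and ?R2 = "res K2 s"
    note R1 = res_inverse[OF dom(1) s] and R2 = res_inverse[OF dom(2) s]
    have K2R2: "K2 * ?R2 = ?R2 * K2" by (rule res_commute[OF dom(2) s])
    have "?R2 * D * ?R1 = ?R2 * (K2 * (1 + s *\<^sub>R K1) - (1 + s *\<^sub>R K2) * K1) * ?R1"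
      by (simp add: D_def distrib_left distrib_right)
    also have "\<dots> = ?R2 * K2 * ((1 + s *\<^sub>R K1) * ?R1) - (?R2 * (1 + s *\<^sub>R K2)) * (K1 * ?R1)"
      by (simp only: left_diff_distrib right_diff_distrib mult.assoc)
    finally have 1: "K2 * ?R2 - K1 * ?R1 = ?R2 * (D * ?R1)" by (simp add: R1 R2 K2R2 mult.assoc)
    have "op_trace (K2 * ?R2) - op_trace (K1 * ?R1) = op_trace (?R2 * (D * ?R1))"
      unfolding 1[symmetric] by (rule op_trace_diff[symmetric]) (intro trace_class_mult_right tc)+
    also have "\<dots> = op_trace (D * ?R1 * ?R2)" by (intro op_trace_commute trace_class_mult_right tD)
    finally have 2: "?f s = op_trace (D * (?R1 * (?R2 - ?R1)))"
      by (simp add: right_diff_distrib mult.assoc op_trace_diff trace_class_mult_right tD)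
    have inv: "invertible_op (1 + s *\<^sub>R K1)" "invertible_op (1 + s *\<^sub>R K2)"
      using dom s unfolding log_domain_def by auto
    have "?R2 - ?R1 = - (s *\<^sub>R (?R2 * D * ?R1))"
      unfolding res_def op_inverse_diff[OF inv] by (simp add: D_def algebra_simps)
    then have "norm (?R2 - ?R1) = s * norm (?R2 * D * ?R1)" using s by simp
    also have "\<dots> \<le> 1 * (M * norm D * M)"
      using s M0 by (intro mult_mono order_trans[OF norm_mult_ineq] mult_nonneg_nonneg M) auto
    finally have "norm (?R1 * (?R2 - ?R1)) \<le> M * (M * norm D * M)"
      using M0 s by (intro order_trans[OF norm_mult_ineq] mult_mono M mult_nonneg_nonneg) auto
    then have "norm (?R1 * (?R2 - ?R1)) * d \<le> M * (M * norm D * M) * d" by (intro mult_right_mono d0)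
    then show ?thesis unfolding 2
      using cmod_op_trace_le[OF trace_norm_le_mult_right[OF d[folded D_def], of "?R1 * (?R2 - ?R1)"]]
      by (simp add: power3_eq_cube mult_ac)
  qed
  have "cmod (trace_log K2 - trace_log K1
      - op_trace (D * op_inverse (1 + K1))) \<le> M ^ 3 * d * norm D * measure lborel {0..1::real}"
    by (rule has_integral_bound_real[OF _ finite.emptyI int]) (use f M0 d0 in auto)
  then show ?thesis by (simp add: D_def)
qed

lemma constant_if_quadratic_bound:
  fixes f :: "real \<Rightarrow> 'a::real_normed_vector"
  assumes "\<And>t r. t \<in> {0..1} \<Longrightarrow> r \<in> {0..1} \<Longrightarrow> norm (f t - f r) \<le> C * (t - r)\<^sup>2"
  shows "f 1 = f 0"
proof -
  have "(f has_vector_derivative 0) (at r within {0..1})" if r: "r \<in> {0..1}" for r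
    unfolding has_vector_derivative_def has_derivative_iff_norm
  proof
    have "((\<lambda>t. C * \<bar>t - r\<bar>) \<longlongrightarrow> C * \<bar>r - r\<bar>) (at r within {0..1})" by (intro tendsto_intros)
    then have lim: "((\<lambda>t. C * \<bar>t - r\<bar>) \<longlongrightarrow> 0) (at r within {0..1})" by simp
    have "norm (norm (f t - f r - (t - r) *\<^sub>R 0) / norm (t - r)) \<le> C * \<bar>t - r\<bar>" if "t \<in> {0..1}" "t \<noteq> r" for t
    proof -
      have "norm (f t - f r) \<le> (C * \<bar>t - r\<bar>) * \<bar>t - r\<bar>"
        using assms[OF that(1) r] by (simp add: power2_eq_square mult.assoc abs_mult[symmetric])
      then show ?thesis using that(2) by (simp add: divide_le_eq)
    qed
    then show "((\<lambda>y. norm (f y - f r - (y - r) *\<^sub>R 0) / norm (y - r)) \<longlongrightarrow> 0) (at r within {0..1})"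
      by (intro Lim_null_comparison[OF _ lim]) (auto simp: eventually_at_filter)
  qed simp
  then obtain c where "\<And>x. x \<in> {0..1} \<Longrightarrow> f x = c"
    using has_vector_derivative_zero_constant[of "{0..1}" f] by auto
  then show ?thesis by simp
qed

lemma accretive_near_one:
  assumes "norm K \<le> k"
  shows "(1 - k) * (norm x)\<^sup>2 \<le> Re (cinner x ((1 + K) *\<^sub>V x))"
proof -
  have "- Re (cinner x (K *\<^sub>V x)) \<le> cmod (cinner x (K *\<^sub>V x))"
    using abs_Re_le_cmod[of "cinner x (K *\<^sub>V x)"] by linarith
  also have "\<dots> \<le> norm x * (norm K * norm x)"
    by (rule order_trans[OF cmod_cinner_le mult_left_mono[OF norm_bop_apply]]) simp
  also have "\<dots> \<le> k * (norm x)\<^sup>2"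
    using mult_right_mono[OF assms, of "(norm x)\<^sup>2"] by (simp add: power2_eq_square mult_ac)
  finally show ?thesis by (simp add: cinner_add_right cinner_self left_diff_distrib del: of_real_power)
qed

text \<open>Up to an invertible factor, \<open>(1 - s) + s P Q\<close> is the accretive operator \<open>(1 - s) P\<^sup>-\<^sup>1 + s Q\<close>.\<close>

lemma log_domain_product:
  assumes k: "0 \<le> k" "k < 1" and K: "norm K \<le> k" and J: "norm J \<le> k"
  defines "c \<equiv> (1 - k) / 4"
  shows "log_domain ((1 + K) * (1 + J) - 1)"
    and "s \<in> {0..1} \<Longrightarrow> norm (res ((1 + K) * (1 + J) - 1) s) \<le> 1 / c * (1 / c)"
proof -
  define P Q where "P = 1 + K" and "Q = 1 + J"
  have c: "0 < c" "c \<le> 1 - k" using k by (auto simp: c_def)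
  have Pacc: "(1 - k) * (norm x)\<^sup>2 \<le> Re (cinner x (P *\<^sub>V x))" for x
    unfolding P_def by (rule accretive_near_one[OF K])
  have Qacc: "(1 - k) * (norm x)\<^sup>2 \<le> Re (cinner x (Q *\<^sub>V x))" for x
    unfolding Q_def by (rule accretive_near_one[OF J])
  have P: "invertible_op P" "norm (op_inverse P) \<le> 1 / c"
  proof -
    have "0 < 1 - k" using k by simp
    note acc = accretive_invertible[OF this Pacc]
    show "invertible_op P" by (rule acc)
    have "1 / (1 - k) \<le> 1 / c" using c by (intro divide_left_mono) auto
    then show "norm (op_inverse P) \<le> 1 / c" using acc(2) by linarith
  qed
  have Piacc: "c * (norm x)\<^sup>2 \<le> Re (cinner x (op_inverse P *\<^sub>V x))" for x
  proof -
    define y where "y = op_inverse P *\<^sub>V x"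
    have x: "x = P *\<^sub>V y" using op_inverse(2)[OF P(1)] bop_apply_simps(6)[of P "op_inverse P" x] by (simp add: y_def)
    have "norm x \<le> norm y + norm K * norm y"
      unfolding x P_def using norm_triangle_mono[OF order_refl norm_bop_apply, of y K y] by simp
    also have "\<dots> \<le> norm y + 1 * norm y" using K k by (intro add_left_mono mult_right_mono) auto
    finally have "(norm x)\<^sup>2 \<le> (2 * norm y)\<^sup>2" by (intro power_mono) auto
    then have "c * (norm x)\<^sup>2 \<le> (1 - k) * (norm y)\<^sup>2"
      using mult_left_mono[of "(norm x)\<^sup>2" "(2 * norm y)\<^sup>2" c] c by (simp add: c_def power_mult_distrib)
    also have "\<dots> \<le> Re (cinner y (P *\<^sub>V y))" by (rule Pacc)
    also have "\<dots> = Re (cinner x y)" unfolding x[symmetric] by (subst cinner_commute) simp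
    finally show ?thesis by (simp add: y_def)
  qed
  have main: "invertible_op (1 + s *\<^sub>R (P * Q - 1)) \<and> norm (op_inverse (1 + s *\<^sub>R (P * Q - 1))) \<le> 1 / c * (1 / c)"
    if s: "s \<in> {0..1}" for s
  proof -
    define N where "N = (1 - s) *\<^sub>R op_inverse P + s *\<^sub>R Q"
    have "c * (norm x)\<^sup>2 \<le> Re (cinner x (N *\<^sub>V x))" for x
    proof -
      have "c * (norm x)\<^sup>2 \<le> Re (cinner x (Q *\<^sub>V x))"
        using mult_right_mono[OF c(2), of "(norm x)\<^sup>2"] Qacc[of x] by simp
      then have "(1 - s) * (c * (norm x)\<^sup>2) + s * (c * (norm x)\<^sup>2)
          \<le> (1 - s) * Re (cinner x (op_inverse P *\<^sub>V x)) + s * Re (cinner x (Q *\<^sub>V x))"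
        using s Piacc[of x] by (intro add_mono mult_left_mono) auto
      then show ?thesis by (simp add: N_def cinner_linear algebra_simps)
    qed
    note N = accretive_invertible[OF c(1) this]
    have eq: "1 + s *\<^sub>R (P * Q - 1) = P * N"
      by (simp add: N_def distrib_left op_inverse[OF P(1)]) (simp add: algebra_simps)
    have "norm (op_inverse N * op_inverse P) \<le> 1 / c * (1 / c)"
      by (rule order_trans[OF norm_mult_ineq], rule mult_mono[OF N(2) P(2)]) (use c in simp_all)
    then show ?thesis
      unfolding eq invertible_op_mult(2)[OF P(1) N(1)] using invertible_op_mult(1)[OF P(1) N(1)] by blast
  qed
  show "log_domain ((1 + K) * (1 + J) - 1)"
    using main unfolding log_domain_def P_def Q_def by blast
  show "s \<in> {0..1} \<Longrightarrow> norm (res ((1 + K) * (1 + J) - 1) s) \<le> 1 / c * (1 / c)"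
    using main unfolding res_def P_def Q_def by blast
qed

proposition op_trace_log_mult:
  fixes K J :: "'h::complex_hilbert bop"
  assumes K: "norm K < 1" and J: "norm J < 1" and tc: "trace_class K" "trace_class J"
  defines "L \<equiv> (1 + K) * (1 + J) - 1"
  shows "trace_log L = trace_log K + trace_log J"
proof -
  define k where "k = max (norm K) (norm J)"
  have k: "0 \<le> k" "k < 1" "norm K \<le> k" "norm J \<le> k"
    unfolding k_def using K J by (auto simp: le_max_iff_disj)
  define M where "M = 1 / ((1 - k) / 4) * (1 / ((1 - k) / 4))"
  define P Q where "P t = 1 + t *\<^sub>R K" and "Q t = 1 + t *\<^sub>R J" for t
  define Lt where "Lt t = P t * Q t - 1" for t
  have scaled: "norm (t *\<^sub>R X) \<le> k" if "t \<in> {0..1}" "norm X \<le> k" for t and X :: "'h bop"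
    using that mult_mono[of "\<bar>t\<bar>" 1 "norm X" k] by simp
  have zero: "norm (0 :: 'h bop) \<le> k" using k by simp
  have Ldom: "log_domain (Lt t)" and LM: "\<And>s. s \<in> {0..1} \<Longrightarrow> norm (res (Lt t) s) \<le> M" if "t \<in> {0..1}" for t
    unfolding Lt_def P_def Q_def M_def
    by (rule log_domain_product[OF k(1,2) scaled[OF that k(3)] scaled[OF that k(4)]])+
  have Kdom: "log_domain (t *\<^sub>R K)" and KM: "\<And>s. s \<in> {0..1} \<Longrightarrow> norm (res (t *\<^sub>R K) s) \<le> M" if "t \<in> {0..1}" for t
    using log_domain_product[OF k(1,2) scaled[OF that k(3)] zero] unfolding M_def by simp_all
  have Jdom: "log_domain (t *\<^sub>R J)" and JM: "\<And>s. s \<in> {0..1} \<Longrightarrow> norm (res (t *\<^sub>R J) s) \<le> M" if "t \<in> {0..1}" for t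
    using log_domain_product[OF k(1,2) scaled[OF that k(4)] zero] unfolding M_def by simp_all
  have M0: "0 \<le> M" using order_trans[OF norm_ge_zero KM[of 0 0]] by simp
  obtain a where a: "trace_norm_le K a" using tc trace_norm_le_if_trace_class by blast
  obtain b where b: "trace_norm_le J b" using tc trace_norm_le_if_trace_class by blast
  have ab: "0 \<le> a" "0 \<le> b" using trace_norm_le_nonneg a b by auto
  have nPQ: "norm (P t) \<le> 2" "norm (Q t) \<le> 2" if "t \<in> {0..1}" for t
    unfolding P_def Q_def
    using norm_triangle_ineq[of 1 "t *\<^sub>R K"] norm_triangle_ineq[of 1 "t *\<^sub>R J"] norm_one_bop_le[where 'h='h]
      scaled[OF that k(3)] scaled[OF that k(4)] k by linarith+
  have tcL: "trace_class (Lt t)" for t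
  proof -
    have "Lt t = t *\<^sub>R K * Q t + t *\<^sub>R J" by (simp add: Lt_def P_def Q_def algebra_simps)
    then show ?thesis by (simp add: trace_class_add trace_class_mult_right trace_class_scaleR tc)
  qed
  define \<phi> where "\<phi> t = trace_log (Lt t) - trace_log (t *\<^sub>R K) - trace_log (t *\<^sub>R J)" for t
  define C where "C = M ^ 3 * (2 * a + 2 * b) * 4 + M ^ 3 * a * 1 + M ^ 3 * b * 1 + M * M * a"
  have "norm (\<phi> t - \<phi> r) \<le> C * (t - r)\<^sup>2" if t: "t \<in> {0..1}" and r: "r \<in> {0..1}" for t r
  proof -
    define \<delta> where "\<delta> = t - r"
    define Pi Qi where "Pi = op_inverse (P r)" and "Qi = op_inverse (Q r)"
    have "invertible_op (1 + r *\<^sub>R K)" using Kdom[OF r, unfolded log_domain_def, THEN bspec, of 1] by simp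
    then have Pi: "invertible_op (P r)" "norm Pi \<le> M"
      using KM[OF r, of 1] by (simp_all add: Pi_def P_def res_def)
    have "invertible_op (1 + r *\<^sub>R J)" using Jdom[OF r, unfolded log_domain_def, THEN bspec, of 1] by simp
    then have Qi: "invertible_op (Q r)" "norm Qi \<le> M"
      using JM[OF r, of 1] by (simp_all add: Qi_def Q_def res_def)
    have QQ: "Q t * Qi = 1 + \<delta> *\<^sub>R (J * Qi)"
    proof -
      have "Q t = Q r + \<delta> *\<^sub>R J" by (simp add: Q_def \<delta>_def algebra_simps)
      then show ?thesis using op_inverse(2)[OF Qi(1)] by (simp add: distrib_right Qi_def)
    qed
    have LiR: "op_inverse (1 + Lt r) = Qi * Pi"
      by (simp add: Lt_def invertible_op_mult(2)[OF Pi(1) Qi(1)] Pi_def Qi_def)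
    have DL: "Lt t - Lt r = \<delta> *\<^sub>R (K * Q t + P r * J)"
      by (simp add: Lt_def P_def Q_def \<delta>_def algebra_simps)
    have tn: "trace_norm_le (K * Q t + P r * J) (2 * a + 2 * b)"
      by (rule trace_norm_le_mono[OF trace_norm_le_add[OF trace_norm_le_mult_right[OF a] trace_norm_le_mult_left[OF b]]])
        (intro add_mono mult_right_mono nPQ t r ab)
    have nn: "norm (K * Q t + P r * J) \<le> 4"
    proof -
      have "norm (K * Q t) \<le> 1 * 2" "norm (P r * J) \<le> 2 * 1"
        using nPQ[OF t] nPQ[OF r] K J by (intro order_trans[OF norm_mult_ineq] mult_mono; simp)+
      then show ?thesis using norm_triangle_ineq[of "K * Q t" "P r * J"] by linarith
    qed
    have 1: "cmod (trace_log (Lt t) - trace_log (Lt r) - op_trace ((Lt t - Lt r) * (Qi * Pi))) \<le> M ^ 3 * (2 * a + 2 * b) * 4 * \<delta>\<^sup>2"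
    proof -
      have "cmod (trace_log (Lt t) - trace_log (Lt r) - op_trace ((Lt t - Lt r) * (Qi * Pi)))
          \<le> M ^ 3 * (\<bar>\<delta>\<bar> * (2 * a + 2 * b)) * norm (Lt t - Lt r)"
        unfolding LiR[symmetric]
        by (rule op_trace_log_expansion[OF Ldom[OF r] Ldom[OF t] tcL tcL _ LM[OF r] LM[OF t]])
          (unfold DL, rule trace_norm_le_scaleR[OF tn])
      also have "\<dots> \<le> M ^ 3 * (\<bar>\<delta>\<bar> * (2 * a + 2 * b)) * (\<bar>\<delta>\<bar> * 4)"
        unfolding DL norm_scaleR using M0 ab nn by (intro mult_left_mono mult_nonneg_nonneg) auto
      also have "\<dots> = M ^ 3 * (2 * a + 2 * b) * 4 * (\<bar>\<delta>\<bar> * \<bar>\<delta>\<bar>)" by (simp only: mult_ac)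
      finally show ?thesis by (simp add: power2_eq_square)
    qed
    have 2: "cmod (trace_log (t *\<^sub>R X) - trace_log (r *\<^sub>R X) - op_trace ((\<delta> *\<^sub>R X) * op_inverse (1 + r *\<^sub>R X))) \<le> M ^ 3 * x * 1 * \<delta>\<^sup>2"
      if X: "log_domain (t *\<^sub>R X)" "log_domain (r *\<^sub>R X)" "\<And>s. s \<in> {0..1} \<Longrightarrow> norm (res (t *\<^sub>R X) s) \<le> M"
        "\<And>s. s \<in> {0..1} \<Longrightarrow> norm (res (r *\<^sub>R X) s) \<le> M" "trace_norm_le X x" "norm X \<le> 1" for X x
    proof -
      have D: "t *\<^sub>R X - r *\<^sub>R X = \<delta> *\<^sub>R X" by (simp add: \<delta>_def scaleR_diff_left)
      have tcX: "trace_class X" using X(5) by (rule trace_class_if_trace_norm_le)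
      have "cmod (trace_log (t *\<^sub>R X) - trace_log (r *\<^sub>R X) - op_trace ((\<delta> *\<^sub>R X) * op_inverse (1 + r *\<^sub>R X)))
          \<le> M ^ 3 * (\<bar>\<delta>\<bar> * x) * norm (\<delta> *\<^sub>R X)"
        unfolding D[symmetric]
        by (rule op_trace_log_expansion[OF X(2,1) trace_class_scaleR[OF tcX] trace_class_scaleR[OF tcX] _ X(4,3)])
          (unfold D, rule trace_norm_le_scaleR[OF X(5)])
      also have "\<dots> \<le> M ^ 3 * (\<bar>\<delta>\<bar> * x) * (\<bar>\<delta>\<bar> * 1)"
        unfolding norm_scaleR using M0 trace_norm_le_nonneg[OF X(5)] X(6) by (intro mult_left_mono mult_nonneg_nonneg) auto
      also have "\<dots> = M ^ 3 * x * 1 * (\<bar>\<delta>\<bar> * \<bar>\<delta>\<bar>)" by (simp only: mult_ac)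
      finally show ?thesis by (simp add: power2_eq_square)
    qed
    have 2: "cmod (trace_log (t *\<^sub>R K) - trace_log (r *\<^sub>R K) - op_trace ((\<delta> *\<^sub>R K) * Pi)) \<le> M ^ 3 * a * 1 * \<delta>\<^sup>2"
      "cmod (trace_log (t *\<^sub>R J) - trace_log (r *\<^sub>R J) - op_trace ((\<delta> *\<^sub>R J) * Qi)) \<le> M ^ 3 * b * 1 * \<delta>\<^sup>2"
      unfolding Pi_def P_def Qi_def Q_def
      using 2[OF Kdom[OF t] Kdom[OF r] KM[OF t] KM[OF r] a] 2[OF Jdom[OF t] Jdom[OF r] JM[OF t] JM[OF r] b] K J
      by simp_all
    have 3: "op_trace ((Lt t - Lt r) * (Qi * Pi)) - op_trace ((\<delta> *\<^sub>R K) * Pi) - op_trace ((\<delta> *\<^sub>R J) * Qi)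
        = \<delta>\<^sup>2 *\<^sub>R op_trace (K * (J * (Qi * Pi)))"
    proof -
      have "K * Q t * (Qi * Pi) = K * (Q t * Qi) * Pi" by (simp only: mult.assoc)
      also have "\<dots> = K * Pi + \<delta> *\<^sub>R (K * (J * (Qi * Pi)))" unfolding QQ by (simp add: distrib_left distrib_right mult.assoc)
      finally have *: "(Lt t - Lt r) * (Qi * Pi) = \<delta> *\<^sub>R (K * Pi) + \<delta> *\<^sub>R (\<delta> *\<^sub>R (K * (J * (Qi * Pi)))) + \<delta> *\<^sub>R (P r * (J * Qi * Pi))"
        unfolding DL by (simp add: distrib_right scaleR_add_right mult.assoc)
      have "op_trace (P r * (J * Qi * Pi)) = op_trace (J * Qi * Pi * P r)"
        by (intro op_trace_commute trace_class_mult_right tc)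
      also have "\<dots> = op_trace (J * Qi)" using op_inverse(1)[OF Pi(1)] by (simp add: mult.assoc Pi_def)
      finally have **: "op_trace (P r * (J * Qi * Pi)) = op_trace (J * Qi)" .
      show ?thesis
        unfolding * using ** by (simp add: op_trace_add op_trace_scaleR trace_class_add trace_class_scaleR
            trace_class_mult_left trace_class_mult_right tc power2_eq_square)
    qed
    have 4: "cmod (op_trace (K * (J * (Qi * Pi)))) \<le> M * M * a"
    proof -
      have "norm (J * (Qi * Pi)) \<le> 1 * (M * M)"
        using J Qi Pi M0 by (intro order_trans[OF norm_mult_ineq] mult_mono mult_nonneg_nonneg; simp)
      then have "norm (J * (Qi * Pi)) * a \<le> M * M * a" using ab by (intro mult_right_mono) auto
      then show ?thesis using cmod_op_trace_le[OF trace_norm_le_mult_right[OF a, of "J * (Qi * Pi)"]] by linarith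
    qed
    have 5: "cmod (\<delta>\<^sup>2 *\<^sub>R op_trace (K * (J * (Qi * Pi)))) \<le> M * M * a * \<delta>\<^sup>2"
      using mult_left_mono[OF 4, of "\<delta>\<^sup>2"] by (simp add: mult_ac)
    have "\<phi> t - \<phi> r = (trace_log (Lt t) - trace_log (Lt r) - op_trace ((Lt t - Lt r) * (Qi * Pi)))
        - (trace_log (t *\<^sub>R K) - trace_log (r *\<^sub>R K) - op_trace ((\<delta> *\<^sub>R K) * Pi))
        - (trace_log (t *\<^sub>R J) - trace_log (r *\<^sub>R J) - op_trace ((\<delta> *\<^sub>R J) * Qi))
        + \<delta>\<^sup>2 *\<^sub>R op_trace (K * (J * (Qi * Pi)))"
      unfolding 3[symmetric] by (simp add: \<phi>_def)
    also have "cmod \<dots> \<le> M ^ 3 * (2 * a + 2 * b) * 4 * \<delta>\<^sup>2 + M ^ 3 * a * 1 * \<delta>\<^sup>2 + M ^ 3 * b * 1 * \<delta>\<^sup>2 + M * M * a * \<delta>\<^sup>2"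
      by (intro order_trans[OF norm_triangle_ineq] order_trans[OF norm_triangle_ineq4] add_mono 1 2 5)
    also have "\<dots> = C * \<delta>\<^sup>2" by (simp add: C_def algebra_simps)
    finally show ?thesis by (simp add: \<delta>_def)
  qed
  then have "\<phi> 1 = \<phi> 0" by (rule constant_if_quadratic_bound)
  moreover have "Lt 0 = 0" "Lt 1 = L" by (simp_all add: Lt_def P_def Q_def L_def)
  moreover have "op_trace (0 :: 'h bop) = 0"
    using op_trace_scaleR[OF tc(1), of 0] by simp
  ultimately show ?thesis by (simp add: \<phi>_def algebra_simps)
qed


section \<open>The resolvent\<close>

abbreviation resolvent :: "'h::complex_hilbert bop \<Rightarrow> complex \<Rightarrow> 'h bop" where
  "resolvent T z \<equiv> op_inverse (z *\<^sub>C 1 - T)"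

lemma op_spectrum_iff: "z \<in> op_spectrum T \<longleftrightarrow> \<not> invertible_op (z *\<^sub>C 1 - T)"
  by (simp add: op_spectrum_def invertible_op_def)

lemma bounded_linear_scaleC_bop_left: "bounded_linear (\<lambda>c. c *\<^sub>C (T::'h::complex_hilbert bop))"
  by (rule bounded_bilinear.bounded_linear_left[OF bounded_bilinear_scaleC_bop])

lemma tendsto_affine_bop: "((\<lambda>w. Q + w *\<^sub>C P) \<longlongrightarrow> Q + z *\<^sub>C (P::'h::complex_hilbert bop)) (at z within X)"
  by (intro tendsto_intros bounded_linear.tendsto[OF bounded_linear_scaleC_bop_left])

lemma eventually_invertible_affine:
  assumes "invertible_op (Q + z *\<^sub>C P)"
  shows "\<forall>\<^sub>F w in at z. invertible_op (Q + w *\<^sub>C P)"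
  using eventually_invertible_op[OF tendsto_affine_bop] by (rule eventually_mono) (rule invertible_op_near(1)[OF assms])

lemma open_invertible_affine: "open {z. invertible_op (Q + z *\<^sub>C (P::'h::complex_hilbert bop))}"
proof (subst open_subopen, intro ballI)
  fix z assume "z \<in> {z. invertible_op (Q + z *\<^sub>C P)}"
  then have z: "invertible_op (Q + z *\<^sub>C P)" by simp
  from eventually_invertible_affine[OF z] obtain U where "open U" "z \<in> U"
    and U: "\<And>w. w \<in> U \<Longrightarrow> w \<noteq> z \<Longrightarrow> invertible_op (Q + w *\<^sub>C P)"
    unfolding eventually_at_topological by auto
  moreover have "U \<subseteq> {z. invertible_op (Q + z *\<^sub>C P)}" using U z by auto
  ultimately show "\<exists>T. open T \<and> z \<in> T \<and> T \<subseteq> {z. invertible_op (Q + z *\<^sub>C P)}" by blast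
qed

lemma holomorphic_inverse_affine:
  shows "(\<lambda>z. cinner x (op_inverse (Q + z *\<^sub>C P) *\<^sub>V y)) holomorphic_on {z. invertible_op (Q + z *\<^sub>C P)}"
proof (rule holomorphic_onI)
  fix z assume "z \<in> {z. invertible_op (Q + z *\<^sub>C P)}"
  then have z: "invertible_op (Q + z *\<^sub>C P)" by simp
  let ?A = "\<lambda>w. Q + w *\<^sub>C P"
  let ?I = "\<lambda>w. op_inverse (?A w)"
  let ?f = "\<lambda>w. cinner x (?I w *\<^sub>V y)"
  have lim: "((\<lambda>w. - cinner x ((?I w * P * ?I z) *\<^sub>V y)) \<longlongrightarrow> - cinner x ((?I z * P * ?I z) *\<^sub>V y)) (at z)"
    by (intro tendsto_intros bounded_linear.tendsto[OF bounded_linear_cinner_bop] tendsto_op_inverse[OF z] tendsto_affine_bop)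
  have "(?f has_field_derivative - cinner x ((?I z * P * ?I z) *\<^sub>V y)) (at z)"
    unfolding has_field_derivative_iff
  proof (rule Lim_transform_eventually[OF lim])
    have "\<forall>\<^sub>F w in at z. invertible_op (?A w) \<and> w \<noteq> z"
      using eventually_invertible_affine[OF z] by (rule eventually_conj) (simp add: eventually_at_filter)
    then show "\<forall>\<^sub>F w in at z. - cinner x ((?I w * P * ?I z) *\<^sub>V y) = (?f w - ?f z) / (w - z)"
    proof (rule eventually_mono)
      fix w assume w: "invertible_op (?A w) \<and> w \<noteq> z"
      have "?A z - ?A w = (z - w) *\<^sub>C P" by (simp add: scaleC_diff_left)
      then have "?I w - ?I z = (z - w) *\<^sub>C (?I w * P * ?I z)"
        using op_inverse_diff[OF z conjunct1[OF w]] by simp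
      then have "?f w - ?f z = (z - w) * cinner x ((?I w * P * ?I z) *\<^sub>V y)"
        unfolding cinner_diff_right[symmetric] bop_apply_simps(2)[symmetric] by (simp add: cinner_scaleC_right)
      then show "- cinner x ((?I w * P * ?I z) *\<^sub>V y) = (?f w - ?f z) / (w - z)"
        using w by (simp add: field_simps)
    qed
  qed
  then show "?f field_differentiable at z within {z. invertible_op (Q + z *\<^sub>C P)}"
    using field_differentiable_at_within field_differentiable_def by blast
qed

lemma open_resolvent_set: "open (- op_spectrum T)"
  and holomorphic_resolvent: "(\<lambda>z. cinner x (resolvent T z *\<^sub>V y)) holomorphic_on (- op_spectrum T)"
proof -
  have "- op_spectrum T = {z. invertible_op (- T + z *\<^sub>C 1)}"
    by (auto simp: op_spectrum_iff)
  then show "open (- op_spectrum T)" "(\<lambda>z. cinner x (resolvent T z *\<^sub>V y)) holomorphic_on (- op_spectrum T)"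
    using open_invertible_affine[of "- T" 1] holomorphic_inverse_affine[of x "- T" 1 y] by simp_all
qed

lemma resolvent_bound:
  assumes z: "norm T < cmod z"
  shows "invertible_op (z *\<^sub>C 1 - T)" "norm (resolvent T z) \<le> 1 / (cmod z - norm T)"
proof -
  have z0: "z \<noteq> 0" using z norm_ge_zero[of T] by auto
  have "norm (inverse z *\<^sub>C T) < 1"
  proof -
    have "norm (inverse z *\<^sub>C T) = norm T / cmod z"
      by (simp add: norm_scaleC_bop norm_inverse divide_inverse mult.commute)
    then show ?thesis using z z0 by simp
  qed
  from invertible_op_scaleC(1)[OF neumann[OF this] z0]
  show inv: "invertible_op (z *\<^sub>C 1 - T)" using z0 by (simp add: scaleC_diff_right scaleC_scaleC)
  show "norm (resolvent T z) \<le> 1 / (cmod z - norm T)"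
  proof (rule norm_op_inverse_le[OF inv])
    fix x
    have "norm (z *\<^sub>C x) - norm (T *\<^sub>V x) \<le> norm ((z *\<^sub>C 1 - T) *\<^sub>V x)"
      by (simp add: norm_triangle_ineq2)
    then show "(cmod z - norm T) * norm x \<le> norm ((z *\<^sub>C 1 - T) *\<^sub>V x)"
      using norm_bop_apply[of T x] by (simp add: norm_scaleC left_diff_distrib)
  qed (use z in simp)
qed

lemma compact_op_spectrum: "compact (op_spectrum T)"
  unfolding compact_eq_bounded_closed
proof
  show "bounded (op_spectrum T)"
    unfolding bounded_iff using resolvent_bound(1)[of T] by (intro exI[of _ "norm T"]) (force simp: op_spectrum_iff not_less[symmetric])
  show "closed (op_spectrum T)" using open_resolvent_set[of T] by (simp add: open_closed)
qed

lemma op_spectrum_nonempty: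
  fixes T :: "'h::complex_hilbert bop"
  assumes "(1::'h bop) \<noteq> 0"
  shows "op_spectrum T \<noteq> {}"
proof
  assume empty: "op_spectrum T = {}"
  have "op_inverse (0 *\<^sub>C 1 - T) = 0"
  proof (rule bop_eqI_cinner)
    fix x y
    let ?h = "\<lambda>z. cinner x (resolvent T z *\<^sub>V y)"
    have hol: "?h holomorphic_on UNIV" using holomorphic_resolvent[of x T y] empty by simp
    have lim: "((\<lambda>z::complex. norm x * norm y * (1 / (cmod z - norm T))) \<longlongrightarrow> norm x * norm y * 0) at_infinity"
    proof (intro tendsto_intros)
      have "filterlim (\<lambda>z::complex. - norm T + cmod z) at_top at_infinity"
        by (rule filterlim_tendsto_add_at_top[OF tendsto_const filterlim_norm_at_top])
      then have "filterlim (\<lambda>z::complex. cmod z - norm T) at_top at_infinity" by (simp add: add.commute)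
      from filterlim_compose[OF tendsto_inverse_0_at_top[OF filterlim_ident] this]
      show "((\<lambda>z::complex. 1 / (cmod z - norm T)) \<longlongrightarrow> 0) at_infinity"
        by (simp add: inverse_eq_divide)
    qed
    have "(?h \<longlongrightarrow> 0) at_infinity"
    proof (rule Lim_null_comparison)
      show "((\<lambda>z::complex. norm x * norm y * (1 / (cmod z - norm T))) \<longlongrightarrow> 0) at_infinity" using lim by simp
      have "cmod (?h z) \<le> norm x * norm y * (1 / (cmod z - norm T))" if z: "norm T + 1 \<le> cmod z" for z
      proof -
        have "cmod (?h z) \<le> norm x * (norm (resolvent T z) * norm y)"
          by (rule order_trans[OF cmod_cinner_le mult_left_mono[OF norm_bop_apply]]) simp
        also have "\<dots> \<le> norm x * (1 / (cmod z - norm T) * norm y)"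
          using z by (intro mult_left_mono mult_right_mono resolvent_bound(2)) auto
        finally show ?thesis by (simp add: mult_ac)
      qed
      then show "\<forall>\<^sub>F z in at_infinity. cmod (?h z) \<le> norm x * norm y * (1 / (cmod z - norm T))"
        unfolding eventually_at_infinity by blast
    qed
    from Liouville_weak[OF hol this, of 0] show "?h 0 = cinner x (0 *\<^sub>V y)" by simp
  qed
  moreover have "invertible_op (0 *\<^sub>C 1 - T)" using empty op_spectrum_iff by blast
  ultimately have "0 * (0 *\<^sub>C 1 - T) = 1" using op_inverse(1) by metis
  then show False using assms by simp
qed

text \<open>Inversion at a point \<open>p\<close> outside the spectrum with winding number 1 turns the path into one with
  winding number 0 around the image of the spectrum, and \<open>(z - T)\<^sup>-\<^sup>1 - (z - p)\<^sup>-\<^sup>1\<close> into a function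
  that is holomorphic off this image, also at 0.\<close>

lemma resolvent_contour_integral:
  fixes T :: "'h::complex_hilbert bop"
  assumes nz: "(1::'h bop) \<noteq> 0"
    and \<gamma>: "valid_path \<gamma>" "pathfinish \<gamma> = pathstart \<gamma>" "path_image \<gamma> \<inter> op_spectrum T = {}"
    and wn: "\<And>z. z \<in> op_spectrum T \<Longrightarrow> winding_number \<gamma> z = 1"
  shows "((\<lambda>z. cinner x (resolvent T z *\<^sub>V y)) has_contour_integral (2 * of_real pi * \<i> * cinner x y)) \<gamma>"
proof -
  let ?W = "{z. z \<notin> path_image \<gamma> \<and> winding_number \<gamma> z = 1}"
  have W: "open ?W" by (rule open_winding_number_levelsets[OF valid_path_imp_path[OF \<gamma>(1)] \<gamma>(2)])
  have KW: "op_spectrum T \<subseteq> ?W" using wn \<gamma>(3) by auto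
  have "\<exists>p. p \<in> ?W \<and> p \<notin> op_spectrum T"
  proof (rule ccontr)
    assume "\<nexists>p. p \<in> ?W \<and> p \<notin> op_spectrum T"
    then have "?W = op_spectrum T" using KW by blast
    then have "closed (op_spectrum T) \<and> open (op_spectrum T)" using W compact_imp_closed[OF compact_op_spectrum] by simp
    then have "op_spectrum T = UNIV" unfolding clopen using op_spectrum_nonempty[OF nz] by simp
    then show False using compact_op_spectrum[of T] not_compact_UNIV by metis
  qed
  then obtain p where p: "p \<notin> path_image \<gamma>" "winding_number \<gamma> p = 1" "p \<notin> op_spectrum T" by blast
  define f where "f z = 1 / (z - p)" for z
  have f': "(f has_field_derivative - (1 / (z - p)\<^sup>2)) (at z)" if "z \<noteq> p" for z
    unfolding f_def using that by (auto intro!: derivative_eq_intros simp: power2_eq_square)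
  have fhol: "f holomorphic_on - {p}" unfolding f_def by (intro holomorphic_intros) auto
  have fan: "f analytic_on - {p}" using fhol analytic_on_open[of "- {p}" f] by (simp add: open_Compl)
  have img: "path_image \<gamma> \<subseteq> - {p}" using p(1) by blast
  define \<gamma>' where "\<gamma>' = f \<circ> \<gamma>"
  have \<gamma>': "valid_path \<gamma>'" unfolding \<gamma>'_def by (rule valid_path_compose_holomorphic[OF \<gamma>(1) fhol _ img]) auto
  have loop': "pathfinish \<gamma>' = pathstart \<gamma>'" using \<gamma>(2) by (simp add: \<gamma>'_def pathfinish_compose pathstart_compose)
  have subst: "contour_integral \<gamma>' g = contour_integral \<gamma> (\<lambda>z. - (1 / (z - p)\<^sup>2) * g (f z))" for g
    unfolding \<gamma>'_def contour_integral_comp_analyticW[OF fan \<gamma>(1) img]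
  proof (rule contour_integral_eq)
    fix z assume "z \<in> path_image \<gamma>"
    then have "z \<noteq> p" using p(1) by blast
    from DERIV_imp_deriv[OF f'[OF this]]
    show "deriv f z * g (f z) = - (1 / (z - p)\<^sup>2) * g (f z)" by simp
  qed
  define P where "P = - (T - p *\<^sub>C 1)"
  define S where "S = {u. invertible_op (1 + u *\<^sub>C P)}"
  have scale: "1 + u *\<^sub>C P = u *\<^sub>C (z *\<^sub>C 1 - T)" if "u * (z - p) = 1" for u z
  proof -
    have "u *\<^sub>C (z *\<^sub>C 1 - T) = u *\<^sub>C ((z - p) *\<^sub>C 1 + P)"
      by (simp add: P_def scaleC_diff_left)
    also have "\<dots> = (u * (z - p)) *\<^sub>C 1 + u *\<^sub>C P" by (simp only: scaleC_add_right scaleC_scaleC)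
    finally show ?thesis unfolding that by simp
  qed
  define G where "G u = cinner x (op_inverse (1 + u *\<^sub>C P) *\<^sub>V (P *\<^sub>V y))" for u
  have GS: "open S" "G holomorphic_on S"
    unfolding S_def G_def by (rule open_invertible_affine holomorphic_inverse_affine)+
  have img': "path_image \<gamma>' \<subseteq> S"
  proof
    fix u assume "u \<in> path_image \<gamma>'"
    then obtain z where z: "z \<in> path_image \<gamma>" "u = f z" by (auto simp: \<gamma>'_def path_image_compose)
    then have "z \<noteq> p" using p(1) by blast
    then have u: "u * (z - p) = 1" "u \<noteq> 0" using z by (auto simp: f_def)
    have "invertible_op (z *\<^sub>C 1 - T)" using z \<gamma>(3) op_spectrum_iff by blast
    then show "u \<in> S" unfolding S_def mem_Collect_eq scale[OF u(1)] by (rule invertible_op_scaleC(1)) (rule u(2))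
  qed
  have "winding_number \<gamma>' w = 0" if w: "w \<notin> S" for w
  proof -
    have w0: "w \<noteq> 0"
    proof
      assume "w = 0"
      then have "w \<in> S" by (auto simp: S_def intro: invertible_opI[of 1])
      then show False using w by blast
    qed
    define k where "k = p + 1 / w"
    have wk: "w * (k - p) = 1" "k \<noteq> p" using w0 by (auto simp: k_def)
    have k: "k \<in> op_spectrum T"
      using w invertible_op_scaleC(1)[of "k *\<^sub>C 1 - T" w] w0 unfolding S_def mem_Collect_eq scale[OF wk(1)] op_spectrum_iff by blast
    have kp: "k \<notin> path_image \<gamma>" using k \<gamma>(3) by blast
    have "winding_number \<gamma>' w = 1 / (2 * pi * \<i>) * contour_integral \<gamma> (\<lambda>z. - (1 / (z - p)\<^sup>2) * (1 / (f z - w)))"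
      using w img' by (subst winding_number_valid_path[OF \<gamma>']) (auto simp: subst)
    also have "contour_integral \<gamma> (\<lambda>z. - (1 / (z - p)\<^sup>2) * (1 / (f z - w))) = contour_integral \<gamma> (\<lambda>z. 1 / (z - k) - 1 / (z - p))"
    proof (rule contour_integral_eq)
      fix z assume "z \<in> path_image \<gamma>"
      then have z: "z \<noteq> p" "z \<noteq> k" using kp p(1) by auto
      have w': "w = 1 / (k - p)" using wk by (simp add: field_simps)
      have "f z - w = (k - z) / ((z - p) * (k - p))" unfolding f_def w' using z wk(2) by (simp add: field_simps)
      then have e: "1 / (f z - w) = (z - p) * ((z - p) - (z - k)) / (- (z - k))" by simp
      have "- (1 / a\<^sup>2) * (a * (a - b) / (- b)) = 1 / b - 1 / a" if "a \<noteq> 0" "b \<noteq> 0" for a b :: complex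
        using that by (simp add: field_simps power2_eq_square)
      then show "- (1 / (z - p)\<^sup>2) * (1 / (f z - w)) = 1 / (z - k) - 1 / (z - p)"
        unfolding e using z by (metis right_minus_eq)
    qed
    also have "\<dots> = 2 * pi * \<i> * winding_number \<gamma> k - 2 * pi * \<i> * winding_number \<gamma> p"
      by (intro contour_integral_unique has_contour_integral_diff has_contour_integral_winding_number \<gamma>(1) kp p(1))
    finally show ?thesis using wn[OF k] p(2) by simp
  qed
  then have "(G has_contour_integral 0) \<gamma>'"
    by (rule Cauchy_theorem_global[OF GS \<gamma>' loop' img'])
  then have "contour_integral \<gamma> (\<lambda>z. - (1 / (z - p)\<^sup>2) * G (f z)) = 0"
    using subst[of G] contour_integral_unique by metis
  moreover have "contour_integral \<gamma> (\<lambda>z. - (1 / (z - p)\<^sup>2) * G (f z))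
      = contour_integral \<gamma> (\<lambda>z. cinner x (resolvent T z *\<^sub>V y) - cinner x y * (1 / (z - p)))"
  proof (rule contour_integral_eq)
    fix z assume z: "z \<in> path_image \<gamma>"
    then have zp: "z \<noteq> p" and inv: "invertible_op (z *\<^sub>C 1 - T)" using p(1) \<gamma>(3) op_spectrum_iff by blast+
    define u where "u = f z"
    have u: "u * (z - p) = 1" "u \<noteq> 0" using zp by (auto simp: u_def f_def)
    let ?R = "resolvent T z"
    have "P = (z *\<^sub>C 1 - T) - (z - p) *\<^sub>C 1" by (simp add: P_def scaleC_diff_left)
    then have "?R * P = 1 - (z - p) *\<^sub>C ?R" using op_inverse(1)[OF inv] by (simp add: right_diff_distrib)
    from arg_cong[OF this, of "\<lambda>X. X *\<^sub>V y"]
    have "?R *\<^sub>V P *\<^sub>V y = y - (z - p) *\<^sub>C (?R *\<^sub>V y)" by simp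
    then have "G u = inverse u * (cinner x y - (z - p) * cinner x (?R *\<^sub>V y))"
      unfolding G_def scale[OF u(1)] invertible_op_scaleC(2)[OF inv u(2)]
      by (simp add: cinner_scaleC_right cinner_diff_right)
    moreover have "inverse u = z - p" using u by (simp add: field_simps)
    ultimately have G: "G (f z) = (z - p) * (cinner x y - (z - p) * cinner x (?R *\<^sub>V y))" by (simp add: u_def)
    have "- (1 / d\<^sup>2) * (d * (a - d * b)) = b - a * (1 / d)" if "d \<noteq> 0" for a b d :: complex
      using that by (simp add: field_simps power2_eq_square)
    then show "- (1 / (z - p)\<^sup>2) * G (f z) = cinner x (?R *\<^sub>V y) - cinner x y * (1 / (z - p))"
      unfolding G using zp by (metis right_minus_eq)
  qed
  moreover have int: "(\<lambda>z. cinner x (resolvent T z *\<^sub>V y)) contour_integrable_on \<gamma>"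
    by (rule contour_integrable_holomorphic_simple[OF holomorphic_resolvent open_resolvent_set \<gamma>(1)]) (use \<gamma>(3) in auto)
  ultimately have "contour_integral \<gamma> (\<lambda>z. cinner x (resolvent T z *\<^sub>V y)) - cinner x y * (2 * pi * \<i> * winding_number \<gamma> p) = 0"
    using contour_integral_unique[OF has_contour_integral_diff[OF has_contour_integral_integral[OF int]
      has_contour_integral_lmul[OF has_contour_integral_winding_number[OF \<gamma>(1) p(1)]]]] by simp
  then show ?thesis using has_contour_integral_integral[OF int] p(2) by (simp add: mult_ac)
qed


section \<open>Operator-valued integrals along paths\<close>

lemma operator_primitive:
  fixes g :: "complex \<Rightarrow> 'h::complex_hilbert bop"
  assumes cont: "continuous_on (ball z0 r) g"
    and hol: "\<And>x y. (\<lambda>z. cinner x (g z *\<^sub>V y)) holomorphic_on ball z0 r"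
  obtains F where "\<And>z. z \<in> ball z0 r \<Longrightarrow> (F has_derivative (\<lambda>d. d *\<^sub>C g z)) (at z)"
proof (cases "r > 0")
  case r: True
  define J where "J a b = integral {0..1} (\<lambda>s. (b - a) *\<^sub>C g (linepath a b s))" for a b
  have seg: "closed_segment a b \<subseteq> ball z0 r" if "a \<in> ball z0 r" "b \<in> ball z0 r" for a b
    using that by (rule closed_segment_subset[OF _ _ convex_ball])
  have J: "((\<lambda>s. (b - a) *\<^sub>C g (linepath a b s)) has_integral J a b) {0..1}"
    if ab: "a \<in> ball z0 r" "b \<in> ball z0 r" for a b
    unfolding J_def
  proof (intro integrable_integral integrable_continuous_interval bounded_linear.continuous_on[OF bounded_linear_scaleC_bop])
    show "continuous_on {0..1} (\<lambda>s. g (linepath a b s))"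
      by (rule continuous_on_compose2[OF cont continuous_on_linepath])
        (use seg[OF ab] in \<open>auto simp: linepath_image_01[symmetric]\<close>)
  qed
  have add: "J z0 w = J z0 z + J z w" if z: "z \<in> ball z0 r" and w: "w \<in> ball z0 r" for z w
  proof (rule bop_eqI_cinner)
    fix x y
    let ?h = "\<lambda>z. cinner x (g z *\<^sub>V y)"
    obtain H where H: "\<And>z. z \<in> ball z0 r \<Longrightarrow> (H has_field_derivative ?h z) (at z within ball z0 r)"
    proof (rule holomorphic_convex_primitive[OF convex_ball finite.emptyI])
      show "continuous_on (ball z0 r) ?h" by (rule holomorphic_on_imp_continuous_on[OF hol])
      show "?h field_differentiable at z" if "z \<in> interior (ball z0 r) - {}" for z
        using that by (intro holomorphic_on_imp_differentiable_at[OF hol open_ball]) simp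
    qed (use that in blast)
    have *: "cinner x (J a b *\<^sub>V y) = H b - H a" if ab: "a \<in> ball z0 r" "b \<in> ball z0 r" for a b
    proof (rule has_integral_unique)
      show "((\<lambda>s. ?h (linepath a b s) * (b - a)) has_integral cinner x (J a b *\<^sub>V y)) {0..1}"
        using has_integral_linear[OF J[OF ab] bounded_linear_cinner_bop[of x y]]
        by (simp add: o_def cinner_scaleC_right mult.commute)
      show "((\<lambda>s. ?h (linepath a b s) * (b - a)) has_integral (H b - H a)) {0..1}"
        using contour_integral_primitive[OF H valid_path_linepath, of a b] seg[OF ab]
        by (simp add: has_contour_integral_linepath)
    qed
    show "cinner x (J z0 w *\<^sub>V y) = cinner x ((J z0 z + J z w) *\<^sub>V y)"
      using r z w by (simp add: cinner_add_right *)
  qed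
  have "(J z0 has_derivative (\<lambda>d. d *\<^sub>C g z)) (at z)" if z: "z \<in> ball z0 r" for z
    unfolding has_derivative_at_alt
  proof (intro conjI allI impI bounded_linear_scaleC_bop_left)
    fix e :: real assume e: "e > 0"
    obtain d1 where d1: "d1 > 0" "ball z d1 \<subseteq> ball z0 r" using z open_contains_ball open_ball by blast
    have "isCont g z" using cont z by (simp add: continuous_on_eq_continuous_at)
    then obtain d2 where d2: "d2 > 0" "\<And>u. dist u z < d2 \<Longrightarrow> dist (g u) (g z) < e"
      using e unfolding continuous_at_eps_delta by blast
    have "norm (J z0 w - J z0 z - (w - z) *\<^sub>C g z) \<le> e * norm (w - z)" if w: "norm (w - z) < min d1 d2" for w
    proof -
      have "w \<in> ball z d1" using w by (simp add: dist_norm norm_minus_commute)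
      then have wB: "w \<in> ball z0 r" using d1(2) by blast
      have "((\<lambda>s. (w - z) *\<^sub>C g (linepath z w s) - (w - z) *\<^sub>C g z) has_integral (J z w - (w - z) *\<^sub>C g z)) {0..1}"
        using has_integral_diff[OF J[OF z wB] has_integral_const_real[of "(w - z) *\<^sub>C g z" 0 1]] by simp
      moreover have "norm ((w - z) *\<^sub>C g (linepath z w s) - (w - z) *\<^sub>C g z) \<le> e * norm (w - z)" if s: "s \<in> {0..1}" for s
      proof -
        have "linepath z w s - z = s *\<^sub>R (w - z)" by (simp add: linepath_def algebra_simps)
        then have "norm (linepath z w s - z) = s * norm (w - z)" using s by simp
        also have "\<dots> \<le> 1 * norm (w - z)" using s by (intro mult_right_mono) auto
        finally have "dist (linepath z w s) z < d2" using w by (simp add: dist_norm)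
        then have "norm (g (linepath z w s) - g z) \<le> e" using d2(2) by (fastforce simp: dist_norm)
        then have "norm ((w - z) *\<^sub>C (g (linepath z w s) - g z)) \<le> norm (w - z) * e"
          unfolding norm_scaleC_bop by (intro mult_left_mono) auto
        then show ?thesis by (simp add: scaleC_diff_right mult.commute)
      qed
      ultimately have "norm (J z w - (w - z) *\<^sub>C g z) \<le> e * norm (w - z) * measure lborel {0..1::real}"
        using e by (intro has_integral_bound_real[OF _ finite.emptyI]) auto
      then show ?thesis using add[OF z wB] by simp
    qed
    then show "\<exists>d>0. \<forall>w. norm (w - z) < d \<longrightarrow> norm (J z0 w - J z0 z - (w - z) *\<^sub>C g z) \<le> e * norm (w - z)"
      using d1(1) d2(1) by (intro exI[of _ "min d1 d2"]) auto
  qed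
  then show ?thesis by (rule that)
next
  case False
  then have "ball z0 r = {}" by simp
  then show ?thesis using that by blast
qed

text \<open>The derivative of a valid path may be unbounded near the finitely many exceptional points, so
  continuity of the integrand does not suffice.\<close>

lemma operator_path_integrable:
  fixes g :: "complex \<Rightarrow> 'h::complex_hilbert bop"
  assumes S: "open S" and cont: "continuous_on S g"
    and hol: "\<And>x y. (\<lambda>z. cinner x (g z *\<^sub>V y)) holomorphic_on S"
    and \<gamma>: "valid_path \<gamma>" "path_image \<gamma> \<subseteq> S"
  shows "(\<lambda>t. vector_derivative \<gamma> (at t within {0..1}) *\<^sub>C g (\<gamma> t)) integrable_on {0..1}"
proof -
  let ?f = "\<lambda>t. vector_derivative \<gamma> (at t within {0..1}) *\<^sub>C g (\<gamma> t)"
  obtain k where k: "finite k" "\<gamma> C1_differentiable_on ({0..1} - k)" and c\<gamma>: "continuous_on {0..1} \<gamma>"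
    using \<gamma>(1) unfolding valid_path_def piecewise_C1_differentiable_on_def by blast
  have "?f integrable_on cbox 0 1"
  proof (rule integrable_on_little_subintervals, intro ballI)
    fix t :: real assume "t \<in> cbox 0 1"
    then have t: "t \<in> {0..1}" by simp
    then have "\<gamma> t \<in> S" using \<gamma>(2) by (auto simp: path_image_def)
    then obtain r where r: "r > 0" "ball (\<gamma> t) r \<subseteq> S" using S open_contains_ball by blast
    obtain F where F: "\<And>z. z \<in> ball (\<gamma> t) r \<Longrightarrow> (F has_derivative (\<lambda>d. d *\<^sub>C g z)) (at z)"
      using operator_primitive[OF continuous_on_subset[OF cont r(2)] holomorphic_on_subset[OF hol r(2)]] by blast
    obtain d where d: "d > 0" "\<And>u. u \<in> {0..1} \<Longrightarrow> dist u t < d \<Longrightarrow> dist (\<gamma> u) (\<gamma> t) < r"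
      using c\<gamma> t r(1) unfolding continuous_on_iff by blast
    have "?f integrable_on cbox u v" if uv: "t \<in> cbox u v" "cbox u v \<subseteq> ball t d" "cbox u v \<subseteq> cbox 0 1" for u v
    proof -
      have in_ball: "\<gamma> s \<in> ball (\<gamma> t) r" if "s \<in> {u..v}" for s
      proof -
        have "s \<in> {0..1}" "dist s t < d" using that uv(2,3) by (auto simp: dist_commute)
        then show ?thesis using d(2) by (simp add: dist_commute)
      qed
      have "(?f has_integral ((F \<circ> \<gamma>) v - (F \<circ> \<gamma>) u)) {u..v}"
      proof (rule fundamental_theorem_of_calculus_interior_strong[OF k(1)])
        show "u \<le> v" using uv(1) by simp
        fix s assume s: "s \<in> {u<..<v} - k"
        then have "s \<in> {u..v}" by simp
        then have s01: "s \<in> {0..1}" using uv(3) by (auto simp: subset_iff)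
        have "\<gamma> differentiable at s" using k(2) s s01 unfolding C1_differentiable_on_eq by blast
        then have v: "(\<gamma> has_vector_derivative vector_derivative \<gamma> (at s)) (at s)" by (simp add: vector_derivative_works)
        have "((F \<circ> \<gamma>) has_vector_derivative vector_derivative \<gamma> (at s) *\<^sub>C g (\<gamma> s)) (at s)"
          by (rule vector_derivative_diff_chain_within[OF v has_derivative_at_withinI[OF F[OF in_ball[OF \<open>s \<in> {u..v}\<close>]]]])
        moreover have "vector_derivative \<gamma> (at s within {0..1}) = vector_derivative \<gamma> (at s)"
          by (rule vector_derivative_at_within_ivl[OF v]) (use s01 in auto)
        ultimately show "((F \<circ> \<gamma>) has_vector_derivative ?f s) (at s)" by simp
      next
        have "{u..v} \<subseteq> {0..1}" using uv(3) by simp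
        moreover have "continuous_on (ball (\<gamma> t) r) F"
          by (intro continuous_at_imp_continuous_on ballI has_derivative_continuous[OF F])
        ultimately show "continuous_on {u..v} (F \<circ> \<gamma>)"
          using in_ball by (intro continuous_on_compose continuous_on_subset[OF c\<gamma>]) (auto elim!: continuous_on_subset)
      qed
      then show ?thesis by (auto simp: integrable_on_def)
    qed
    then show "\<exists>d>0. \<forall>u v. t \<in> cbox u v \<and> cbox u v \<subseteq> ball t d \<and> cbox u v \<subseteq> cbox 0 1 \<longrightarrow> ?f integrable_on cbox u v"
      using d(1) by blast
  qed
  then show ?thesis by simp
qed


section \<open>A contour around the spectrum\<close>

lemma Re_csqrt_pos:
  assumes "z \<notin> \<real>\<^sub>\<le>\<^sub>0"
  shows "0 < Re (csqrt z)"
proof (rule ccontr)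
  assume "\<not> 0 < Re (csqrt z)"
  then have "Re (csqrt z) = 0" using csqrt_principal[of z] by simp
  moreover have "b * b \<in> \<real>\<^sub>\<le>\<^sub>0" if "Re b = 0" for b
    using that by (simp add: complex_nonpos_Reals_iff)
  ultimately have "csqrt z * csqrt z \<in> \<real>\<^sub>\<le>\<^sub>0" by blast
  then show False using assms by (simp flip: power2_eq_square)
qed

lemma square_not_nonpos:
  assumes "0 < Re b"
  shows "b\<^sup>2 \<notin> \<real>\<^sub>\<le>\<^sub>0"
proof
  assume "b\<^sup>2 \<in> \<real>\<^sub>\<le>\<^sub>0"
  then have "2 * Re b * Im b = 0" "(Re b)\<^sup>2 - (Im b)\<^sup>2 \<le> 0"
    by (auto simp: complex_nonpos_Reals_iff power2_eq_square)
  then show False using assms by (auto simp: zero_less_power)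
qed

lemma cmod_minus_one_less:
  assumes "0 < Re a"
  shows "cmod (a - 1) < cmod (a + 1)"
proof -
  have "(cmod (a - 1))\<^sup>2 < (cmod (a + 1))\<^sup>2"
    using assms unfolding cmod_power2 by (simp add: power2_eq_square algebra_simps)
  then show ?thesis by (rule power2_less_imp_less) simp
qed

definition cayley :: "complex \<Rightarrow> complex" where "cayley u = (1 + u) / (1 - u)"

lemma Re_cayley_pos:
  assumes "cmod u < 1"
  shows "0 < Re (cayley u)"
proof -
  have u1: "u \<noteq> 1" using assms by auto
  have "cayley u = (1 + u) * cnj (1 - u) / of_real ((cmod (1 - u))\<^sup>2)"
    unfolding cayley_def complex_div_cnj[of "1 + u"] by simp
  then have "Re (cayley u) = Re ((1 + u) * cnj (1 - u)) / (cmod (1 - u))\<^sup>2" by (simp only: Re_divide_of_real)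
  also have "Re ((1 + u) * cnj (1 - u)) = 1 - (cmod u)\<^sup>2"
    unfolding cmod_power2 by (simp add: power2_eq_square algebra_simps)
  also have "(1 - (cmod u)\<^sup>2) / (cmod (1 - u))\<^sup>2 > 0"
    using assms u1 by (intro divide_pos_pos) (auto simp: power_less_one_iff abs_square_less_1)
  finally show ?thesis .
qed

lemma cayley_inverse:
  assumes "cmod u < 1"
  shows "(cayley u - 1) / (cayley u + 1) = u"
proof -
  have "1 - u \<noteq> 0" using assms by auto
  then have "cayley u - 1 = 2 * u / (1 - u)" "cayley u + 1 = 2 / (1 - u)"
    unfolding cayley_def by (simp_all add: field_simps)
  then show ?thesis using \<open>1 - u \<noteq> 0\<close> by simp
qed

lemma slit_plane_simply_connected: "simply_connected (- \<real>\<^sub>\<le>\<^sub>0 :: complex set)"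
proof -
  have "complex_of_real ` {..0} = \<real>\<^sub>\<le>\<^sub>0" by (auto simp: nonpos_Reals_def)
  then show ?thesis using simply_connected_slotted_complex_plane_left[of 0] by simp
qed

text \<open>The map \<open>u \<mapsto> ((1 + u)/(1 - u))\<^sup>2\<close> takes the unit disc conformally onto the slit plane; a circle of
  radius close to 1 is mapped to a suitable contour.\<close>

lemma slit_plane_contour:
  assumes K: "compact K" "K \<inter> \<real>\<^sub>\<le>\<^sub>0 = {}"
  obtains \<gamma> where "valid_path \<gamma>" "pathfinish \<gamma> = pathstart \<gamma>" "path_image \<gamma> \<subseteq> - \<real>\<^sub>\<le>\<^sub>0 - K"
    "\<And>z. z \<in> K \<Longrightarrow> winding_number \<gamma> z = 1" "\<And>z. z \<in> \<real>\<^sub>\<le>\<^sub>0 \<Longrightarrow> winding_number \<gamma> z = 0"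
proof -
  define m where "m z = (csqrt z - 1) / (csqrt z + 1)" for z
  have m1: "cmod (m z) < 1" if "z \<notin> \<real>\<^sub>\<le>\<^sub>0" for z
    using cmod_minus_one_less[OF Re_csqrt_pos[OF that]] by (simp add: m_def norm_divide divide_less_eq) 
  have "\<exists>r. 0 < r \<and> r < 1 \<and> (\<forall>z\<in>K. cmod (m z) < r)"
  proof (cases "K = {}")
    case False
    have "continuous_on K (\<lambda>z. cmod (m z))"
      unfolding m_def
    proof (intro continuous_intros continuous_on_subset[OF continuous_on_csqrt] ballI)
      show "csqrt z + 1 \<noteq> 0" if "z \<in> K" for z
      proof
        assume "csqrt z + 1 = 0"
        then have "Re (csqrt z) = - 1" by (simp add: complex_eq_iff)
        then show False using Re_csqrt_pos[of z] that K(2) by auto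
      qed
    qed (use K(2) in auto)
    from continuous_attains_sup[OF K(1) False this]
    obtain z0 where z0: "z0 \<in> K" "\<And>z. z \<in> K \<Longrightarrow> cmod (m z) \<le> cmod (m z0)" by blast
    have "cmod (m z0) < 1" using z0(1) K(2) by (intro m1) auto
    then obtain r where r: "cmod (m z0) < r" "r < 1" using dense by blast
    moreover have "0 < r" using le_less_trans[OF norm_ge_zero r(1)] .
    ultimately show ?thesis using z0(2) le_less_trans by blast
  qed (auto intro: exI[of _ "1/2"])
  then obtain r where r: "0 < r" "r < 1" "\<And>z. z \<in> K \<Longrightarrow> cmod (m z) < r" by blast
  define \<phi> where "\<phi> u = (cayley u)\<^sup>2" for u
  have \<phi>': "(\<phi> has_field_derivative 4 * (1 + u) / (1 - u) ^ 3) (at u)" if "cmod u < 1" for u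
  proof -
    have u: "1 - u \<noteq> 0" using that by auto
    then have "(\<phi> has_field_derivative 2 * ((1 + u) / (1 - u)) * ((1 * (1 - u) - (1 + u) * (- 1)) / ((1 - u) * (1 - u)))) (at u)"
      unfolding \<phi>_def cayley_def by (auto intro!: derivative_eq_intros)
    also have "2 * ((1 + u) / (1 - u)) * ((1 * (1 - u) - (1 + u) * (- 1)) / ((1 - u) * (1 - u))) = 4 * (1 + u) / (1 - u) ^ 3"
      using u by (simp add: power3_eq_cube)
    finally show ?thesis .
  qed
  have hol: "\<phi> holomorphic_on ball 0 1"
    unfolding holomorphic_on_open[OF open_ball] by (intro ballI exI, rule \<phi>') simp
  have \<phi>D: "\<phi> u \<notin> \<real>\<^sub>\<le>\<^sub>0" if "cmod u < 1" for u
    unfolding \<phi>_def by (rule square_not_nonpos[OF Re_cayley_pos[OF that]])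
  have m\<phi>: "m (\<phi> u) = u" if "cmod u < 1" for u
    using csqrt_square[of "cayley u"] Re_cayley_pos[OF that] cayley_inverse[OF that] by (simp add: m_def \<phi>_def)
  let ?c = "circlepath 0 r"
  have c: "path_image ?c \<subseteq> ball 0 1" using r by (auto simp: path_image_circlepath)
  have cr: "cmod u = r" if "u \<in> path_image ?c" for u using that r by (auto simp: path_image_circlepath)
  define \<gamma> where "\<gamma> = \<phi> \<circ> ?c"
  have v: "valid_path \<gamma>" unfolding \<gamma>_def by (rule valid_path_compose_holomorphic[OF _ hol open_ball c]) simp
  have loop: "pathfinish \<gamma> = pathstart \<gamma>" by (simp add: \<gamma>_def pathfinish_compose pathstart_compose)
  have img: "path_image \<gamma> \<subseteq> - \<real>\<^sub>\<le>\<^sub>0 - K"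
  proof
    fix w assume "w \<in> path_image \<gamma>"
    then obtain u where u: "u \<in> path_image ?c" "w = \<phi> u" by (auto simp: \<gamma>_def path_image_compose)
    have "cmod u < 1" using cr[OF u(1)] r by simp
    then have "w \<notin> \<real>\<^sub>\<le>\<^sub>0" "m w = u" using \<phi>D m\<phi> u(2) by auto
    then show "w \<in> - \<real>\<^sub>\<le>\<^sub>0 - K" using r(3)[of w] cr[OF u(1)] by auto
  qed
  show ?thesis
  proof (rule that[OF v loop img])
    show "winding_number \<gamma> z = 0" if "z \<in> \<real>\<^sub>\<le>\<^sub>0" for z
      by (rule simply_connected_imp_winding_number_zero[OF slit_plane_simply_connected valid_path_imp_path[OF v] _ loop])
        (use img that in auto)
    fix z assume z: "z \<in> K"
    define a where "a = csqrt z"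
    have a: "0 < Re a" unfolding a_def using z K(2) by (intro Re_csqrt_pos) auto
    have a1: "1 + a \<noteq> 0" using a by (auto simp: complex_eq_iff)
    define u0 where "u0 = (a - 1) / (a + 1)"
    have u0: "cmod u0 < r" using r(3)[OF z] by (simp add: u0_def m_def a_def)
    define E where "E u = 2 / (1 - u) + (1 - a) / ((1 - a) * u + (1 + a))" for u
    have den: "(1 - a) * u + (1 + a) \<noteq> 0" if "cmod u < 1" for u
    proof
      assume "(1 - a) * u + (1 + a) = 0"
      then have "cmod (1 + a) = cmod ((1 - a) * u)" by (metis add_eq_0_iff norm_minus_cancel)
      also have "\<dots> \<le> cmod (1 - a) * 1" unfolding norm_mult using that by (intro mult_left_mono) auto
      also have "\<dots> < cmod (1 + a)" using cmod_minus_one_less[OF a] by (simp add: norm_minus_commute add.commute)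
      finally show False by simp
    qed
    have hE: "E holomorphic_on ball 0 1"
      unfolding E_def by (intro holomorphic_intros) (use den in \<open>auto simp: dist_norm\<close>)
    have E0: "(E has_contour_integral 0) ?c"
      by (rule Cauchy_theorem_convex_simple[OF hE convex_ball _ c]) auto
    have an: "\<phi> analytic_on ball 0 1" using hol by (simp add: analytic_on_open)
    have zimg: "z \<notin> path_image \<gamma>" using img z by auto
    have u0c: "u0 \<notin> path_image ?c" using u0 cr by force
    have "winding_number \<gamma> z = 1 / (2 * pi * \<i>) * contour_integral ?c (\<lambda>u. deriv \<phi> u * (1 / (\<phi> u - z)))"
      unfolding winding_number_valid_path[OF v zimg] unfolding \<gamma>_def
      by (subst contour_integral_comp_analyticW[OF an _ c]) auto
    also have "contour_integral ?c (\<lambda>u. deriv \<phi> u * (1 / (\<phi> u - z))) = contour_integral ?c (\<lambda>u. 1 / (u - u0) + E u)"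
    proof (rule contour_integral_eq)
      fix u assume u: "u \<in> path_image ?c"
      have u1: "cmod u < 1" using cr[OF u] r by simp
      have n1: "1 - u \<noteq> 0" using u1 by auto
      define p q where "p = (1 + a) * u + (1 - a)" and "q = (1 - a) * u + (1 + a)"
      have q: "q \<noteq> 0" unfolding q_def by (rule den[OF u1])
      have p: "p \<noteq> 0"
      proof
        assume "p = 0"
        then have "u * (a + 1) = a - 1" by (simp add: p_def algebra_simps)
        then have "u = u0" using a1 by (simp add: u0_def eq_divide_eq add.commute)
        then show False using u u0c by simp
      qed
      have "u - u0 = p / (1 + a)"
        unfolding u0_def p_def using a1 by (simp add: divide_simps add.commute[of a 1])
      then have inv: "1 / (u - u0) = (1 + a) / p" by simp
      have zz: "z = a\<^sup>2" by (simp add: a_def)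
      have "\<phi> u - z = (cayley u - a) * (cayley u + a)" unfolding \<phi>_def zz by (simp add: power2_eq_square algebra_simps)
      also have "cayley u - a = p / (1 - u)" unfolding cayley_def p_def using n1 by (simp add: field_simps)
      also have "cayley u + a = q / (1 - u)" unfolding cayley_def q_def using n1 by (simp add: field_simps)
      finally have "1 / (\<phi> u - z) = (1 - u)\<^sup>2 / (p * q)" by (simp add: power2_eq_square)
      then have "deriv \<phi> u * (1 / (\<phi> u - z)) = 4 * (1 + u) / (1 - u) ^ 3 * ((1 - u)\<^sup>2 / (p * q))"
        using DERIV_imp_deriv[OF \<phi>'[OF u1]] by simp
      also have "\<dots> = 4 * (1 + u) / ((1 - u) * (p * q))"
        using n1 by (simp add: power3_eq_cube power2_eq_square)
      also have "4 * (1 + u) = (1 + a) * (1 - u) * q + 2 * p * q + (1 - a) * (1 - u) * p"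
        by (simp add: p_def q_def algebra_simps)
      also have "\<dots> / ((1 - u) * (p * q)) = (1 + a) / p + (2 / (1 - u) + (1 - a) / q)"
        using p q n1 by (simp add: divide_simps) (simp add: algebra_simps)
      finally show "deriv \<phi> u * (1 / (\<phi> u - z)) = 1 / (u - u0) + E u" unfolding inv E_def q_def .
    qed
    also have "\<dots> = 2 * pi * \<i> * winding_number ?c u0 + 0"
      by (intro contour_integral_unique has_contour_integral_add has_contour_integral_winding_number E0 u0c valid_path_circlepath)
    finally show "winding_number \<gamma> z = 1" using winding_number_circlepath[of u0 0 r] u0 by simp
  qed
qed


section \<open>The Dunford logarithm\<close>

lemma slit_plane_segment:
  fixes z :: complex
  assumes z: "z \<notin> \<real>\<^sub>\<le>\<^sub>0" and s: "0 \<le> s" "s \<le> 1"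
  shows "1 + of_real s * (z - 1) \<notin> \<real>\<^sub>\<le>\<^sub>0"
proof
  assume "1 + of_real s * (z - 1) \<in> \<real>\<^sub>\<le>\<^sub>0"
  then have im: "s * Im z = 0" and re: "1 + s * (Re z - 1) \<le> 0" by (auto simp: complex_nonpos_Reals_iff)
  show False
  proof (cases "s = 0")
    case False
    then have "Im z = 0" "0 < Re z" using im z by (auto simp: complex_nonpos_Reals_iff)
    then have "0 \<le> s * Re z" using s by simp
    then have "s = 1" using re s by (simp add: algebra_simps)
    then show False using re \<open>0 < Re z\<close> by simp
  qed (use re in simp)
qed

lemma Ln_integral:
  assumes z: "z \<notin> \<real>\<^sub>\<le>\<^sub>0"
  shows "((\<lambda>s. (z - 1) / (1 + of_real s * (z - 1))) has_integral Ln z) {0..1}"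
proof -
  have "((\<lambda>s. Ln (1 + of_real s * (z - 1))) has_vector_derivative (z - 1) / (1 + of_real s * (z - 1))) (at s within {0..1})"
    if s: "s \<in> {0..1}" for s
  proof -
    have "((\<lambda>w. Ln (1 + w * (z - 1))) has_field_derivative inverse (1 + of_real s * (z - 1)) * (z - 1)) (at (of_real s))"
      by (rule DERIV_chain2[OF has_field_derivative_Ln])
        (use slit_plane_segment[OF z] s in \<open>auto intro!: derivative_eq_intros\<close>)
    then have "((\<lambda>s. Ln (1 + of_real s * (z - 1))) has_vector_derivative inverse (1 + of_real s * (z - 1)) * (z - 1)) (at s within {0..1})"
      using has_vector_derivative_real_field by blast
    then show ?thesis by (simp add: divide_inverse mult.commute)
  qed
  then have "((\<lambda>s. (z - 1) / (1 + of_real s * (z - 1))) has_integral (Ln (1 + of_real 1 * (z - 1)) - Ln (1 + of_real 0 * (z - 1)))) {0..1}"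
    by (intro fundamental_theorem_of_calculus) auto
  then show ?thesis by simp
qed

lemma op_spectrum_if_log_domain:
  assumes "log_domain (T - 1)"
  shows "op_spectrum T \<inter> \<real>\<^sub>\<le>\<^sub>0 = {}"
proof -
  have "invertible_op (z *\<^sub>C 1 - T)" if z: "z \<in> \<real>\<^sub>\<le>\<^sub>0" for z
  proof -
    obtain l where l: "0 \<le> l" "z = - of_real l"
      using z by (auto simp: nonpos_Reals_def) (metis add.inverse_inverse neg_0_le_iff_le of_real_minus)
    define s where "s = 1 / (1 + l)"
    have s: "s \<in> {0..1}" "(1 + l) * s = 1" using l by (auto simp: s_def)
    have "z *\<^sub>C 1 - T = (- of_real (1 + l)) *\<^sub>C (1 + s *\<^sub>R (T - 1))"
    proof -
      have "(- of_real (1 + l)) *\<^sub>C (1 + s *\<^sub>R (T - 1)) = - ((1 + l) *\<^sub>R (1 + s *\<^sub>R (T - 1)))"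
        by (simp only: scaleC_minus_left scaleC_of_real)
      also have "\<dots> = - ((1 + l) *\<^sub>R 1 + (T - 1))" by (simp add: scaleR_add_right s(2))
      also have "\<dots> = z *\<^sub>C 1 - T" by (simp add: l(2) scaleC_minus_left scaleC_of_real scaleR_add_left)
      finally show ?thesis ..
    qed
    moreover have "- of_real (1 + l) \<noteq> (0::complex)" using l(1) by (metis neg_equal_0_iff_equal of_real_eq_0_iff add_nonneg_eq_0_iff zero_le_one zero_neq_one)
    ultimately show ?thesis
      using invertible_op_scaleC(1) assms s(1) unfolding log_domain_def by metis
  qed
  then show ?thesis using op_spectrum_iff by blast
qed

text \<open>The function \<open>(Ln z - L) (z - T)\<^sup>-\<^sup>1\<close> extends holomorphically across the spectrum, so
  that the contour integral of \<open>Ln z (z - T)\<^sup>-\<^sup>1\<close> reduces to that of \<open>L (z - T)\<^sup>-\<^sup>1\<close>.\<close>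

lemma Ln_resolvent_identity:
  assumes dom: "log_domain (T - 1)" and z: "z \<notin> \<real>\<^sub>\<le>\<^sub>0" and inv: "invertible_op (z *\<^sub>C 1 - T)"
  defines "R \<equiv> resolvent T z"
  shows "((\<lambda>s. 1 / (1 + of_real s * (z - 1)) * cinner x (res (T - 1) s *\<^sub>V y)) has_integral
    (Ln z * cinner x (R *\<^sub>V y) - cinner x ((((T - 1) * res_integral (T - 1)) * R) *\<^sub>V y))) {0..1}"
proof -
  have lin: "bounded_linear (\<lambda>X. cinner x (((T - 1) * X * R) *\<^sub>V y))"
    by (rule bounded_linear_compose[OF bounded_linear_cinner_bop
      bounded_linear_compose[OF bounded_linear_mult_left bounded_linear_mult_right]])
  have "((\<lambda>s. cinner x (((T - 1) * res (T - 1) s * R) *\<^sub>V y)) has_integral cinner x (((T - 1) * res_integral (T - 1) * R) *\<^sub>V y)) {0..1}"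
    using has_integral_linear[OF integrable_integral[OF integrable_res[OF dom]] lin] by (simp add: o_def res_integral_def)
  from has_integral_diff[OF has_integral_mult_left[OF Ln_integral[OF z], of "cinner x (R *\<^sub>V y)"] this]
  show ?thesis
  proof (rule has_integral_eq[rotated])
    fix s :: real assume s: "s \<in> {0..1}"
    define c where "c = 1 + of_real s * (z - 1)"
    have c0: "c \<noteq> 0" using slit_plane_segment[OF z, of s] s by (auto simp: c_def)
    let ?X = "res (T - 1) s"
    note X = res_inverse[OF dom s]
    have R: "R * (z *\<^sub>C 1 - T) = 1" "(z *\<^sub>C 1 - T) * R = 1" unfolding R_def by (rule op_inverse[OF inv])+
    have TX: "(T - 1) * ?X = ?X * (T - 1)" by (rule res_commute[OF dom s])
    have "(z - 1) *\<^sub>C (1 + s *\<^sub>R (T - 1)) - c *\<^sub>C (T - 1) = z *\<^sub>C 1 - T"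
    proof -
      have "c *\<^sub>C (T - 1) = (T - 1) + (z - 1) *\<^sub>C (s *\<^sub>R (T - 1))"
        by (simp only: c_def scaleC_add_left scaleC_one scaleC_of_real[symmetric] scaleC_scaleC mult.commute)
      then show ?thesis by (simp add: scaleC_add_right scaleC_diff_left)
    qed
    then have "?X * ((z - 1) *\<^sub>C (1 + s *\<^sub>R (T - 1)) - c *\<^sub>C (T - 1)) * R = ?X * (z *\<^sub>C 1 - T) * R" by simp
    moreover have "?X * ((z - 1) *\<^sub>C (1 + s *\<^sub>R (T - 1)) - c *\<^sub>C (T - 1)) * R
        = (z - 1) *\<^sub>C (?X * (1 + s *\<^sub>R (T - 1)) * R) - c *\<^sub>C (?X * (T - 1) * R)"
      by (simp only: right_diff_distrib left_diff_distrib bop_mult_scaleC)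
    moreover have "?X * (z *\<^sub>C 1 - T) * R = ?X" by (simp only: mult.assoc R mult_1_right)
    ultimately have "(z - 1) *\<^sub>C R - c *\<^sub>C ((T - 1) * ?X * R) = ?X"
      by (simp only: X(1) TX mult_1_left)
    from arg_cong[OF this, of "\<lambda>X. cinner x (X *\<^sub>V y)"]
    have "cinner x (?X *\<^sub>V y) = (z - 1) * cinner x (R *\<^sub>V y) - c * cinner x (((T - 1) * ?X * R) *\<^sub>V y)"
      by (simp only: bop_apply_simps(2,8) cinner_diff_right cinner_scaleC_right)
    then show "(z - 1) / (1 + of_real s * (z - 1)) * cinner x (R *\<^sub>V y) - cinner x (((T - 1) * ?X * R) *\<^sub>V y)
        = 1 / (1 + of_real s * (z - 1)) * cinner x (?X *\<^sub>V y)"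
      unfolding c_def[symmetric] using c0 by (simp add: field_simps)
  qed
qed

theorem op_log_eq_integral:
  fixes T :: "'h::complex_hilbert bop"
  assumes dom: "log_domain (T - 1)"
  shows "op_log T = (T - 1) * res_integral (T - 1)"
proof (cases "(1::'h bop) = 0")
  case True
  have "X = 0" for X :: "'h bop" by (metis True mult.left_neutral mult_zero_left)
  then show ?thesis by metis
next
  case nz: False
  define L where "L = (T - 1) * res_integral (T - 1)"
  define \<gamma> where "\<gamma> = (SOME \<gamma>. dunford_contour (- \<real>\<^sub>\<le>\<^sub>0) T \<gamma>)"
  obtain \<gamma>0 where "valid_path \<gamma>0" "pathfinish \<gamma>0 = pathstart \<gamma>0" "path_image \<gamma>0 \<subseteq> - \<real>\<^sub>\<le>\<^sub>0 - op_spectrum T"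
    "\<And>z. z \<in> op_spectrum T \<Longrightarrow> winding_number \<gamma>0 z = 1" "\<And>z. z \<in> \<real>\<^sub>\<le>\<^sub>0 \<Longrightarrow> winding_number \<gamma>0 z = 0"
    using slit_plane_contour[OF compact_op_spectrum op_spectrum_if_log_domain[OF dom]] by blast
  then have "dunford_contour (- \<real>\<^sub>\<le>\<^sub>0) T \<gamma>0" by (simp add: dunford_contour_def)
  then have "dunford_contour (- \<real>\<^sub>\<le>\<^sub>0) T \<gamma>" unfolding \<gamma>_def by (rule someI[of "dunford_contour (- \<real>\<^sub>\<le>\<^sub>0) T"])
  then have \<gamma>: "valid_path \<gamma>" "pathfinish \<gamma> = pathstart \<gamma>" "path_image \<gamma> \<subseteq> - \<real>\<^sub>\<le>\<^sub>0 - op_spectrum T"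
    "\<And>z. z \<in> op_spectrum T \<Longrightarrow> winding_number \<gamma> z = 1" "\<And>z. z \<notin> - \<real>\<^sub>\<le>\<^sub>0 \<Longrightarrow> winding_number \<gamma> z = 0"
    unfolding dunford_contour_def by blast+
  let ?R = "resolvent T"
  let ?S = "- \<real>\<^sub>\<le>\<^sub>0 - op_spectrum T"
  let ?g = "\<lambda>z. Ln z *\<^sub>C ?R z"
  have S: "open ?S" using compact_imp_closed[OF compact_op_spectrum] by (intro open_Diff open_Compl closed_nonpos_Reals_complex)
  have invS: "invertible_op (z *\<^sub>C 1 - T)" "z \<notin> \<real>\<^sub>\<le>\<^sub>0" if "z \<in> ?S" for z using that op_spectrum_iff by auto
  have hol: "(\<lambda>z. cinner x (?g z *\<^sub>V y)) holomorphic_on ?S" for x y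
    by (simp only: bop_apply_simps cinner_scaleC_right)
      (intro holomorphic_intros holomorphic_on_subset[OF holomorphic_resolvent]; auto)
  have cont: "continuous_on ?S ?g"
  proof (rule bounded_bilinear.continuous_on[OF bounded_bilinear_scaleC_bop])
    show "continuous_on ?S Ln" by (intro continuous_intros) auto
    have "continuous_on ?S (\<lambda>z. z *\<^sub>C (1::'h bop) - T)"
      by (intro continuous_intros bounded_linear.continuous_on[OF bounded_linear_scaleC_bop_left])
    then show "continuous_on ?S ?R" by (rule continuous_on_op_inverse) (rule invS)
  qed
  let ?I = "\<lambda>t. (Ln (\<gamma> t) * vector_derivative \<gamma> (at t within {0..1})) *\<^sub>C ?R (\<gamma> t)"
  have int: "?I integrable_on {0..1}"
    using operator_path_integrable[OF S cont hol \<gamma>(1,3)] by (simp add: scaleC_scaleC mult.commute)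
  have log: "op_log T = (1 / (2 * of_real pi * \<i>)) *\<^sub>C integral {0..1} ?I"
    unfolding op_log_def dunford_def Let_def \<gamma>_def ..
  show ?thesis
    unfolding L_def[symmetric]
  proof (rule bop_eqI_cinner)
    fix x y
    have "((\<lambda>t. cinner x (?I t *\<^sub>V y)) has_integral cinner x (integral {0..1} ?I *\<^sub>V y)) {0..1}"
      using has_integral_linear[OF integrable_integral[OF int] bounded_linear_cinner_bop] by (simp add: o_def)
    then have 1: "((\<lambda>z. Ln z * cinner x (?R z *\<^sub>V y)) has_contour_integral cinner x (integral {0..1} ?I *\<^sub>V y)) \<gamma>"
      by (simp add: has_contour_integral_def cinner_scaleC_right mult_ac)
    define N where "N z = integral (cbox 0 1) (\<lambda>s. 1 / (1 + of_real s * (z - 1)) * cinner x (res (T - 1) s *\<^sub>V y))" for z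
    have Nhol: "N holomorphic_on - \<real>\<^sub>\<le>\<^sub>0"
    proof (rule holomorphic_onI)
      fix z :: complex assume "z \<in> - \<real>\<^sub>\<le>\<^sub>0"
      then obtain r where r: "r > 0" "ball z r \<subseteq> - \<real>\<^sub>\<le>\<^sub>0"
        using open_contains_ball[of "- \<real>\<^sub>\<le>\<^sub>0 :: complex set"] closed_nonpos_Reals_complex by (auto simp: open_Compl)
      have den: "1 + of_real s * (w - 1) \<noteq> 0" if "w \<in> ball z r" "s \<in> {0..1}" for s w
        using slit_plane_segment[of w s] r(2) that by force
      have cr: "continuous_on {0..1} (\<lambda>s. cinner x (res (T - 1) s *\<^sub>V y))"
        by (rule bounded_linear.continuous_on[OF bounded_linear_cinner_bop continuous_on_res[OF dom]])
      have "N holomorphic_on ball z r"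
        unfolding N_def
      proof (rule leibniz_rule_holomorphic[OF _ _ _ convex_ball])
        fix w and s :: real assume w: "w \<in> ball z r" "s \<in> cbox 0 1"
        have "1 + of_real s * (w - 1) \<noteq> 0" using den w by simp
        then show "((\<lambda>w. 1 / (1 + of_real s * (w - 1)) * cinner x (res (T - 1) s *\<^sub>V y)) has_field_derivative
            - (of_real s / (1 + of_real s * (w - 1))\<^sup>2) * cinner x (res (T - 1) s *\<^sub>V y)) (at w within ball z r)"
          by (auto intro!: derivative_eq_intros simp: power2_eq_square)
      next
        fix w assume w: "w \<in> ball z r"
        show "(\<lambda>s. 1 / (1 + of_real s * (w - 1)) * cinner x (res (T - 1) s *\<^sub>V y)) integrable_on cbox 0 1"
          using den[OF w] unfolding cbox_interval by (intro integrable_continuous_interval continuous_intros cr) auto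
      next
        have "continuous_on (ball z r \<times> cbox 0 1) (\<lambda>p. cinner x (res (T - 1) (snd p) *\<^sub>V y))"
          by (rule continuous_on_compose2[OF cr continuous_on_snd[OF continuous_on_id]]) auto
        then show "continuous_on (ball z r \<times> cbox 0 1) (\<lambda>(w, s). - (of_real s / (1 + of_real s * (w - 1))\<^sup>2) * cinner x (res (T - 1) s *\<^sub>V y))"
          unfolding case_prod_unfold using den by (intro continuous_intros) auto
      qed
      then have "N field_differentiable at z" using r(1) by (intro holomorphic_on_imp_differentiable_at[OF _ open_ball]) auto
      then show "N field_differentiable at z within - \<real>\<^sub>\<le>\<^sub>0" by (rule field_differentiable_at_within)
    qed
    have N0: "(N has_contour_integral 0) \<gamma>"
      by (rule Cauchy_theorem_global[OF _ Nhol \<gamma>(1,2) _ \<gamma>(5)])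
        (use \<gamma>(3) closed_nonpos_Reals_complex in \<open>auto simp: open_Compl\<close>)
    have "((\<lambda>z. cinner (adj L *\<^sub>V x) (?R z *\<^sub>V y)) has_contour_integral (2 * of_real pi * \<i> * cinner (adj L *\<^sub>V x) y)) \<gamma>"
      by (rule resolvent_contour_integral[OF nz \<gamma>(1,2) _ \<gamma>(4)]) (use \<gamma>(3) in auto)
    from has_contour_integral_add[OF N0 this, unfolded add_0_left]
    have "((\<lambda>z. Ln z * cinner x (?R z *\<^sub>V y)) has_contour_integral (2 * of_real pi * \<i> * cinner (adj L *\<^sub>V x) y)) \<gamma>"
    proof (rule has_contour_integral_eq)
      fix z assume "z \<in> path_image \<gamma>"
      then have "z \<in> ?S" using \<gamma>(3) by blast
      from integral_unique[OF Ln_resolvent_identity[OF dom invS(2,1)[OF this], of x y]]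
      show "N z + cinner (adj L *\<^sub>V x) (?R z *\<^sub>V y) = Ln z * cinner x (?R z *\<^sub>V y)"
        by (simp add: N_def L_def cinner_adj_left del: adj_mult)
    qed
    then have "cinner x (integral {0..1} ?I *\<^sub>V y) = 2 * of_real pi * \<i> * cinner x (L *\<^sub>V y)"
      using has_contour_integral_unique[OF 1] by (simp add: cinner_adj_left)
    then show "cinner x (op_log T *\<^sub>V y) = cinner x (L *\<^sub>V y)"
      unfolding log by (simp add: cinner_scaleC_right)
  qed
qed


section \<open>The operator exponential\<close>

lemma power_minus_bop: "(- X) ^ n = (- 1) ^ n *\<^sub>R (X ^ n :: 'h::complex_hilbert bop)"
  by (induction n) simp_all

lemma summable_norm_op_exp: "summable (\<lambda>n. norm (X ^ n /\<^sub>R fact n :: 'h::complex_hilbert bop))"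
proof (rule summable_comparison_test'[where N = 0])
  show "summable (\<lambda>n. inverse (fact n) * norm X ^ n)" by (rule summable_exp)
  show "norm (norm (X ^ n /\<^sub>R fact n)) \<le> inverse (fact n) * norm X ^ n" for n
    by (simp add: mult_left_mono norm_power_bop_le)
qed

lemma op_exp_LIMSEQ: "(\<lambda>N. \<Sum>n<N. X ^ n /\<^sub>R fact n) \<longlonglongrightarrow> op_exp X"
  unfolding op_exp_def by (rule summable_LIMSEQ[OF summable_norm_cancel[OF summable_norm_op_exp]])

lemma op_exp_minus: "op_exp X * op_exp (- X) = 1"
proof -
  have "(\<Sum>i\<le>k. (X ^ i /\<^sub>R fact i) * ((- X) ^ (k - i) /\<^sub>R fact (k - i))) = (if k = 0 then 1 else 0)" for k
  proof -
    have "(\<Sum>i\<le>k. (X ^ i /\<^sub>R fact i) * ((- X) ^ (k - i) /\<^sub>R fact (k - i)))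
        = (\<Sum>i\<le>k. (inverse (fact k) * (real (k choose i) * 1 ^ i * (- 1) ^ (k - i))) *\<^sub>R X ^ k)"
    proof (rule sum.cong[OF refl])
      fix i assume "i \<in> {..k}"
      then have i: "i \<le> k" by simp
      have "inverse (fact i) * (inverse (fact (k - i)) * (- 1) ^ (k - i)) = inverse (fact k) * (real (k choose i) * 1 ^ i * (- 1) ^ (k - i))"
        using binomial_fact[OF i, where 'a = real] by (simp add: field_simps)
      moreover have "X ^ i * X ^ (k - i) = X ^ k" using i by (simp flip: power_add)
      moreover have "(X ^ i /\<^sub>R fact i) * ((- X) ^ (k - i) /\<^sub>R fact (k - i))
          = (inverse (fact i) * (inverse (fact (k - i)) * (- 1) ^ (k - i))) *\<^sub>R (X ^ i * X ^ (k - i))"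
        by (simp add: power_minus_bop mult_ac)
      ultimately show "(X ^ i /\<^sub>R fact i) * ((- X) ^ (k - i) /\<^sub>R fact (k - i))
          = (inverse (fact k) * (real (k choose i) * 1 ^ i * (- 1) ^ (k - i))) *\<^sub>R X ^ k"
        by (simp only:)
    qed
    also have "\<dots> = (inverse (fact k) * (1 + (- 1)) ^ k) *\<^sub>R X ^ k"
      unfolding binomial_ring by (simp only: scaleR_sum_left sum_distrib_left)
    finally show ?thesis by simp
  qed
  then have "(\<lambda>k. if k = 0 then 1 else 0) sums (op_exp X * op_exp (- X))"
    using Cauchy_product_sums[OF summable_norm_op_exp[of X] summable_norm_op_exp[of "- X"]]
    by (simp only: op_exp_def)
  then show ?thesis using sums_single[of 0 "\<lambda>_. 1 :: 'a bop"] sums_unique2 by fastforce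
qed

lemma adj_op_exp: "adj (op_exp X) = op_exp (adj X)"
proof -
  have "adj (op_exp X) = (\<Sum>n. adj (X ^ n /\<^sub>R fact n))"
    unfolding op_exp_def
    by (rule bounded_linear.suminf[OF bounded_linear_adj summable_norm_cancel[OF summable_norm_op_exp]])
  then show ?thesis by (simp add: op_exp_def)
qed

lemma op_exp_selfadjoint:
  assumes "selfadjoint A"
  shows "adj (op_exp (\<i> *\<^sub>C A)) = op_exp ((- \<i>) *\<^sub>C A)"
    and "op_exp (\<i> *\<^sub>C A) * op_exp ((- \<i>) *\<^sub>C A) = 1" "op_exp ((- \<i>) *\<^sub>C A) * op_exp (\<i> *\<^sub>C A) = 1"
  using assms op_exp_minus[of "\<i> *\<^sub>C A"] op_exp_minus[of "(- \<i>) *\<^sub>C A"]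
  by (simp_all add: adj_op_exp selfadjoint_def scaleC_minus_left)


section \<open>Commutators\<close>

lemma commutator_anticommute: "commutator Y X = - commutator X Y"
  by (simp add: commutator_def)

lemma commutator_mult_left: "commutator (X * Z) Y = X * commutator Z Y + commutator X Y * Z"
  by (simp add: commutator_def left_diff_distrib right_diff_distrib mult.assoc)

lemma trace_norm_le_commutator_power:
  assumes c: "trace_norm_le (commutator X Y) c" and m: "norm X \<le> m" "1 \<le> m"
  shows "trace_norm_le (commutator (X ^ n) Y) (real n * m ^ n * c)"
proof (induction n)
  case 0
  then show ?case by (simp add: commutator_def trace_norm_le_zero)
next
  case (Suc n)
  have c0: "0 \<le> c" by (rule trace_norm_le_nonneg[OF c])
  have "norm (X ^ n) \<le> m ^ n" by (rule order_trans[OF norm_power_bop_le power_mono[OF m(1) norm_ge_zero]])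
  also have "\<dots> \<le> m ^ Suc n" using m(2) by simp
  finally have "norm (X ^ n) * c \<le> m ^ Suc n * c" using c0 by (rule mult_right_mono)
  moreover have "norm X * (real n * m ^ n * c) \<le> m * (real n * m ^ n * c)"
    using m c0 by (intro mult_right_mono mult_nonneg_nonneg) auto
  ultimately have "norm X * (real n * m ^ n * c) + norm (X ^ n) * c \<le> real (Suc n) * m ^ Suc n * c"
    by (simp add: algebra_simps)
  from trace_norm_le_mono[OF trace_norm_le_add[OF trace_norm_le_mult_left[OF Suc] trace_norm_le_mult_right[OF c]] this]
  show ?case by (simp add: commutator_mult_left)
qed

lemma trace_class_commutator_op_exp:
  assumes "trace_class (commutator X Y)"
  shows "trace_class (commutator (op_exp X) Y)"
proof -
  obtain c where c: "trace_norm_le (commutator X Y) c" using assms trace_norm_le_if_trace_class by blast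
  have c0: "0 \<le> c" by (rule trace_norm_le_nonneg[OF c])
  define m where "m = max 1 (norm X)"
  have m: "norm X \<le> m" "1 \<le> m" by (auto simp: m_def)
  have summand: "trace_norm_le (commutator (X ^ n /\<^sub>R fact n) Y) (inverse (fact n) * (2 * m) ^ n * c)" for n
  proof -
    have "commutator (X ^ n /\<^sub>R fact n) Y = inverse (fact n) *\<^sub>R commutator (X ^ n) Y"
      by (simp add: commutator_def scaleR_diff_right)
    moreover have "\<bar>inverse (fact n)\<bar> * (real n * m ^ n * c) \<le> inverse (fact n) * (2 * m) ^ n * c"
    proof -
      have "real n \<le> 2 ^ n" using of_nat_less_two_power[of n, where 'a = real] by simp
      then have "real n * m ^ n * c \<le> 2 ^ n * m ^ n * c" using m c0 by (intro mult_right_mono) auto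
      then show ?thesis by (simp add: power_mult_distrib mult.assoc)
    qed
    ultimately show ?thesis
      using trace_norm_le_mono[OF trace_norm_le_scaleR[OF trace_norm_le_commutator_power[OF c m]]] by simp
  qed
  have "trace_norm_le (commutator (\<Sum>n<N. X ^ n /\<^sub>R fact n) Y) (exp (2 * m) * c)" for N
  proof -
    have "commutator (\<Sum>n<N. X ^ n /\<^sub>R fact n) Y = (\<Sum>n<N. commutator (X ^ n /\<^sub>R fact n) Y)"
      unfolding commutator_def sum_subtractf sum_distrib_left sum_distrib_right ..
    moreover have "trace_norm_le (\<Sum>n<N. commutator (X ^ n /\<^sub>R fact n) Y) (\<Sum>n<N. inverse (fact n) * (2 * m) ^ n * c)"
      by (rule trace_norm_le_sum) (rule summand)
    moreover have "(\<Sum>n<N. inverse (fact n) * (2 * m) ^ n * c) \<le> exp (2 * m) * c"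
    proof -
      have "(\<Sum>n<N. inverse (fact n) * (2 * m) ^ n) \<le> exp (2 * m)"
      proof -
        have "(\<Sum>n<N. inverse (fact n) * (2 * m) ^ n) \<le> (\<Sum>n. inverse (fact n) * (2 * m) ^ n)"
          by (rule sum_le_suminf[OF summable_exp]) (use m in auto)
        then show ?thesis by (simp add: exp_def)
      qed
      then show ?thesis unfolding sum_distrib_right[symmetric] using c0 by (rule mult_right_mono)
    qed
    ultimately show ?thesis using trace_norm_le_mono by simp
  qed
  moreover have "(\<lambda>N. commutator (\<Sum>n<N. X ^ n /\<^sub>R fact n) Y) \<longlonglongrightarrow> commutator (op_exp X) Y"
    unfolding commutator_def by (intro tendsto_intros op_exp_LIMSEQ)
  ultimately have "trace_norm_le (commutator (op_exp X) Y) (exp (2 * m) * c)" by (rule trace_norm_le_limit)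
  then show ?thesis by (rule trace_class_if_trace_norm_le)
qed

lemma trace_class_commutator_op_exps:
  assumes "trace_class (commutator X Y)"
  shows "trace_class (commutator (op_exp X) (op_exp Y))"
proof -
  have "trace_class (commutator Y (op_exp X))"
    unfolding commutator_anticommute[of Y] by (intro trace_class_minus trace_class_commutator_op_exp assms)
  from trace_class_commutator_op_exp[OF this] show ?thesis
    unfolding commutator_anticommute[of "op_exp X"] by (rule trace_class_minus)
qed

lemma norm_unitary_le:
  assumes "unitary U"
  shows "norm U \<le> 1"
proof (rule norm_bop_le)
  fix x
  have "cinner (U *\<^sub>V x) (U *\<^sub>V x) = cinner x ((adj U * U) *\<^sub>V x)" by (simp add: cinner_adj_right)
  also have "(adj U * U) *\<^sub>V x = x" using assms by (simp add: unitary_def del: bop_apply_simps(6))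
  finally have "cinner (U *\<^sub>V x) (U *\<^sub>V x) = cinner x x" .
  then have "(norm (U *\<^sub>V x))\<^sup>2 = (norm x)\<^sup>2" by (simp only: cinner_self of_real_eq_iff)
  then show "norm (U *\<^sub>V x) \<le> 1 * norm x" by (simp add: power2_eq_iff_nonneg)
qed simp

lemma unitary_mult: "unitary U \<Longrightarrow> unitary V \<Longrightarrow> unitary (U * V)"
  unfolding unitary_def by (simp add: mult.assoc) (simp add: mult.assoc[symmetric])

lemma norm_mult_contraction:
  fixes X U :: "'h::complex_hilbert bop"
  assumes "norm U \<le> 1"
  shows "norm (X * U) \<le> norm X" "norm (U * X) \<le> norm X"
  using norm_mult_ineq[of X U] mult_left_mono[OF assms norm_ge_zero[of X]]
    norm_mult_ineq[of U X] mult_right_mono[OF assms norm_ge_zero[of X]] by linarith+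


section \<open>Additivity\<close>

lemma log_domain_small: "norm K < 1 \<Longrightarrow> log_domain K"
  using log_domain_product(1)[of "norm K" K 0] by simp

lemma op_trace_log_conj:
  assumes dom: "log_domain K" and U: "U * U' = 1" "U' * U = 1" and tc: "trace_class K"
  shows "trace_log (U * K * U') = trace_log K"
proof -
  have *: "res (U * K * U') s = U * res K s * U'" if s: "s \<in> {0..1}" for s
    unfolding res_def[of "U * K * U'"]
  proof (rule op_inverse_eqI)
    have eq: "1 + s *\<^sub>R (U * K * U') = U * (1 + s *\<^sub>R K) * U'"
      by (simp add: distrib_left distrib_right U)
    have "U * res K s * U' * (U * (1 + s *\<^sub>R K) * U') = U * (res K s * ((U' * U) * (1 + s *\<^sub>R K))) * U'"
      by (simp only: mult.assoc)
    then show "U * res K s * U' * (1 + s *\<^sub>R (U * K * U')) = 1"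
      unfolding eq by (simp only: U mult_1_left mult_1_right res_inverse[OF dom s])
    have "U * (1 + s *\<^sub>R K) * U' * (U * res K s * U') = U * ((1 + s *\<^sub>R K) * ((U' * U) * res K s)) * U'"
      by (simp only: mult.assoc)
    then show "(1 + s *\<^sub>R (U * K * U')) * (U * res K s * U') = 1"
      unfolding eq by (simp only: U mult_1_left mult_1_right res_inverse[OF dom s])
  qed
  have "bounded_linear (\<lambda>X. U * X * U')"
    by (rule bounded_linear_compose[OF bounded_linear_mult_left bounded_linear_mult_right])
  from has_integral_linear[OF integrable_integral[OF integrable_res[OF dom]] this]
  have "((\<lambda>s. U * res K s * U') has_integral U * res_integral K * U') {0..1}"
    by (simp add: o_def res_integral_def)
  then have "(res (U * K * U') has_integral U * res_integral K * U') {0..1}"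
    by (rule has_integral_eq[rotated]) (simp add: *)
  then have ri: "res_integral (U * K * U') = U * res_integral K * U'"
    unfolding res_integral_def by (rule integral_unique)
  have "(U * K * U') * res_integral (U * K * U') = U * (K * ((U' * U) * res_integral K)) * U'"
    unfolding ri by (simp only: mult.assoc)
  also have "\<dots> = U * (K * res_integral K * U')" by (simp only: U mult_1_left mult.assoc)
  also have "op_trace \<dots> = op_trace (K * res_integral K * U' * U)"
    by (intro op_trace_commute trace_class_mult_right tc)
  finally show ?thesis by (simp add: mult.assoc U)
qed

theorem op_trace_log_commutator_mult:
  fixes U V W :: "'h::complex_hilbert bop"
  assumes uni: "unitary U" "unitary V" "unitary W"
    and tc: "trace_class (commutator U W)" "trace_class (commutator V W)"
    and small: "norm (commutator U W) < 1" "norm (commutator V W) < 1"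
  shows "op_trace (op_log (U * V * W * adj V * adj U * adj W))
    = op_trace (op_log (U * W * adj U * adj W)) + op_trace (op_log (V * W * adj V * adj W))"
proof -
  have id: "X * adj X = 1" "adj X * X = 1" "norm X \<le> 1" "norm (adj X) \<le> 1" if "unitary X" for X :: "'h bop"
    using that norm_unitary_le by (simp_all add: unitary_def)
  have comm: "X * W * adj X * adj W - 1 = commutator X W * adj X * adj W" if "unitary X" for X
  proof -
    have "W * X * adj X * adj W = W * (X * adj X) * adj W" by (simp only: mult.assoc)
    then show ?thesis by (simp add: commutator_def left_diff_distrib id[OF that] id[OF uni(3)])
  qed
  define K where "K = V * W * adj V * adj W - 1"
  define J where "J = U * W * adj U * adj W - 1"
  define K' where "K' = U * K * adj U"
  have K: "trace_class K" "norm K < 1"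
    unfolding K_def comm[OF uni(2)] using tc(2) small(2)
      norm_mult_contraction(1)[OF id(4)[OF uni(3)], of "commutator V W * adj V"]
      norm_mult_contraction(1)[OF id(4)[OF uni(2)], of "commutator V W"]
    by (auto intro: trace_class_mult_right)
  have J: "trace_class J" "norm J < 1"
    unfolding J_def comm[OF uni(1)] using tc(1) small(1)
      norm_mult_contraction(1)[OF id(4)[OF uni(3)], of "commutator U W * adj U"]
      norm_mult_contraction(1)[OF id(4)[OF uni(1)], of "commutator U W"]
    by (auto intro: trace_class_mult_right)
  have K': "trace_class K'" "norm K' < 1"
    unfolding K'_def using K
      norm_mult_contraction(1)[OF id(4)[OF uni(1)], of "U * K"]
      norm_mult_contraction(2)[OF id(3)[OF uni(1)], of K]
    by (auto intro: trace_class_mult_right trace_class_mult_left)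
  define L where "L = (1 + K') * (1 + J) - 1"
  have "1 + K' = U * (1 + K) * adj U"
    by (simp add: K'_def distrib_left distrib_right id[OF uni(1)])
  then have "1 + L = U * (V * W * adj V * adj W) * adj U * (U * W * adj U * adj W)"
    by (simp add: L_def J_def K_def)
  also have "\<dots> = U * V * W * adj V * (adj W * ((adj U * U) * W)) * adj U * adj W" by (simp only: mult.assoc)
  finally have L: "U * V * W * adj V * adj U * adj W = 1 + L" by (simp add: id uni)
  have "log_domain L"
    unfolding L_def
    by (rule log_domain_product(1)[of "max (norm K') (norm J)"]) (use K'(2) J(2) in \<open>auto simp: le_max_iff_disj\<close>)
  then have "op_log (1 + L) = L * res_integral L" using op_log_eq_integral[of "1 + L"] by simp
  moreover have "op_log (U * W * adj U * adj W) = J * res_integral J"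
    using op_log_eq_integral[of "U * W * adj U * adj W"] log_domain_small[OF J(2)] by (simp add: J_def)
  moreover have "op_log (V * W * adj V * adj W) = K * res_integral K"
    using op_log_eq_integral[of "V * W * adj V * adj W"] log_domain_small[OF K(2)] by (simp add: K_def)
  moreover have "trace_log K' = trace_log K"
    unfolding K'_def by (intro op_trace_log_conj log_domain_small K id uni)
  ultimately show ?thesis
    using op_trace_log_mult[OF K'(2) J(2) K'(1) J(1)] unfolding L L_def by simp
qed

lemma bott_pairI:
  assumes "unitary U" "unitary W" "trace_class ((U - 1) * (W - 1))" "trace_class (commutator U W)"
    "norm (commutator U W) < 2"
  shows "bott_pair U W"
proof -
  have "(W - 1) * (U - 1) = (U - 1) * (W - 1) - commutator U W"
    by (simp add: commutator_def left_diff_distrib right_diff_distrib)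
  then show ?thesis unfolding bott_pair_def using assms trace_class_diff by simp
qed

theorem bott_mult:
  assumes uni: "unitary U" "unitary V" "unitary W"
    and tc: "trace_class (commutator U W)" "trace_class (commutator V W)"
    and small: "norm (commutator U W) < 1" "norm (commutator V W) < 1"
    and tc1: "trace_class ((U - 1) * (W - 1))" "trace_class ((V - 1) * (W - 1))"
  shows "bott (U * V) W = bott U W + bott V W"
proof -
  have "bott_pair U W" "bott_pair V W"
    using small by (intro bott_pairI uni tc tc1; simp)+
  moreover have "bott_pair (U * V) W"
  proof (rule bott_pairI[OF unitary_mult[OF uni(1,2)] uni(3)])
    have "(U * V - 1) * (W - 1) = U * ((V - 1) * (W - 1)) + (U - 1) * (W - 1)"
      by (simp add: left_diff_distrib right_diff_distrib mult.assoc)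
    then show "trace_class ((U * V - 1) * (W - 1))" by (simp add: trace_class_add trace_class_mult_left tc1)
    show "trace_class (commutator (U * V) W)"
      unfolding commutator_mult_left by (intro trace_class_add trace_class_mult_left trace_class_mult_right tc)
    show "norm (commutator (U * V) W) < 2"
      unfolding commutator_mult_left
      using norm_triangle_ineq[of "U * commutator V W" "commutator U W * V"] small
        norm_mult_contraction(2)[OF norm_unitary_le[OF uni(1)], of "commutator V W"]
        norm_mult_contraction(1)[OF norm_unitary_le[OF uni(2)], of "commutator U W"] by linarith
  qed
  ultimately show ?thesis
    using op_trace_log_commutator_mult[OF uni tc small]
    by (simp add: bott_def distrib_left mult.assoc)
qed

theorem theorem4:
  fixes A B C :: "'h::complex_hilbert bop"
  assumes "separable_space (euclidean :: 'h topology)"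
    and "selfadjoint A" and "selfadjoint B" and "selfadjoint C"
    and "trace_class (commutator A C)" and "trace_class (commutator B C)"
    and "\<And>t::real. t \<in> {0..1} \<Longrightarrow>
           norm (commutator (op_exp ((\<i> * of_real t) *\<^sub>C A)) (op_exp ((\<i> * of_real t) *\<^sub>C C))) < 1"
    and "\<And>t::real. t \<in> {0..1} \<Longrightarrow>
           norm (commutator (op_exp ((\<i> * of_real t) *\<^sub>C B)) (op_exp ((\<i> * of_real t) *\<^sub>C C))) < 1"
  shows "op_trace (op_log (op_exp (\<i> *\<^sub>C A) * op_exp (\<i> *\<^sub>C B) * op_exp (\<i> *\<^sub>C C) *
                           op_exp ((-\<i>) *\<^sub>C B) * op_exp ((-\<i>) *\<^sub>C A) * op_exp ((-\<i>) *\<^sub>C C)))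
       = op_trace (op_log (op_exp (\<i> *\<^sub>C A) * op_exp (\<i> *\<^sub>C C) *
                           op_exp ((-\<i>) *\<^sub>C A) * op_exp ((-\<i>) *\<^sub>C C)))
       + op_trace (op_log (op_exp (\<i> *\<^sub>C B) * op_exp (\<i> *\<^sub>C C) *
                           op_exp ((-\<i>) *\<^sub>C B) * op_exp ((-\<i>) *\<^sub>C C)))
       \<and> (trace_class ((op_exp (\<i> *\<^sub>C A) - 1) * (op_exp (\<i> *\<^sub>C C) - 1)) \<and>
          trace_class ((op_exp (\<i> *\<^sub>C B) - 1) * (op_exp (\<i> *\<^sub>C C) - 1)) \<longrightarrow>
          bott (op_exp (\<i> *\<^sub>C A) * op_exp (\<i> *\<^sub>C B)) (op_exp (\<i> *\<^sub>C C))
          = bott (op_exp (\<i> *\<^sub>C A)) (op_exp (\<i> *\<^sub>C C)) + bott (op_exp (\<i> *\<^sub>C B)) (op_exp (\<i> *\<^sub>C C)))"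
proof -
  have uni: "unitary (op_exp (\<i> *\<^sub>C X))" if "selfadjoint X" for X :: "'h bop"
    unfolding unitary_def op_exp_selfadjoint(1)[OF that] by (intro conjI op_exp_selfadjoint(2,3) that)
  have tc: "trace_class (commutator (op_exp (\<i> *\<^sub>C X)) (op_exp (\<i> *\<^sub>C C)))"
    if "trace_class (commutator X C)" for X
  proof (rule trace_class_commutator_op_exps)
    have "commutator (\<i> *\<^sub>C X) (\<i> *\<^sub>C C) = - commutator X C"
      by (simp add: commutator_def scaleC_scaleC scaleC_minus_left)
    then show "trace_class (commutator (\<i> *\<^sub>C X) (\<i> *\<^sub>C C))" using trace_class_minus[OF that] by simp
  qed
  have small: "norm (commutator (op_exp (\<i> *\<^sub>C A)) (op_exp (\<i> *\<^sub>C C))) < 1"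
    "norm (commutator (op_exp (\<i> *\<^sub>C B)) (op_exp (\<i> *\<^sub>C C))) < 1"
    using assms(7)[of 1] assms(8)[of 1] by simp_all
  note hyps = uni[OF assms(2)] uni[OF assms(3)] uni[OF assms(4)] tc[OF assms(5)] tc[OF assms(6)] small
  show ?thesis
    using op_trace_log_commutator_mult[OF hyps] bott_mult[OF hyps]
    unfolding op_exp_selfadjoint(1)[OF assms(2)] op_exp_selfadjoint(1)[OF assms(3)] op_exp_selfadjoint(1)[OF assms(4)]
    by blast
qed

end
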